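(* Let $a,b,c$ be independent generic elements of $P$, $d=(1-ac)/b$, and $u,v,r,s\in K$ with $cu+dv+ar+bs=0$ (so $((a,u),(b,v),(c,r),(d,s))$ lies in $P_W$ for $W\subseteq K^4$ the variety $xz+yw=1$). Let $q$ be the strong type over $\emptyset$ of $((a,u),(b,v),(c,r),(d,s))$. Working in the $\emptyset$-definable group $(S^4,+)$, the stabilizer $Stab(q)$ is trivial, but $q$ is not almost internal to $P$.
   Context: Let $K$ be a saturated algebraically closed field of characteristic $0$. $M$ is the two-sorted structure $(P,S)$ where $P=K$ carries its full field structure and $S=K\times K$, with the following additional basic functions and relations: the projection $\pi:S\to P$, $\pi(a,b)=a$; the action $*:P\times S\to S$, $a*(b,c)=(b,c+a)$; and for each irreducible affine variety $W\subseteq K^n$ defined over $\mathbb{Q}^{alg}$, a predicate $P_W\subseteq S^n$ for its tangent bundle, namely the set of $((x_1,u_1),\dots,(x_n,u_n))$ such that $Q(\bar x)=0$ and $\sum_{i=1}^n\frac{\partial Q}{\partial x_i}(\bar x)u_i=0$ for all $Q$ in a generating set of the ideal of $W$ over $K$. The addition on $S$ is coordinatewise addition on $K\times K$; it is $\emptyset$-definable in $M$ (its graph is $P_W$ for $W$ the graph of addition on $K$), and $(S^4,+)$ is the product group. For a strong type $q$ in a definable group $G$, $Stab(q)=\{g\in G:$ for some (any) $x$ realizing $q$ independent from $g$, $g+x$ realizes $q\}$. A type is almost internal to $P$ if some realization of a nonforking extension over a set $B$ lies in $acl(B,f)$ for a tuple $f$ from $P$. *)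

theory Defs
  imports
    "HOL-Computational_Algebra.Computational_Algebra"
    "HOL-Library.Poly_Mapping"
    "HOL-Library.Product_Plus"
    "HOL-Library.Equipollence"
    "HOL-Algebra.Group"
begin

section \<open>First-order structures\<close>

text \<open>
  Structures are relational: a function of the language is represented by its graph, and the
  sorts of a many-sorted structure by unary predicates partitioning the universe \<^typ>\<open>'u\<close>.
  This changes neither the definable sets nor anything defined from them.  A structure
  interprets every symbol on argument lists of all lengths; it is empty on lists of the wrong
  length or with elements of the wrong sort.
\<close>

type_synonym ('r, 'u) struct = "'r \<Rightarrow> 'u list \<Rightarrow> bool"

datatype 'r fm =
    Eq nat nat
  | Rel 'r "nat list"
  | Neg "'r fm"
  | Conj "'r fm" "'r fm"
  | Ex nat "'r fm"

primrec fv :: "'r fm \<Rightarrow> nat set" where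
  "fv (Eq i j) = {i, j}"
| "fv (Rel R is) = set is"
| "fv (Neg \<phi>) = fv \<phi>"
| "fv (Conj \<phi> \<psi>) = fv \<phi> \<union> fv \<psi>"
| "fv (Ex i \<phi>) = fv \<phi> - {i}"

primrec sat :: "('r, 'u) struct \<Rightarrow> (nat \<Rightarrow> 'u) \<Rightarrow> 'r fm \<Rightarrow> bool" where
  "sat I v (Eq i j) \<longleftrightarrow> v i = v j"
| "sat I v (Rel R is) \<longleftrightarrow> I R (map v is)"
| "sat I v (Neg \<phi>) \<longleftrightarrow> \<not> sat I v \<phi>"
| "sat I v (Conj \<phi> \<psi>) \<longleftrightarrow> sat I v \<phi> \<and> sat I v \<psi>"
| "sat I v (Ex i \<phi>) \<longleftrightarrow> (\<exists>y. sat I (v(i := y)) \<phi>)"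

text \<open>
  The subsets of the \<open>n\<close>-th power of the universe definable with parameters from \<open>A\<close>.  Variables
  \<open>0, \<dots>, n - 1\<close> are the free ones and the following ones stand for the parameters \<open>ps\<close>; by the
  condition on \<^const>\<open>fv\<close>, values of \<^const>\<open>nth\<close> outside the list are never used.
\<close>

definition definable :: "('r, 'u) struct \<Rightarrow> 'u set \<Rightarrow> nat \<Rightarrow> 'u list set set" where
  "definable I A n =
     {{xs. length xs = n \<and> sat I (nth (xs @ ps)) \<phi>} | \<phi> ps.
        set ps \<subseteq> A \<and> fv \<phi> \<subseteq> {..<n + length ps}}"

definition small :: "'u set \<Rightarrow> bool" where
  "small A \<longleftrightarrow> A \<prec> (UNIV :: 'u set)"

definition saturated :: "('r, 'u) struct \<Rightarrow> bool" where
  "saturated I \<longleftrightarrow>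
     (\<forall>A. small A \<longrightarrow>
        (\<forall>p \<subseteq> definable I A 1. (\<forall>F \<subseteq> p. finite F \<longrightarrow> \<Inter>F \<noteq> {}) \<longrightarrow> \<Inter>p \<noteq> {}))"

definition acl :: "('r, 'u) struct \<Rightarrow> 'u set \<Rightarrow> 'u set" where
  "acl I A = {x. \<exists>D \<in> definable I A 1. finite D \<and> [x] \<in> D}"

definition same_type :: "('r, 'u) struct \<Rightarrow> 'u set \<Rightarrow> 'u list \<Rightarrow> 'u list \<Rightarrow> bool" where
  "same_type I A x y \<longleftrightarrow>
     length x = length y \<and> (\<forall>D \<in> definable I A (length x). x \<in> D \<longleftrightarrow> y \<in> D)"

definition finite_equiv_rels ::
    "('r, 'u) struct \<Rightarrow> 'u set \<Rightarrow> nat \<Rightarrow> ('u list \<times> 'u list) set set" where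
  "finite_equiv_rels I A n =
     {E. equiv {xs. length xs = n} E \<and> finite ({xs. length xs = n} // E) \<and>
         {x @ y | x y. (x, y) \<in> E} \<in> definable I A (n + n)}"

text \<open>
  The strong type of a tuple over \<open>A\<close> (equivalently, its type over the imaginary algebraic closure
  of \<open>A\<close>), identified with the set of its realizations.
\<close>

definition strong_type :: "('r, 'u) struct \<Rightarrow> 'u set \<Rightarrow> 'u list \<Rightarrow> 'u list set" where
  "strong_type I A x = {y. \<forall>E \<in> finite_equiv_rels I A (length x). (x, y) \<in> E}"

section \<open>Forking\<close>

text \<open>
  A formula without parameters in the variables \<open>(x, y)\<close>, where \<open>x\<close> has length \<open>n\<close>, is represented
  by the set \<open>D\<close> it defines; \<open>fibre D n b\<close> is the set defined by its instance \<open>\<phi>(x, b)\<close>.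
\<close>

definition fibre :: "'u list set \<Rightarrow> nat \<Rightarrow> 'u list \<Rightarrow> 'u list set" where
  "fibre D n b = {x. length x = n \<and> x @ b \<in> D}"

definition divides ::
    "('r, 'u) struct \<Rightarrow> 'u set \<Rightarrow> nat \<Rightarrow> 'u list set \<Rightarrow> bool" where
  "divides I A n X \<longleftrightarrow>
     (\<exists>m b. \<exists>D \<in> definable I {} (n + m). length b = m \<and> X = fibre D n b \<and>
        (\<exists>(k::nat) (bs :: nat \<Rightarrow> 'u list).
           (\<forall>i. same_type I A b (bs i)) \<and>
           (\<forall>J. finite J \<and> card J = k \<longrightarrow> (\<Inter>j\<in>J. fibre D n (bs j)) = {})))"

definition forks ::
    "('r, 'u) struct \<Rightarrow> 'u set \<Rightarrow> nat \<Rightarrow> 'u list set \<Rightarrow> bool" where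
  "forks I A n X \<longleftrightarrow> (\<exists>F. finite F \<and> (\<forall>Y \<in> F. divides I A n Y) \<and> X \<subseteq> \<Union>F)"

text \<open>
  \<open>indep I A x B\<close>: the tuple \<open>x\<close> is independent from \<open>B\<close> over \<open>A\<close>, i.e. its type over \<open>A \<union> B\<close> does
  not fork over \<open>A\<close>.
\<close>

definition indep ::
    "('r, 'u) struct \<Rightarrow> 'u set \<Rightarrow> 'u list \<Rightarrow> 'u set \<Rightarrow> bool" where
  "indep I A x B \<longleftrightarrow>
     (\<forall>X \<in> definable I (A \<union> B) (length x). x \<in> X \<longrightarrow> \<not> forks I A (length x) X)"

definition independent_family :: "('r, 'u) struct \<Rightarrow> 'u set \<Rightarrow> 'u list \<Rightarrow> bool" where
  "independent_family I A xs \<longleftrightarrow>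
     (\<forall>i < length xs. indep I A [xs ! i] {xs ! j | j. j < length xs \<and> j \<noteq> i})"

text \<open>
  In the following two definitions \<open>q\<close> is (the set of realizations of) a strong type over \<open>A\<close>.
  A realization of a nonforking extension of \<open>q\<close> over \<open>B\<close> is a realization of \<open>q\<close> independent
  from \<open>B\<close> over \<open>A\<close>.
\<close>

definition Stab ::
    "('r, 'u) struct \<Rightarrow> 'u set \<Rightarrow> 'u list monoid \<Rightarrow> 'u list set \<Rightarrow> 'u list set" where
  "Stab I A G q =
     {g \<in> carrier G. \<exists>x \<in> q. x \<in> carrier G \<and> indep I A x (set g) \<and> g \<otimes>\<^bsub>G\<^esub> x \<in> q}"

definition almost_internal ::
    "('r, 'u) struct \<Rightarrow> 'u set \<Rightarrow> 'u set \<Rightarrow> 'u list set \<Rightarrow> bool" where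
  "almost_internal I A Q q \<longleftrightarrow>
     (\<exists>B. small B \<and> (\<exists>x \<in> q. indep I A x B \<and>
        (\<exists>f. set f \<subseteq> Q \<and> set x \<subseteq> acl I (A \<union> B \<union> set f))))"

section \<open>Affine varieties and their tangent bundles\<close>

text \<open>
  Polynomials in variables indexed by \<^typ>\<open>nat\<close>, as finitely supported functions from exponent
  vectors to coefficients; points of affine \<open>n\<close>-space are lists of length \<open>n\<close>.
\<close>

type_synonym 'k mpoly = "(nat \<Rightarrow>\<^sub>0 nat) \<Rightarrow>\<^sub>0 'k"

definition in_vars :: "nat \<Rightarrow> 'k::zero mpoly \<Rightarrow> bool" where
  "in_vars n Q \<longleftrightarrow> (\<forall>m \<in> Poly_Mapping.keys Q. Poly_Mapping.keys m \<subseteq> {..<n})"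

definition eval_mpoly :: "'k::comm_ring_1 mpoly \<Rightarrow> 'k list \<Rightarrow> 'k" where
  "eval_mpoly Q x =
     (\<Sum>m \<in> Poly_Mapping.keys Q. Poly_Mapping.lookup Q m *
        (\<Prod>i \<in> Poly_Mapping.keys m. (x ! i) ^ Poly_Mapping.lookup m i))"

text \<open>
  If variable \<open>i\<close> does not occur in the monomial \<open>m\<close>, the truncated difference below is harmless
  because the coefficient is \<open>0\<close>.
\<close>

definition partial_deriv :: "nat \<Rightarrow> 'k::comm_ring_1 mpoly \<Rightarrow> 'k mpoly" where
  "partial_deriv i Q =
     (\<Sum>m \<in> Poly_Mapping.keys Q. Poly_Mapping.single (m - Poly_Mapping.single i 1)
        (of_nat (Poly_Mapping.lookup m i) * Poly_Mapping.lookup Q m))"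

definition zero_set :: "nat \<Rightarrow> 'k::comm_ring_1 mpoly set \<Rightarrow> 'k list set" where
  "zero_set n F = {x. length x = n \<and> (\<forall>Q \<in> F. eval_mpoly Q x = 0)}"

definition zariski_closed :: "nat \<Rightarrow> 'k::comm_ring_1 list set \<Rightarrow> bool" where
  "zariski_closed n V \<longleftrightarrow> (\<exists>F. (\<forall>Q \<in> F. in_vars n Q) \<and> V = zero_set n F)"

definition irreducible_variety :: "nat \<Rightarrow> 'k::comm_ring_1 list set \<Rightarrow> bool" where
  "irreducible_variety n W \<longleftrightarrow> zariski_closed n W \<and> W \<noteq> {} \<and>
     (\<forall>V1 V2. zariski_closed n V1 \<and> zariski_closed n V2 \<and> W = V1 \<union> V2 \<longrightarrow> W = V1 \<or> W = V2)"

text \<open>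
  \<open>Q\<^sup>a\<^sup>l\<^sup>g\<close> is a perfect field, so being the zero set of polynomials over it is the same as having an
  ideal generated by polynomials over it.
\<close>

definition defined_over_Qalg :: "nat \<Rightarrow> 'k::field_char_0 list set \<Rightarrow> bool" where
  "defined_over_Qalg n W \<longleftrightarrow>
     (\<exists>F. (\<forall>Q \<in> F. in_vars n Q \<and> (\<forall>m. algebraic (Poly_Mapping.lookup Q m))) \<and>
          W = zero_set n F)"

definition ideal_of :: "nat \<Rightarrow> 'k::comm_ring_1 list set \<Rightarrow> 'k mpoly set" where
  "ideal_of n W = {Q. in_vars n Q \<and> (\<forall>x \<in> W. eval_mpoly Q x = 0)}"

text \<open>
  By the product rule, it makes no difference whether \<open>Q\<close> ranges over the ideal of \<open>W\<close> or over some
  set of generators.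
\<close>

definition tangent_bundle :: "nat \<Rightarrow> 'k::comm_ring_1 list set \<Rightarrow> ('k \<times> 'k) list set" where
  "tangent_bundle n W =
     {xu. length xu = n \<and>
        (\<forall>Q \<in> ideal_of n W. eval_mpoly Q (map fst xu) = 0 \<and>
           (\<Sum>i<n. eval_mpoly (partial_deriv i Q) (map fst xu) * snd (xu ! i)) = 0)}"

section \<open>The field \<open>K\<close> and the two-sorted structure \<open>M\<close>\<close>

datatype field_sym = Zero | One | Add | Mult

primrec field_struct :: "(field_sym, 'k::field) struct" where
  "field_struct Zero xs \<longleftrightarrow> xs = [0]"
| "field_struct One xs \<longleftrightarrow> xs = [1]"
| "field_struct Add xs \<longleftrightarrow> (\<exists>a b. xs = [a, b, a + b])"
| "field_struct Mult xs \<longleftrightarrow> (\<exists>a b. xs = [a, b, a * b])"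

datatype 'k elem = inP 'k | inS (tvec: "'k \<times> 'k")

abbreviation sort_P :: "'k elem set" where
  "sort_P \<equiv> range inP"

abbreviation sort_S :: "'k elem set" where
  "sort_S \<equiv> range inS"

text \<open>
  The language has a symbol \<open>Tan W\<close> for every set \<open>W\<close> of lists; unless \<open>W\<close> is an irreducible affine
  variety defined over \<open>Q\<^sup>a\<^sup>l\<^sup>g\<close> it is interpreted by the empty relation, so it contributes nothing.
\<close>

datatype 'k M_sym = SortP | SortS | Field field_sym | Proj | Act | Tan "'k list set"

primrec M_struct :: "('k M_sym, 'k::field_char_0 elem) struct" where
  "M_struct SortP xs \<longleftrightarrow> (\<exists>a. xs = [inP a])"
| "M_struct SortS xs \<longleftrightarrow> (\<exists>b. xs = [inS b])"
| "M_struct (Field R) xs \<longleftrightarrow> (\<exists>as. xs = map inP as \<and> field_struct R as)"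
| "M_struct Proj xs \<longleftrightarrow> (\<exists>a b. xs = [inS (a, b), inP a])"
| "M_struct Act xs \<longleftrightarrow> (\<exists>a b c. xs = [inP a, inS (b, c), inS (b, c + a)])"
| "M_struct (Tan W) xs \<longleftrightarrow>
     (\<exists>ts. xs = map inS ts \<and> irreducible_variety (length ts) W \<and>
        defined_over_Qalg (length ts) W \<and> ts \<in> tangent_bundle (length ts) W)"

text \<open>\<open>P\<close> is strongly minimal: its generic elements (over the empty set) are the nonalgebraic ones.\<close>

definition generic_P :: "'k::field_char_0 \<Rightarrow> bool" where
  "generic_P a \<longleftrightarrow> inP a \<notin> acl M_struct {}"

definition S_power :: "nat \<Rightarrow> 'k::ab_group_add elem list monoid" where
  "S_power n =
     \<lparr>carrier = {g. length g = n \<and> set g \<subseteq> sort_S},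
      mult = map2 (\<lambda>x y. inS (tvec x + tvec y)),
      one = replicate n (inS 0)\<rparr>"

end

theory Submission
  imports Defs
begin

text \<open>
  A field automorphism fixing \<open>Q\<^sup>a\<^sup>l\<^sup>g\<close> acts on both coordinates of \<open>S\<close>, and a derivation \<open>D\<close> acts by
  \<open>(a, u) \<mapsto> (a, u + D a)\<close>; both are automorphisms of \<open>M\<close>.  Hence transcendental elements over a
  finite set are conjugate, and if \<open>t\<close> is transcendental over \<open>F\<close> but algebraic over \<open>F\<close> and the
  first coordinates of \<open>x\<close>, the conjugates \<open>t + j\<close> make the algebraic relation between \<open>x\<close> and
  \<open>t\<close> divide.  So independence of \<open>x\<close> from a set implies algebraic independence of first
  coordinates.

  If \<open>x\<close> and \<open>g + x\<close> realize \<open>q\<close> with \<open>x\<close> independent from \<open>g\<close>, subtracting the two equations of the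
  quadric yields a linear relation between the first coordinates of \<open>x\<close> with coefficients the first
  coordinates of \<open>g\<close>.  A generic point of the quadric satisfies none, so these vanish; then the
  tangent equations give a linear relation whose coefficients are the second coordinates of \<open>g\<close>.
  If \<open>q\<close> were almost internal to \<open>P\<close> over \<open>B\<close>, a derivation vanishing on the first coordinates of
  \<open>B\<close> but not on that of \<open>x\<close> would fix \<open>B\<close> and \<open>P\<close> pointwise and move \<open>x\<close> through infinitely many
  positions.

  That \<open>0\<close> stabilizes \<open>q\<close> means that a \<open>\<emptyset>\<close>-definable set containing a generic point does not fork.
  Otherwise one of the dividing sets contains all generic points over its parameters.  This implies
  that it is covered, coordinate by coordinate, up to one translation, which is a first-order
  condition on the parameters, and arbitrarily many sets with this property have a common point.
\<close>

section \<open>Partial homomorphisms\<close>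

text \<open>Partial homomorphisms take values in a ring and not only in a field because one
  extension argument serves twice: with values in K it yields automorphisms, and with values in the
  dual numbers the homomorphisms x + eps D(x) yield derivations D. Automorphisms are not obtained by
  matching transcendence bases, which would need control of cardinalities. Only involutions
  exchanging two independent elements are constructed; dependent elements are conjugated by
  composing two of them. The scalar u is definable from (0, u), because the origin (0, 0) is
  definable, whereas a derivation can move u over a transcendental point. So the first coordinates
  of an element of the stabilizer must vanish before its second coordinates can serve as
  coefficients over which a generic point stays generic. In the last part, the members of a dividing
  sequence are tied to each other only by having the same type, so what is carried along the
  sequence has to be a formula in the parameters. Each of the three free coordinates costs a factor
  2, so 8 k members suffice to find k with a common point.\<close>

definition subring :: "'a::comm_ring_1 set \<Rightarrow> bool" where
  "subring E \<longleftrightarrow> 1 \<in> E \<and> (\<forall>x\<in>E. \<forall>y\<in>E. x - y \<in> E \<and> x * y \<in> E)"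

definition algebraic_over :: "'a::comm_ring_1 set \<Rightarrow> 'a \<Rightarrow> bool" where
  "algebraic_over E x \<longleftrightarrow> (\<exists>p. p \<noteq> 0 \<and> (\<forall>i. coeff p i \<in> E) \<and> poly p x = 0)"

lemma subring_0: "subring E \<Longrightarrow> 0 \<in> E"
  unfolding subring_def by (metis diff_self)

lemma subring_minus: "subring E \<Longrightarrow> x \<in> E \<Longrightarrow> - x \<in> E"
  using subring_0 unfolding subring_def by (metis diff_0)

lemma subring_add: "subring E \<Longrightarrow> x \<in> E \<Longrightarrow> y \<in> E \<Longrightarrow> x + y \<in> E"
  using subring_minus[of E y] unfolding subring_def by (metis diff_minus_eq_add)

lemma algebraic_over_mem:
  assumes "subring E" "x \<in> E"
  shows "algebraic_over E x"
proof -
  have "\<forall>i. coeff [:- x, 1:] i \<in> E"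
    using assms subring_0[OF assms(1)] subring_minus[OF assms]
    by (auto simp: coeff_pCons subring_def split: nat.split)
  moreover have "[:- x, 1:] \<noteq> 0" by simp
  moreover have "poly [:- x, 1:] x = 0" by simp
  ultimately show ?thesis unfolding algebraic_over_def by blast
qed

text \<open>
  A homomorphism from a subring of a field \<open>K\<close> to a commutative ring \<open>T\<close> that maps nonzero
  elements to units, represented by its graph.
\<close>

definition partial_hom :: "('k::field \<times> 't::comm_ring_1) set \<Rightarrow> bool" where
  "partial_hom R \<longleftrightarrow> (1, 1) \<in> R \<and>
     (\<forall>p\<in>R. \<forall>q\<in>R. (fst p - fst q, snd p - snd q) \<in> R \<and> (fst p * fst q, snd p * snd q) \<in> R) \<and>
     (\<forall>p\<in>R. if fst p = 0 then snd p = 0 else snd p dvd 1)"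

definition coeffs_in :: "('k::field \<times> 't::comm_ring_1) set \<Rightarrow> 'k poly \<Rightarrow> 't poly \<Rightarrow> bool" where
  "coeffs_in R p p' \<longleftrightarrow> (\<forall>i. (coeff p i, coeff p' i) \<in> R)"

text \<open>The candidate extension to the generated ring, sending x to y. As a relation it exists
  even if p(x) = 0 does not force p'(y) = 0; that it is a \<open>partial_hom\<close> is what has to
  be proved.\<close>

definition adjoin ::
    "('k::field \<times> 't::comm_ring_1) set \<Rightarrow> 'k \<Rightarrow> 't \<Rightarrow> ('k \<times> 't) set" where
  "adjoin R x y = {(poly p x, poly p' y) | p p'. coeffs_in R p p'}"

lemma adjoinI: "coeffs_in R p p' \<Longrightarrow> poly p x = a \<Longrightarrow> poly p' y = b \<Longrightarrow> (a, b) \<in> adjoin R x y"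
  unfolding adjoin_def by blast

lemma partial_hom_1: "partial_hom R \<Longrightarrow> (1, 1) \<in> R"
  unfolding partial_hom_def by blast

lemma partial_hom_diff:
  "partial_hom R \<Longrightarrow> (a, a') \<in> R \<Longrightarrow> (b, b') \<in> R \<Longrightarrow> (a - b, a' - b') \<in> R"
  unfolding partial_hom_def by fastforce

lemma partial_hom_mult:
  "partial_hom R \<Longrightarrow> (a, a') \<in> R \<Longrightarrow> (b, b') \<in> R \<Longrightarrow> (a * b, a' * b') \<in> R"
  unfolding partial_hom_def by fastforce

lemma partial_hom_zero: "partial_hom R \<Longrightarrow> (0, 0) \<in> R"
  using partial_hom_1 partial_hom_diff by (metis diff_self)

lemma partial_hom_minus: "partial_hom R \<Longrightarrow> (a, a') \<in> R \<Longrightarrow> (- a, - a') \<in> R"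
  using partial_hom_zero partial_hom_diff by (metis diff_0)

lemma partial_hom_add:
  "partial_hom R \<Longrightarrow> (a, a') \<in> R \<Longrightarrow> (b, b') \<in> R \<Longrightarrow> (a + b, a' + b') \<in> R"
  using partial_hom_minus[of R b b'] partial_hom_diff[of R a a' "- b" "- b'"] by simp

lemma partial_hom_dom_zero: "partial_hom R \<Longrightarrow> (0, y) \<in> R \<Longrightarrow> y = 0"
  unfolding partial_hom_def by fastforce

lemma partial_hom_unit: "partial_hom R \<Longrightarrow> (x, y) \<in> R \<Longrightarrow> x \<noteq> 0 \<Longrightarrow> y dvd 1"
  unfolding partial_hom_def by fastforce

lemma partial_hom_functional: "partial_hom R \<Longrightarrow> (x, y) \<in> R \<Longrightarrow> (x, z) \<in> R \<Longrightarrow> y = z"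
  using partial_hom_diff[of R x y x z] partial_hom_dom_zero[of R "y - z"] by simp

lemma partial_hom_zero_iff: "partial_hom R \<Longrightarrow> (x, y) \<in> R \<Longrightarrow> x = 0 \<longleftrightarrow> y = 0"
  using partial_hom_dom_zero partial_hom_unit
  by (metis dvd_0_left_iff zero_neq_one)

lemma partial_hom_sum:
  assumes "partial_hom R" "\<And>i. i \<in> A \<Longrightarrow> (f i, g i) \<in> R"
  shows "(sum f A, sum g A) \<in> R"
proof (cases "finite A")
  case True
  then show ?thesis using assms(2)
    by (induction A) (auto intro: assms(1) partial_hom_zero partial_hom_add)
qed (auto intro: assms(1) partial_hom_zero)

section \<open>Coefficientwise images of polynomials\<close>

lemma coeffs_in_0: "partial_hom R \<Longrightarrow> coeffs_in R 0 0"
  by (simp add: coeffs_in_def partial_hom_zero)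

lemma coeffs_in_pCons:
  "(a, a') \<in> R \<Longrightarrow> coeffs_in R p p' \<Longrightarrow> coeffs_in R (pCons a p) (pCons a' p')"
  by (auto simp: coeffs_in_def coeff_pCons split: nat.split)

lemma coeffs_in_const: "partial_hom R \<Longrightarrow> (a, a') \<in> R \<Longrightarrow> coeffs_in R [:a:] [:a':]"
  by (simp add: coeffs_in_pCons coeffs_in_0)

lemma coeffs_in_X: "partial_hom R \<Longrightarrow> coeffs_in R [:0, 1:] [:0, 1:]"
  by (simp add: coeffs_in_pCons coeffs_in_const partial_hom_zero partial_hom_1)

lemma coeffs_in_diff:
  "partial_hom R \<Longrightarrow> coeffs_in R p p' \<Longrightarrow> coeffs_in R q q' \<Longrightarrow> coeffs_in R (p - q) (p' - q')"
  by (simp add: coeffs_in_def partial_hom_diff)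

lemma coeffs_in_minus: "partial_hom R \<Longrightarrow> coeffs_in R p p' \<Longrightarrow> coeffs_in R (- p) (- p')"
  by (simp add: coeffs_in_def partial_hom_minus)

lemma coeffs_in_add:
  "partial_hom R \<Longrightarrow> coeffs_in R p p' \<Longrightarrow> coeffs_in R q q' \<Longrightarrow> coeffs_in R (p + q) (p' + q')"
  by (simp add: coeffs_in_def partial_hom_add)

lemma coeffs_in_mult:
  "partial_hom R \<Longrightarrow> coeffs_in R p p' \<Longrightarrow> coeffs_in R q q' \<Longrightarrow> coeffs_in R (p * q) (p' * q')"
  by (simp add: coeffs_in_def coeff_mult partial_hom_sum partial_hom_mult)

lemma coeffs_in_smult:
  "partial_hom R \<Longrightarrow> (a, a') \<in> R \<Longrightarrow> coeffs_in R p p' \<Longrightarrow> coeffs_in R (smult a p) (smult a' p')"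
  by (simp add: coeffs_in_def partial_hom_mult)

lemma coeffs_in_monom: "partial_hom R \<Longrightarrow> (a, a') \<in> R \<Longrightarrow> coeffs_in R (monom a n) (monom a' n)"
  by (simp add: coeffs_in_def partial_hom_zero)

text \<open>Nonzero coefficients go to units and hence not to 0, so leading coefficients
  survive.\<close>

lemma coeffs_in_degree:
  assumes "partial_hom R" "coeffs_in R p p'"
  shows "degree p' = degree p"
proof -
  have "coeff p i = 0 \<longleftrightarrow> coeff p' i = 0" for i
    using assms partial_hom_zero_iff unfolding coeffs_in_def by blast
  then have "degree p' \<le> degree p" "degree p \<le> degree p'"
    by (meson coeff_eq_0 degree_le)+
  then show ?thesis by simp
qed

lemma coeffs_in_zero_iff: "partial_hom R \<Longrightarrow> coeffs_in R p p' \<Longrightarrow> p = 0 \<longleftrightarrow> p' = 0"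
  by (metis coeffs_in_degree coeffs_in_def leading_coeff_0_iff partial_hom_zero_iff)

lemma coeffs_in_lift:
  assumes "partial_hom R" "\<And>i. coeff p i \<in> fst ` R"
  obtains p' where "coeffs_in R p p'"
proof -
  define f where "f c = (SOME y. (c, y) \<in> R)" for c
  have f: "(c, f c) \<in> R" if "c \<in> fst ` R" for c
    using that unfolding f_def by (metis (mono_tags, lifting) imageE prod.collapse someI)
  have "f 0 = 0"
    using f[of 0] partial_hom_zero[OF assms(1)] partial_hom_dom_zero[OF assms(1)] by force
  then have "coeffs_in R p (map_poly f p)"
    using assms(2) f by (simp add: coeffs_in_def coeff_map_poly)
  then show thesis by (rule that)
qed

text \<open>The domain of R is a ring and not a field, so p has to be multiplied by powers of the
  leading coefficient of m. Their product c is nonzero, hence its image c' is a unit and can be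
  cancelled later. The divisions of p and of its image run in parallel.\<close>

lemma coeffs_in_pseudo_division:
  assumes R: "partial_hom R" and m: "coeffs_in R m m'" "m \<noteq> 0" and "coeffs_in R p p'"
  shows "\<exists>c c' q q' r r'. (c, c') \<in> R \<and> c \<noteq> 0 \<and> coeffs_in R q q' \<and> coeffs_in R r r' \<and>
    smult c p = q * m + r \<and> smult c' p' = q' * m' + r' \<and> (r = 0 \<or> degree r < degree m)"
  using assms(4)
\<comment> \<open>The value 0 is reserved for the zero polynomial, so that the step from a nonzero
  constant to 0 also decreases the measure.\<close>
proof (induction "if p = 0 then 0 else Suc (degree p)" arbitrary: p p' rule: less_induct)
  case less
  note p = less.prems
  show ?case
  proof (cases "p = 0 \<or> degree p < degree m")
    case True
    have "coeffs_in R 0 0" "(1, 1) \<in> R" using R coeffs_in_0 partial_hom_1 by auto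
    with True p show ?thesis
      by (intro exI[of _ 1] exI[of _ 0] exI[of _ p] exI[of _ p'])
        (use \<open>(1, 1) \<in> R\<close> in \<open>auto intro!: exI[of _ 1] exI[of _ 0] exI[of _ p']\<close>)
  next
    case False
    define n where "n = degree p - degree m"
    define a a' where "a = lead_coeff m" and "a' = coeff m' (degree m)"
    define b b' where "b = lead_coeff p" and "b' = coeff p' (degree p)"
    have aa: "(a, a') \<in> R" and bb: "(b, b') \<in> R"
      using m p unfolding a_def a'_def b_def b'_def coeffs_in_def by auto
    have a0: "a \<noteq> 0" using m unfolding a_def by simp
    define s s' where "s = monom b n" and "s' = monom b' n"
    define t t' where "t = smult a p - s * m" and "t' = smult a' p' - s' * m'"
    have ss: "coeffs_in R s s'" unfolding s_def s'_def using R bb by (rule coeffs_in_monom)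
    have tt: "coeffs_in R t t'" unfolding t_def t'_def
      using R aa p ss m by (intro coeffs_in_diff coeffs_in_smult coeffs_in_mult)
    have ds: "degree (s * m) \<le> degree p"
      using degree_mult_le[of s m] degree_monom_le[of b n] False unfolding s_def n_def by linarith
    have "degree t \<le> degree p" unfolding t_def
      using ds by (intro degree_diff_le) (auto intro: order.trans[OF degree_smult_le])
    moreover have "coeff t (degree p) = 0"
    proof -
      have "coeff (s * m) (n + degree m) = b * a"
        unfolding s_def a_def by (simp add: coeff_monom_mult)
      then show ?thesis unfolding t_def using False by (simp add: n_def b_def)
    qed
    ultimately have "t = 0 \<or> degree t < degree p"
      by (metis leading_coeff_0_iff le_neq_implies_less)
    then have "(if t = 0 then 0 else Suc (degree t)) < (if p = 0 then 0 else Suc (degree p))"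
      using False by auto
    from less.hyps[OF this tt] obtain c c' q q' r r' where
      ih: "(c, c') \<in> R" "c \<noteq> 0" "coeffs_in R q q'" "coeffs_in R r r'"
        "smult c t = q * m + r" "smult c' t' = q' * m' + r'" "r = 0 \<or> degree r < degree m"
      by blast
    have "smult (c * a) p = (smult c s + q) * m + r"
      using ih(5) unfolding t_def by (simp add: smult_diff_right algebra_simps)
    moreover have "smult (c' * a') p' = (smult c' s' + q') * m' + r'"
      using ih(6) unfolding t'_def by (simp add: smult_diff_right algebra_simps)
    moreover have "(c * a, c' * a') \<in> R" "c * a \<noteq> 0"
      using R ih aa a0 partial_hom_mult by auto
    moreover have "coeffs_in R (smult c s + q) (smult c' s' + q')"
      using R ih ss by (intro coeffs_in_add coeffs_in_smult)
    ultimately show ?thesis using ih by blast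
  qed
qed

section \<open>Adjoining one element\<close>

lemma partial_hom_adjoin:
  assumes R: "partial_hom R"
    and "\<And>p p'. coeffs_in R p p' \<Longrightarrow> if poly p x = 0 then poly p' y = 0 else poly p' y dvd 1"
  shows "partial_hom (adjoin R x y)"
  unfolding partial_hom_def
proof (intro conjI ballI)
  show "(1, 1) \<in> adjoin R x y"
    by (rule adjoinI[OF coeffs_in_const[OF R partial_hom_1[OF R]]]) simp_all
next
  fix u v assume "u \<in> adjoin R x y" "v \<in> adjoin R x y"
  then obtain p p' q q' where
    uv: "u = (poly p x, poly p' y)" "v = (poly q x, poly q' y)" and
    pq: "coeffs_in R p p'" "coeffs_in R q q'"
    unfolding adjoin_def by auto
  have "fst u - fst v = poly (p - q) x" "snd u - snd v = poly (p' - q') y"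
    using uv by simp_all
  then show "(fst u - fst v, snd u - snd v) \<in> adjoin R x y"
    using coeffs_in_diff[OF R pq] unfolding adjoin_def by blast
  have "fst u * fst v = poly (p * q) x" "snd u * snd v = poly (p' * q') y"
    using uv by simp_all
  then show "(fst u * fst v, snd u * snd v) \<in> adjoin R x y"
    using coeffs_in_mult[OF R pq] unfolding adjoin_def by blast
next
  fix u assume "u \<in> adjoin R x y"
  then show "if fst u = 0 then snd u = 0 else snd u dvd 1"
    unfolding adjoin_def using assms(2) by auto
qed

lemma subset_adjoin: "partial_hom R \<Longrightarrow> R \<subseteq> adjoin R x y"
  by (auto intro: adjoinI[OF coeffs_in_const])

lemma mem_adjoin: "partial_hom R \<Longrightarrow> (x, y) \<in> adjoin R x y"
  by (rule adjoinI[OF coeffs_in_X]) auto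

lemma adjoin_least:
  assumes "partial_hom S" "R \<subseteq> S" "(x, y) \<in> S"
  shows "adjoin R x y \<subseteq> S"
proof -
  have "(poly p x, poly p' y) \<in> S" if "coeffs_in R p p'" for p p'
    using that
  proof (induction p arbitrary: p')
    case 0
    have "coeff p' i = 0" for i
      using 0 assms(2) partial_hom_dom_zero[OF assms(1)] unfolding coeffs_in_def by auto
    then have "p' = 0" by (simp add: poly_eqI)
    then show ?case using partial_hom_zero[OF assms(1)] by simp
  next
    case (pCons a p)
    obtain a' q' where p': "p' = pCons a' q'" by (cases p')
    have "coeffs_in R p q'"
      unfolding coeffs_in_def
    proof
      fix i
      show "(coeff p i, coeff q' i) \<in> R"
        using pCons.prems[unfolded coeffs_in_def, rule_format, of "Suc i"] p' by simp
    qed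
    then have 1: "(poly p x, poly q' y) \<in> S" by (rule pCons.IH)
    have "(a, a') \<in> S"
      using pCons.prems[unfolded coeffs_in_def, rule_format, of 0] p' assms(2) by auto
    then show ?case using 1 assms p' by (simp add: partial_hom_add partial_hom_mult)
  qed
  then show ?thesis unfolding adjoin_def by auto
qed

text \<open>Adjoining an algebraic element: any root of the image of a minimal polynomial will do.\<close>

lemma partial_hom_adjoin_algebraic:
  assumes R: "partial_hom R" and "algebraic_over (fst ` R) x"
    and root: "\<And>m m'. coeffs_in R m m' \<Longrightarrow> m \<noteq> 0 \<Longrightarrow> poly m x = 0 \<Longrightarrow> degree m > 0 \<Longrightarrow>
      (\<And>p p'. coeffs_in R p p' \<Longrightarrow> p \<noteq> 0 \<Longrightarrow> poly p x = 0 \<Longrightarrow> degree m \<le> degree p) \<Longrightarrow>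
      \<exists>y. poly m' y = 0 \<and> Q y"
  shows "\<exists>y. Q y \<and> partial_hom (adjoin R x y)"
proof -
  define A where "A = {m. m \<noteq> 0 \<and> poly m x = 0 \<and> (\<exists>m'. coeffs_in R m m')}"
  obtain m0 where m0: "m0 \<noteq> 0" "\<And>i. coeff m0 i \<in> fst ` R" "poly m0 x = 0"
    using assms(2) unfolding algebraic_over_def by blast
  obtain m0' where "coeffs_in R m0 m0'" using coeffs_in_lift[OF R m0(2)] .
  with m0 have "m0 \<in> A" unfolding A_def by blast
  define m where "m = arg_min degree (\<lambda>m. m \<in> A)"
  have "m \<in> A" and min: "\<And>p. p \<in> A \<Longrightarrow> degree m \<le> degree p"
    unfolding m_def using arg_min_nat_lemma[of "\<lambda>m. m \<in> A" m0 degree] \<open>m0 \<in> A\<close> by auto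
  then obtain m' where m: "m \<noteq> 0" "poly m x = 0" "coeffs_in R m m'"
    unfolding A_def by auto
  have min: "degree m \<le> degree p" if "coeffs_in R p p'" "p \<noteq> 0" "poly p x = 0" for p p'
    using min that unfolding A_def by blast
  have "degree m > 0"
  proof (rule ccontr)
    assume "\<not> degree m > 0"
    then obtain a where "m = [:a:]" by (auto elim: degree_eq_zeroE)
    then show False using m by simp
  qed
  then obtain y where y: "poly m' y = 0" "Q y" using root m min by blast
  \<comment> \<open>By minimality m divides p up to the factor c, and c' is a unit, so the relation
    is inherited by y.\<close>
  have zero: "poly p' y = 0" if p: "coeffs_in R p p'" "poly p x = 0" for p p'
  proof -
    obtain c c' q q' r r' where
      d: "(c, c') \<in> R" "c \<noteq> 0" "coeffs_in R q q'" "coeffs_in R r r'"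
        "smult c p = q * m + r" "smult c' p' = q' * m' + r'" "r = 0 \<or> degree r < degree m"
      using coeffs_in_pseudo_division[OF R m(3,1) p(1)] by blast
    have "poly r x = 0" using arg_cong[OF d(5), of "\<lambda>p. poly p x"] p m by simp
    then have "r = 0" using d(4,7) min[of r r'] by force
    then have "r' = 0" using coeffs_in_zero_iff[OF R d(4)] by simp
    then have "c' * poly p' y = 0"
      using arg_cong[OF d(6), of "\<lambda>p. poly p y"] y by simp
    moreover obtain e where e: "1 = c' * e" using partial_hom_unit[OF R d(1,2)] by (elim dvdE)
    have "poly p' y = e * (c' * poly p' y)"
      unfolding mult.assoc[symmetric] mult.commute[of e] e[symmetric] by simp
    ultimately show ?thesis by simp
  qed
  \<comment> \<open>A Euclidean descent showing that p(x) divides a nonzero element of the domain of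
    R: dividing m by p leaves r with r(x) = - q(x) p(x), so a multiplier for r(x) gives one for
    p(x).\<close>
  have inv: "\<exists>u u' c c'. coeffs_in R u u' \<and> (c, c') \<in> R \<and> c \<noteq> 0 \<and> poly u x * poly p x = c"
    if "coeffs_in R p p'" "p \<noteq> 0" "degree p < degree m" for p p'
    using that
  proof (induction "degree p" arbitrary: p p' rule: less_induct)
    case less
    show ?case
    proof (cases "degree p = 0")
      case True
      have "coeffs_in R 1 1" using coeffs_in_const[OF R partial_hom_1[OF R]] by (simp add: one_pCons)
      moreover have "(coeff p 0, coeff p' 0) \<in> R" using less.prems unfolding coeffs_in_def by simp
      moreover have "coeff p 0 \<noteq> 0" using True less.prems(2) by (metis leading_coeff_0_iff)
      moreover have "poly p x = coeff p 0" using True by (auto elim: degree_eq_zeroE)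
      ultimately show ?thesis
        by (intro exI[of _ 1] exI[of _ "coeff p 0"] exI[of _ "coeff p' 0"] conjI) auto
    next
      case False
      obtain c c' q q' r r' where
        d: "(c, c') \<in> R" "c \<noteq> 0" "coeffs_in R q q'" "coeffs_in R r r'"
          "smult c m = q * p + r" "r = 0 \<or> degree r < degree p"
        using coeffs_in_pseudo_division[OF R less.prems(1,2) m(3)] by blast
      have px: "poly p x \<noteq> 0" using min[OF less.prems(1,2)] less.prems(3) by auto
      have rx: "poly r x = - poly q x * poly p x"
        using arg_cong[OF d(5), of "\<lambda>p. poly p x"] m by (simp add: eq_neg_iff_add_eq_0 add.commute)
      \<comment> \<open>Otherwise q would be a nonzero polynomial of degree below that of m with
        root x.\<close>
      have "r \<noteq> 0"
      proof
        assume "r = 0"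
        then have "poly q x = 0" using rx px by simp
        moreover have "q \<noteq> 0" using d(2,5) m \<open>r = 0\<close> by auto
        ultimately have "degree m \<le> degree q" using min d(3) by blast
        moreover have "degree m = degree q + degree p"
        proof -
          have "degree (smult c m) = degree (q * p)" using d(5) \<open>r = 0\<close> by simp
          then show ?thesis using d(2) \<open>q \<noteq> 0\<close> less.prems by (simp add: degree_mult_eq)
        qed
        ultimately show False using False by simp
      qed
      with d(6) have "degree r < degree p" by simp
      from less.hyps[OF this d(4) \<open>r \<noteq> 0\<close>] this less.prems(3) obtain u u' e e' where
        u: "coeffs_in R u u'" "(e, e') \<in> R" "e \<noteq> 0" "poly u x * poly r x = e"
        by auto
      have "coeffs_in R (- (u * q)) (- (u' * q'))"
        using R u d by (intro coeffs_in_minus coeffs_in_mult)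
      moreover have "poly (- (u * q)) x * poly p x = e" using u rx by (simp add: algebra_simps)
      ultimately show ?thesis using u by blast
    qed
  qed
  have unit: "poly p' y dvd 1" if p: "coeffs_in R p p'" "poly p x \<noteq> 0" for p p'
  proof -
    obtain c c' q q' r r' where
      d: "(c, c') \<in> R" "c \<noteq> 0" "coeffs_in R q q'" "coeffs_in R r r'"
        "smult c p = q * m + r" "smult c' p' = q' * m' + r'" "r = 0 \<or> degree r < degree m"
      using coeffs_in_pseudo_division[OF R m(3,1) p(1)] by blast
    have r: "poly r x = c * poly p x" "poly r' y = c' * poly p' y"
      using arg_cong[OF d(5), of "\<lambda>p. poly p x"] m arg_cong[OF d(6), of "\<lambda>p. poly p y"] y by simp_all
    then have "r \<noteq> 0" using p d by auto
    then obtain u u' e e' where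
      u: "coeffs_in R u u'" "(e, e') \<in> R" "e \<noteq> 0" "poly u x * poly r x = e"
      using inv d by blast
    \<comment> \<open>The identity u(x) r(x) = e is a polynomial relation at x, so it passes to y,
      where e' is a unit.\<close>
    have "coeffs_in R (u * r - [:e:]) (u' * r' - [:e':])"
      using R u d by (intro coeffs_in_diff coeffs_in_mult coeffs_in_const)
    then have "poly (u' * r' - [:e':]) y = 0" using u by (intro zero) auto
    then have "e' = poly p' y * (poly u' y * c')" using r by (simp add: ac_simps)
    then have "poly p' y dvd e'" by (rule dvdI)
    then show ?thesis using partial_hom_unit[OF R u(2,3)] by (rule dvd_trans)
  qed
  have "partial_hom (adjoin R x y)" using R by (rule partial_hom_adjoin) (simp add: zero unit)
  with y(2) show ?thesis by (intro exI[of _ y] conjI)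
qed

lemma partial_hom_Union_chain:
  assumes "C \<noteq> {}" "subset.chain UNIV C" "\<And>R. R \<in> C \<Longrightarrow> partial_hom R"
  shows "partial_hom (\<Union>C)"
  unfolding partial_hom_def
proof (intro conjI ballI)
  show "(1, 1) \<in> \<Union>C" using assms partial_hom_1 by blast
next
  fix u v assume "u \<in> \<Union>C" "v \<in> \<Union>C"
  then obtain R where "R \<in> C" "u \<in> R" "v \<in> R"
    using assms(2) unfolding subset_chain_def by blast
  moreover from this have "partial_hom R" using assms by blast
  ultimately show "(fst u - fst v, snd u - snd v) \<in> \<Union>C"
    "(fst u * fst v, snd u * snd v) \<in> \<Union>C"
    using partial_hom_diff partial_hom_mult by (metis UnionI prod.collapse)+
next
  fix u assume "u \<in> \<Union>C"
  then show "if fst u = 0 then snd u = 0 else snd u dvd 1"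
    using assms(3) unfolding partial_hom_def by blast
qed

text \<open>P is a constraint stable under unions. It is instantiated by no constraint, by equality
  with the converse, and by lifting the identity.\<close>

lemma maximal_partial_hom:
  assumes "partial_hom R0" "P R0"
    and P: "\<And>C. C \<noteq> {} \<Longrightarrow> (\<And>R. R \<in> C \<Longrightarrow> P R) \<Longrightarrow> P (\<Union>C)"
  obtains M where "R0 \<subseteq> M" "partial_hom M" "P M"
    "\<And>R. partial_hom R \<Longrightarrow> P R \<Longrightarrow> M \<subseteq> R \<Longrightarrow> R = M"
proof -
  define A where "A = {R. R0 \<subseteq> R \<and> partial_hom R \<and> P R}"
  have "\<exists>M\<in>A. \<forall>X\<in>A. M \<subseteq> X \<longrightarrow> X = M"
  proof (rule subset_Zorn_nonempty)
    show "A \<noteq> {}" using assms unfolding A_def by auto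
  next
    fix C assume C: "C \<noteq> {}" "subset.chain A C"
    then have "C \<subseteq> A" "subset.chain UNIV C" unfolding subset_chain_def by auto
    then have "partial_hom (\<Union>C)" "P (\<Union>C)" "R0 \<subseteq> \<Union>C"
      using C(1) partial_hom_Union_chain[of C] P[of C] unfolding A_def by auto
    then show "\<Union>C \<in> A" unfolding A_def by simp
  qed
  then obtain M where M: "M \<in> A" "\<And>X. X \<in> A \<Longrightarrow> M \<subseteq> X \<Longrightarrow> X = M" by blast
  show thesis
  proof (rule that[of M])
    show "R0 \<subseteq> M" "partial_hom M" "P M" using M(1) unfolding A_def by auto
  next
    fix R assume "partial_hom R" "P R" "M \<subseteq> R"
    then show "R = M" using M unfolding A_def by auto
  qed
qed

section \<open>Extending automorphisms and derivations\<close>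

lemma algebraic_over_mono: "algebraic_over E x \<Longrightarrow> E \<subseteq> F \<Longrightarrow> algebraic_over F x"
  unfolding algebraic_over_def by blast

lemma partial_hom_converse:
  fixes R :: "('k::field \<times> 'k) set"
  assumes "partial_hom R"
  shows "partial_hom (R\<inverse>)"
  unfolding partial_hom_def
proof (intro conjI ballI)
  show "(1, 1) \<in> R\<inverse>" using partial_hom_1[OF assms] by simp
next
  fix u v assume "u \<in> R\<inverse>" "v \<in> R\<inverse>"
  then show "(fst u - fst v, snd u - snd v) \<in> R\<inverse>" "(fst u * fst v, snd u * snd v) \<in> R\<inverse>"
    using partial_hom_diff[OF assms] partial_hom_mult[OF assms] by auto
next
  fix u assume "u \<in> R\<inverse>"
  then show "if fst u = 0 then snd u = 0 else snd u dvd 1"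
    using partial_hom_zero_iff[OF assms] by (auto simp: dvd_field_iff)
qed

lemma partial_hom_adjoin_transcendental:
  assumes R: "partial_hom R" and "\<not> algebraic_over (fst ` R) x"
    and "\<And>p p'. coeffs_in R p p' \<Longrightarrow> p \<noteq> 0 \<Longrightarrow> poly p' y dvd 1"
  shows "partial_hom (adjoin R x y)"
proof (rule partial_hom_adjoin[OF R])
  fix p p' assume p: "coeffs_in R p p'"
  have "p = 0" if "poly p x = 0"
  proof (rule ccontr)
    assume "p \<noteq> 0"
    moreover have "\<forall>i. coeff p i \<in> fst ` R" using p unfolding coeffs_in_def by force
    ultimately show False using assms(2) that unfolding algebraic_over_def by blast
  qed
  moreover have "p' = 0" if "p = 0" using coeffs_in_zero_iff[OF R p] that by simp
  ultimately show "if poly p x = 0 then poly p' y = 0 else poly p' y dvd 1"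
    using assms(3)[OF p] by (cases "p = 0") auto
qed

lemma partial_hom_adjoin_transcendental_pair:
  fixes R :: "('k::field \<times> 'k) set"
  assumes R: "partial_hom R" and "\<not> algebraic_over (fst ` R) x" "\<not> algebraic_over (snd ` R) y"
  shows "partial_hom (adjoin R x y)"
proof (rule partial_hom_adjoin_transcendental[OF R assms(2)])
  fix p p' assume p: "coeffs_in R p p'" "p \<noteq> 0"
  have "p' \<noteq> 0" using coeffs_in_zero_iff[OF R p(1)] p(2) by simp
  moreover have "\<forall>i. coeff p' i \<in> snd ` R" using p unfolding coeffs_in_def by force
  ultimately have "poly p' y \<noteq> 0" using assms(3) unfolding algebraic_over_def by blast
  then show "poly p' y dvd 1" by (simp add: dvd_field_iff)
qed

lemma partial_hom_subring:
  assumes "partial_hom M"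
  shows "subring (fst ` M)"
  unfolding subring_def
proof (intro conjI ballI)
  show "1 \<in> fst ` M" using partial_hom_1[OF assms] by (metis fst_conv imageI)
next
  fix x y assume "x \<in> fst ` M" "y \<in> fst ` M"
  then obtain x' y' where "(x, x') \<in> M" "(y, y') \<in> M" by force
  then have "(x - y, x' - y') \<in> M" "(x * y, x' * y') \<in> M"
    using assms partial_hom_diff partial_hom_mult by blast+
  then show "x - y \<in> fst ` M" "x * y \<in> fst ` M" by (metis fst_conv imageI)+
qed

definition field_aut :: "('k::field \<Rightarrow> 'k) \<Rightarrow> bool" where
  "field_aut \<sigma> \<longleftrightarrow> bij \<sigma> \<and> (\<forall>x y. \<sigma> (x + y) = \<sigma> x + \<sigma> y) \<and> (\<forall>x y. \<sigma> (x * y) = \<sigma> x * \<sigma> y)"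

definition derivation :: "('k::comm_ring_1 \<Rightarrow> 'k) \<Rightarrow> bool" where
  "derivation D \<longleftrightarrow> (\<forall>x y. D (x + y) = D x + D y) \<and> (\<forall>x y. D (x * y) = x * D y + D x * y)"

lemma total_partial_hom:
  assumes N: "partial_hom N" "fst ` N = UNIV"
  obtains f where "\<And>x y. (x, y) \<in> N \<longleftrightarrow> y = f x" "f 1 = 1"
    "\<And>x y. f (x + y) = f x + f y" "\<And>x y. f (x * y) = f x * f y"
proof -
  have "\<exists>y. (x, y) \<in> N" for x
    using N(2) by (metis UNIV_I fst_conv imageE prod.collapse)
  then obtain f where f: "\<And>x. (x, f x) \<in> N" by metis
  then have *: "(x, y) \<in> N \<longleftrightarrow> y = f x" for x y
    using partial_hom_functional[OF N(1)] by blast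
  show thesis
  proof (rule that[of f])
    show "(x, y) \<in> N \<longleftrightarrow> y = f x" for x y by (rule *)
    show "f 1 = 1" using partial_hom_1[OF N(1)] * by simp
    show "f (x + y) = f x + f y" for x y using partial_hom_add[OF N(1) f f] * by simp
    show "f (x * y) = f x * f y" for x y using partial_hom_mult[OF N(1) f f] * by simp
  qed
qed

text \<open>At a maximal extension the image of a minimal polynomial is nonconstant and has a root,
  as K is algebraically closed, so no algebraic element is missing.\<close>

lemma total_algebraic_extension:
  fixes R :: "('k::alg_closed_field \<times> 'k) set"
  assumes R: "partial_hom R" "\<And>x. algebraic_over (fst ` R) x"
  obtains N where "R \<subseteq> N" "partial_hom N" "fst ` N = UNIV"
proof -
  obtain N where N: "R \<subseteq> N" "partial_hom N"
      "\<And>S. partial_hom S \<Longrightarrow> N \<subseteq> S \<Longrightarrow> S = N"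
    by (rule maximal_partial_hom[OF R(1), where P = "\<lambda>_. True"]) (rule TrueI | rule that; assumption | blast)+
  have "x \<in> fst ` N" for x
  proof -
    have "algebraic_over (fst ` N) x"
      using R(2) N(1) by (meson algebraic_over_mono image_mono)
    then have "\<exists>y. True \<and> partial_hom (adjoin N x y)"
    proof (rule partial_hom_adjoin_algebraic[OF N(2)])
      fix m m' assume "coeffs_in N m m'" "degree m > 0"
      then have "degree m' > 0" using coeffs_in_degree[OF N(2)] by metis
      then show "\<exists>y. poly m' y = 0 \<and> True" using alg_closed_imp_poly_has_root by blast
    qed
    then obtain y where "partial_hom (adjoin N x y)" by blast
    then have "adjoin N x y = N" using N(3) subset_adjoin[OF N(2)] by blast
    then have "(x, y) \<in> N" using mem_adjoin[OF N(2)] by metis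
    then show ?thesis by force
  qed
  then show thesis using that N by blast
qed

text \<open>Exchange at the level of rings. A relation for t with coefficients in E[u] is a
  polynomial in two variables; S collects it by powers of u, and its coefficients are the values at
  t of the polynomials \<open>T j\<close> over E. Independence of u kills S, and then transcendence
  of t kills every \<open>T j\<close>.\<close>

lemma exchange_polynomial:
  fixes E :: "'k::field set"
  assumes "subring E" "\<not> algebraic_over E t"
    "\<not> algebraic_over {poly p t | p. \<forall>i. coeff p i \<in> E} u"
  shows "\<not> algebraic_over {poly p u | p. \<forall>i. coeff p i \<in> E} t"
proof
  assume "algebraic_over {poly p u | p. \<forall>i. coeff p i \<in> E} t"
  then obtain P where P: "P \<noteq> 0" "poly P t = 0"
      and "\<And>i. \<exists>q. coeff P i = poly q u \<and> (\<forall>j. coeff q j \<in> E)"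
    unfolding algebraic_over_def by blast
  then obtain Q where Q: "\<And>i. coeff P i = poly (Q i) u" "\<And>i j. coeff (Q i) j \<in> E"
    by metis
  define n where "n = degree P"
  define S where "S = (\<Sum>i\<le>n. smult (t ^ i) (Q i))"
  define T where "T j = (\<Sum>i\<le>n. monom (coeff (Q i) j) i)" for j
  have T: "coeff (T j) i = (if i \<le> n then coeff (Q i) j else 0)" for i j
    unfolding T_def by (simp add: coeff_sum)
  have ST: "coeff S j = poly (T j) t" for j
    unfolding S_def T_def by (simp add: coeff_sum poly_sum poly_monom mult.commute)
  have TE: "\<forall>i. coeff (T j) i \<in> E" for j
    using T Q(2) subring_0[OF assms(1)] by simp
  have "poly S u = poly P t"
    unfolding S_def n_def by (simp add: poly_sum poly_altdef[of P] Q(1) mult.commute)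
  then have "poly S u = 0" using P by simp
  moreover have "\<forall>j. coeff S j \<in> {poly p t | p. \<forall>i. coeff p i \<in> E}"
    using ST TE by blast
  ultimately have "S = 0" using assms(3) unfolding algebraic_over_def by blast
  then have "poly (T j) t = 0" for j using ST by (metis coeff_0)
  then have T0: "T j = 0" for j using TE assms(2) unfolding algebraic_over_def by blast
  have "coeff (Q n) j = 0" for j
    using arg_cong[OF T0[of j], of "\<lambda>p. coeff p n"] T by simp
  then have "Q n = 0" by (simp add: poly_eqI)
  then have "coeff P n = 0" using Q(1) by simp
  then show False using P unfolding n_def by simp
qed

lemma coeffs_in_Id: "coeffs_in (Id_on E) p p' \<longleftrightarrow> p' = p \<and> (\<forall>i. coeff p i \<in> E)"
  unfolding coeffs_in_def by (auto simp: Id_on_iff poly_eq_iff)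

lemma partial_hom_Id:
  fixes E :: "'k::field set"
  shows "subring E \<Longrightarrow> partial_hom (Id_on E)"
  unfolding partial_hom_def subring_def by (auto simp: dvd_field_iff)

text \<open>
  The involution exchanging two independent transcendental elements is first extended to a
  subring over which \<open>K\<close> is algebraic, by adjoining fixed transcendental elements.
\<close>

lemma swap_automorphism:
  fixes E :: "'k::alg_closed_field set"
  assumes E: "subring E" and t: "\<not> algebraic_over E t"
    and u: "\<not> algebraic_over {poly p t | p. \<forall>i. coeff p i \<in> E} u"
  obtains \<sigma> where "field_aut \<sigma>" "\<And>e. e \<in> E \<Longrightarrow> \<sigma> e = e" "\<sigma> t = u" "\<sigma> u = t"
proof -
  have EE: "E \<subseteq> {poly p t | p. \<forall>i. coeff p i \<in> E}" for t
  proof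
    fix e assume "e \<in> E"
    then have "\<forall>i. coeff [:e:] i \<in> E" using subring_0[OF E]
      by (auto simp: coeff_pCons split: nat.split)
    moreover have "e = poly [:e:] t" by simp
    ultimately show "e \<in> {poly p t | p. \<forall>i. coeff p i \<in> E}" by blast
  qed
  have IdE: "fst ` Id_on E = E" "snd ` Id_on E = E" by force+
  define R1 where "R1 = adjoin (Id_on E) t u"
  define R2 where "R2 = adjoin R1 u t"
  have dom: "fst ` R1 = {poly p t | p. \<forall>i. coeff p i \<in> E}"
    "snd ` R1 = {poly p u | p. \<forall>i. coeff p i \<in> E}"
    unfolding R1_def adjoin_def coeffs_in_Id by force+
  have R0: "partial_hom (Id_on E)" using E by (rule partial_hom_Id)
  have "\<not> algebraic_over E u" using u EE algebraic_over_mono by blast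
  then have R1: "partial_hom R1" unfolding R1_def using t
    by (intro partial_hom_adjoin_transcendental_pair R0) (simp_all add: IdE)
  have R2: "partial_hom R2" unfolding R2_def
    using exchange_polynomial[OF E t u] u
    by (intro partial_hom_adjoin_transcendental_pair R1) (simp_all add: dom)
  have sub: "Id_on E \<subseteq> R1" "R1 \<subseteq> R2" "(t, u) \<in> R1" "(u, t) \<in> R2"
    using subset_adjoin[OF R0] mem_adjoin[OF R0] subset_adjoin[OF R1] mem_adjoin[OF R1]
    unfolding R1_def R2_def by blast+
  \<comment> \<open>The converse is again a partial homomorphism and contains R and (x, y), so it
    contains everything generated by them; taking converses once more gives equality.\<close>
  have sym: "(adjoin R x y)\<inverse> = adjoin R x y"
    if "partial_hom R" "partial_hom (adjoin R x y)" "R\<inverse> \<subseteq> adjoin R x y" "(y, x) \<in> adjoin R x y"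
    for R :: "('k \<times> 'k) set" and x y
  proof -
    have "R \<subseteq> (adjoin R x y)\<inverse>" "(x, y) \<in> (adjoin R x y)\<inverse>" using that by auto
    then have "adjoin R x y \<subseteq> (adjoin R x y)\<inverse>"
      using adjoin_least partial_hom_converse[OF that(2)] by metis
    then show ?thesis by auto
  qed
  have "R1\<inverse> \<subseteq> R2"
  proof -
    have "R1 \<subseteq> R2\<inverse>"
      unfolding R1_def using sub by (intro adjoin_least partial_hom_converse R2) auto
    then show ?thesis by auto
  qed
  then have R2_sym: "R2\<inverse> = R2"
    unfolding R2_def using R1 R2 sub unfolding R2_def by (intro sym) auto
  \<comment> \<open>Symmetry keeps domain and range equal. An element transcendental over the domain
    is then transcendental over the range and can be sent to itself, so a maximal M leaves
    none.\<close>
  obtain M where M: "R2 \<subseteq> M" "partial_hom M" "M\<inverse> = M"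
      and max: "\<And>R. partial_hom R \<Longrightarrow> R\<inverse> = R \<Longrightarrow> M \<subseteq> R \<Longrightarrow> R = M"
  proof (rule maximal_partial_hom[where P = "\<lambda>R. R\<inverse> = R", OF R2 R2_sym])
    fix C :: "('k \<times> 'k) set set"
    assume C: "\<And>R. R \<in> C \<Longrightarrow> R\<inverse> = R"
    have "(\<Union>C)\<inverse> = (\<Union>R\<in>C. R\<inverse>)" by auto
    also have "\<dots> = (\<Union>R\<in>C. R)" using C by (intro SUP_cong) auto
    finally show "(\<Union>C)\<inverse> = \<Union>C" by simp
  next
    fix M assume "R2 \<subseteq> M" "partial_hom M" "M\<inverse> = M"
      "\<And>R. partial_hom R \<Longrightarrow> R\<inverse> = R \<Longrightarrow> M \<subseteq> R \<Longrightarrow> R = M"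
    then show thesis by (rule that)
  qed
  have snd_M: "snd ` M = fst ` M" using M(3) by force
  have alg: "algebraic_over (fst ` M) x" for x
  proof (rule ccontr)
    assume x: "\<not> algebraic_over (fst ` M) x"
    have P: "partial_hom (adjoin M x x)"
      using M(2) x by (intro partial_hom_adjoin_transcendental_pair) (simp_all add: snd_M)
    moreover have "(adjoin M x x)\<inverse> = adjoin M x x"
      using sym[OF M(2) P] M(3) subset_adjoin[OF M(2)] mem_adjoin[OF M(2)] by blast
    ultimately have "adjoin M x x = M" using max subset_adjoin[OF M(2)] by blast
    then have "(x, x) \<in> M" using mem_adjoin[OF M(2)] by metis
    then have "x \<in> fst ` M" by force
    moreover have "subring (fst ` M)"
      using M(2) by (rule partial_hom_subring)
    ultimately show False using x algebraic_over_mem by blast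
  qed
  obtain N where N: "M \<subseteq> N" "partial_hom N" "fst ` N = UNIV"
    using total_algebraic_extension[OF M(2) alg] .
  obtain f where f: "\<And>x y. (x, y) \<in> N \<longleftrightarrow> y = f x" "f 1 = 1"
      "\<And>x y. f (x + y) = f x + f y" "\<And>x y. f (x * y) = f x * f y"
    by (rule total_partial_hom[OF N(2,3)]) (rule that)
  have f0: "f x = 0 \<longleftrightarrow> x = 0" for x using partial_hom_zero_iff[OF N(2), of x "f x"] f(1) by simp
  have "inj f"
  proof (rule injI)
    fix x y assume "f x = f y"
    then have "f (x - y) = 0" using f(3)[of "x - y" y] by simp
    then show "x = y" using f0 by simp
  qed
  \<comment> \<open>Symmetry may be lost in N, so surjectivity needs an argument: y is a root of a
    polynomial p over the range of M. Pulled back along f, p splits into linear factors, and f maps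
    the roots of the pullback to the roots of p.\<close>
  moreover have "y \<in> range f" for y
  proof -
    obtain p where p: "p \<noteq> 0" "\<And>i. coeff p i \<in> fst ` M" "poly p y = 0"
      using alg[of y] unfolding algebraic_over_def by blast
    have "coeff p i \<in> snd ` M" for i using p snd_M by simp
    then have "coeff p i \<in> range f" for i using N(1) f(1) by force
    then have *: "f (inv_into UNIV f (coeff p i)) = coeff p i" for i by (simp add: f_inv_into_f)
    define q where "q = map_poly (inv_into UNIV f) p"
    have "inv_into UNIV f 0 = 0" using f0 \<open>inj f\<close> by (metis inv_f_f)
    then have q: "map_poly f q = p"
      unfolding q_def poly_eq_iff using f0 * by (simp add: coeff_map_poly)
    then have "q \<noteq> 0" using p by auto
    then obtain A where "q = smult (lead_coeff q) (\<Prod>x\<in>#A. [:- x, 1:])"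
      using alg_closed_imp_factorization by blast
    moreover have "map_poly f (smult c r) = smult (f c) (map_poly f r)" for c r
      using f0 f(4) by (intro poly_eqI) (simp add: coeff_map_poly)
    moreover have "map_poly f (\<Prod>x\<in>#A. [:- x, 1:]) = (\<Prod>x\<in>#A. [:- f x, 1:])"
    proof (induction A)
      case empty
      then show ?case using f(2) f0 by (simp add: one_pCons map_poly_pCons)
    next
      case (add x A)
      have fm: "f (- x) = - f x" for x using f(3)[of x "- x"] f0[of 0] by (simp add: eq_neg_iff_add_eq_0 add.commute)
      have fd: "f (x - y) = f x - f y" for x y using f(3)[of x "- y"] fm by simp
      have mult: "map_poly f ([:- x, 1:] * r) = [:- f x, 1:] * map_poly f r" for r
      proof (rule poly_eqI)
        fix i
        show "coeff (map_poly f ([:- x, 1:] * r)) i = coeff ([:- f x, 1:] * map_poly f r) i"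
          using f0 fm f(3,4) fd by (cases i) (simp_all add: coeff_map_poly)
      qed
      show ?case using add mult by simp
    qed
    ultimately have "p = smult (f (lead_coeff q)) (\<Prod>x\<in>#A. [:- f x, 1:])"
      using q by metis
    then have "f (lead_coeff q) * (\<Prod>x\<in>#A. y - f x) = 0" using p(3)
      by (simp add: poly_prod_mset image_mset.compositionality o_def)
    then have "\<exists>x\<in>#A. y = f x" using f0 \<open>q \<noteq> 0\<close> by (auto simp: prod_mset_zero_iff)
    then show ?thesis by blast
  qed
  ultimately have "bij f" by (auto simp: bij_def)
  show thesis
  proof (rule that[of f])
    show "field_aut f" unfolding field_aut_def using \<open>bij f\<close> f by blast
    show "f e = e" if "e \<in> E" for e using that sub M(1) N(1) f(1) by (metis Id_onI subsetD)
    show "f t = u" "f u = t" using sub M(1) N(1) f(1) by (metis subsetD)+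
  qed
qed

section \<open>Dual numbers and the extension of derivations\<close>

datatype 'a dual = Dual (re: 'a) (du: 'a)

instantiation dual :: (comm_ring_1) comm_ring_1
begin
definition "0 = Dual 0 0"
definition "1 = Dual 1 0"
definition "x + y = Dual (re x + re y) (du x + du y)"
definition "x - y = Dual (re x - re y) (du x - du y)"
definition "- x = Dual (- re x) (- du x)"
definition "x * y = Dual (re x * re y) (re x * du y + du x * re y)"
instance
  by standard (auto simp: zero_dual_def one_dual_def plus_dual_def minus_dual_def
      uminus_dual_def times_dual_def algebra_simps)
end

lemmas dual_defs = zero_dual_def one_dual_def plus_dual_def minus_dual_def
  uminus_dual_def times_dual_def

lemma dual_unit: "re (x :: 'a::field dual) \<noteq> 0 \<Longrightarrow> x dvd 1"
  by (rule dvdI[of _ _ "Dual (1 / re x) (- du x / (re x * re x))"])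
    (auto simp: dual_defs field_simps)

text \<open>The first-order Taylor expansion, where eps may also occur in the coefficients.\<close>

lemma poly_dual:
  "poly p (Dual x z) =
     Dual (poly (map_poly re p) x)
       (poly (map_poly du p) x + poly (pderiv (map_poly re p)) x * (z :: 'a::field))"
proof (induction p)
  case 0
  then show ?case by (simp add: zero_dual_def)
next
  case (pCons a p)
  have "re 0 = (0 :: 'a)" "du 0 = (0 :: 'a)" by (simp_all add: zero_dual_def)
  with pCons show ?case
    by (simp add: map_poly_pCons pderiv_pCons) (simp add: dual_defs algebra_simps)
qed

lemma partial_hom_of_nat: "partial_hom R \<Longrightarrow> (of_nat n, of_nat n) \<in> R"
  by (induction n) (auto intro: partial_hom_zero partial_hom_add partial_hom_1)

lemma coeffs_in_pderiv:
  assumes "partial_hom R" "coeffs_in R p p'"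
  obtains p'' where "coeffs_in R (pderiv p) p''"
proof (rule coeffs_in_lift[OF assms(1)])
  fix i
  have "(of_nat (Suc i) * coeff p (Suc i), of_nat (Suc i) * coeff p' (Suc i)) \<in> R"
    using assms unfolding coeffs_in_def by (metis partial_hom_mult partial_hom_of_nat)
  then show "coeff (pderiv p) i \<in> fst ` R" unfolding coeff_pderiv by (metis fst_conv imageI)
qed

text \<open>D is a derivation when x + eps D(x) is a homomorphism, so a homomorphism to the dual
  numbers lifting the identity is wanted; the set G expresses the lifting. E is given eps-part 0,
  and t may be sent to t + eps since it is transcendental over E.\<close>

lemma derivation_exists:
  fixes E :: "'k::field_char_0 set"
  assumes E: "subring E" and t: "\<not> algebraic_over E t"
  obtains D where "derivation D" "\<And>e. e \<in> E \<Longrightarrow> D e = 0" "D t = 1"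
proof -
  define R0 where "R0 = {(e, Dual e 0) | e. e \<in> E}"
  define G where "G = {(x :: 'k, y). re y = x}"
  have R0: "partial_hom R0"
    unfolding partial_hom_def R0_def using E
    by (auto simp: subring_def dual_defs intro: dual_unit[unfolded dual_defs])
  have re_map: "map_poly re p' = p" if "coeffs_in R p p'" "R \<subseteq> G" for R :: "('k \<times> 'k dual) set" and p p'
  proof (rule poly_eqI)
    fix i
    have "re 0 = (0 :: 'k)" by (simp add: zero_dual_def)
    moreover have "(coeff p i, coeff p' i) \<in> G" using that unfolding coeffs_in_def by blast
    ultimately show "coeff (map_poly re p') i = coeff p i" unfolding G_def by (simp add: coeff_map_poly)
  qed
  have re_poly: "re (poly p' (Dual x z)) = poly p x"
    if "coeffs_in R p p'" "R \<subseteq> G" for R :: "('k \<times> 'k dual) set" and p p' x z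
    using re_map[OF that] by (simp add: poly_dual)
  have transc: "partial_hom (adjoin R x (Dual x z))"
    if "partial_hom R" "R \<subseteq> G" "\<not> algebraic_over (fst ` R) x" for R x z
  proof (rule partial_hom_adjoin_transcendental[OF that(1,3)])
    fix p p' assume p: "coeffs_in R p p'" "p \<noteq> 0"
    have "\<forall>i. coeff p i \<in> fst ` R" using p unfolding coeffs_in_def by force
    then have "poly p x \<noteq> 0" using that(3) p unfolding algebraic_over_def by blast
    then show "poly p' (Dual x z) dvd 1" using re_poly[OF p(1) that(2)] by (intro dual_unit) simp
  qed
  have adj_G: "adjoin R x (Dual x z) \<subseteq> G" if "R \<subseteq> G" for R x z
    using re_poly[OF _ that] unfolding adjoin_def by (auto simp: G_def)
  define R1 where "R1 = adjoin R0 t (Dual t 1)"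
  have "R0 \<subseteq> G" unfolding R0_def G_def by auto
  moreover have "fst ` R0 = E" unfolding R0_def by force
  ultimately have "partial_hom R1" "R1 \<subseteq> G"
    unfolding R1_def using t R0 transc adj_G by auto
  then obtain N where N: "R1 \<subseteq> N" "partial_hom N" "N \<subseteq> G"
      and max: "\<And>S. partial_hom S \<Longrightarrow> S \<subseteq> G \<Longrightarrow> N \<subseteq> S \<Longrightarrow> S = N"
    by (rule maximal_partial_hom[where P = "\<lambda>R. R \<subseteq> G"]) (assumption | rule that | blast)+
  have "x \<in> fst ` N" for x
  proof -
    have "\<exists>z. partial_hom (adjoin N x (Dual x z))"
    proof (cases "algebraic_over (fst ` N) x")
      case True
      have "\<exists>y. (\<exists>z. y = Dual x z) \<and> partial_hom (adjoin N x y)"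
      proof (rule partial_hom_adjoin_algebraic[OF N(2) True])
        fix m m' assume m: "coeffs_in N m m'" "m \<noteq> 0" "poly m x = 0" "degree m > 0"
          and min: "\<And>p p'. coeffs_in N p p' \<Longrightarrow> p \<noteq> 0 \<Longrightarrow> poly p x = 0 \<Longrightarrow> degree m \<le> degree p"
        \<comment> \<open>In characteristic 0 the minimal polynomial is separable: its derivative is
          nonzero of smaller degree and cannot vanish at x.\<close>
        have "pderiv m \<noteq> 0" using m(4) by (simp add: pderiv_eq_0_iff)
        moreover have "degree (pderiv m) < degree m" using m(4) by (simp add: degree_pderiv)
        moreover obtain m'' where "coeffs_in N (pderiv m) m''"
          using coeffs_in_pderiv[OF N(2) m(1)] .
        ultimately have s: "poly (pderiv m) x \<noteq> 0" using min[of "pderiv m" m''] by auto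
        \<comment> \<open>Solves the eps-part of the equation for \<open>m'\<close> at
          \<open>Dual x z\<close>, which is linear in z by \<open>poly_dual\<close>.\<close>
        define z where "z = - poly (map_poly du m') x / poly (pderiv m) x"
        have "poly m' (Dual x z) = 0"
          using s m(3) re_map[OF m(1) N(3)] by (simp add: poly_dual z_def zero_dual_def)
        then show "\<exists>y. poly m' y = 0 \<and> (\<exists>z. y = Dual x z)" by blast
      qed
      then show ?thesis by blast
    next
      case False
      then show ?thesis using transc[OF N(2,3)] by blast
    qed
    then obtain z where z: "partial_hom (adjoin N x (Dual x z))" by blast
    then have "adjoin N x (Dual x z) = N" using max adj_G[OF N(3)] subset_adjoin[OF N(2)] by blast
    then have "(x, Dual x z) \<in> N" using mem_adjoin[OF N(2)] by metis
    then show ?thesis by force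
  qed
  then have "fst ` N = UNIV" by blast
  from this obtain f where f: "\<And>x y. (x, y) \<in> N \<longleftrightarrow> y = f x" "f 1 = 1"
      "\<And>x y. f (x + y) = f x + f y" "\<And>x y. f (x * y) = f x * f y"
    by (rule total_partial_hom[OF N(2)]) (assumption | rule that)+
  have re: "re (f x) = x" for x using f(1)[of x "f x"] N(3) unfolding G_def by blast
  show thesis
  proof (rule that[of "\<lambda>x. du (f x)"])
    show "derivation (\<lambda>x. du (f x))"
      unfolding derivation_def using f(3,4) re by (simp add: plus_dual_def times_dual_def)
    have "(e, Dual e 0) \<in> N" if "e \<in> E" for e
      using that N(1) subset_adjoin[OF R0] unfolding R1_def R0_def by blast
    then show "du (f e) = 0" if "e \<in> E" for e using that f(1) by (metis dual.sel(2))
    have "(t, Dual t 1) \<in> N" using mem_adjoin[OF R0] N(1) unfolding R1_def by blast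
    then show "du (f t) = 1" using f(1) by (metis dual.sel(2))
  qed
qed

section \<open>Definable sets, algebraic closure and automorphisms\<close>

(* the simproc would rewrite the sets of witnesses {y. sat I (v(i := y)) \<phi>} *)
declare [[simproc del: finite_Collect]]

section \<open>Satisfaction, renaming of variables and counting of solutions\<close>

lemma finite_fv: "finite (fv \<phi>)"
  by (induction \<phi>) auto

lemma sat_cong: "(\<And>i. i \<in> fv \<phi> \<Longrightarrow> v i = w i) \<Longrightarrow> sat I v \<phi> \<longleftrightarrow> sat I w \<phi>"
proof (induction \<phi> arbitrary: v w)
  case (Rel R js)
  then have "map v js = map w js" by (intro map_cong) auto
  then show ?case unfolding sat.simps by (rule arg_cong)
next
  case (Conj \<phi> \<psi>)
  have "sat I v \<phi> \<longleftrightarrow> sat I w \<phi>" using Conj.prems by (intro Conj.IH(1)) simp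
  moreover have "sat I v \<psi> \<longleftrightarrow> sat I w \<psi>" using Conj.prems by (intro Conj.IH(2)) simp
  ultimately show ?case by simp
next
  case (Neg \<phi>)
  have "sat I v \<phi> \<longleftrightarrow> sat I w \<phi>" using Neg.prems by (intro Neg.IH) simp
  then show ?case by simp
next
  case (Ex i \<phi>)
  then have "sat I (v(i := y)) \<phi> \<longleftrightarrow> sat I (w(i := y)) \<phi>" for y by (intro Ex.IH) auto
  then show ?case by simp
qed simp

text \<open>Bound variables are renamed as well, so for injective f no capture can occur.\<close>

primrec rename :: "(nat \<Rightarrow> nat) \<Rightarrow> 'r fm \<Rightarrow> 'r fm" where
  "rename f (Eq i j) = Eq (f i) (f j)"
| "rename f (Rel R is) = Rel R (map f is)"
| "rename f (Neg \<phi>) = Neg (rename f \<phi>)"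
| "rename f (Conj \<phi> \<psi>) = Conj (rename f \<phi>) (rename f \<psi>)"
| "rename f (Ex i \<phi>) = Ex (f i) (rename f \<phi>)"

lemma sat_rename: "inj f \<Longrightarrow> sat I v (rename f \<phi>) \<longleftrightarrow> sat I (v \<circ> f) \<phi>"
proof (induction \<phi> arbitrary: v)
  case (Ex i \<phi>)
  have "(v(f i := y)) \<circ> f = (v \<circ> f)(i := y)" for y
    using Ex.prems by (auto simp: fun_eq_iff inj_eq)
  with Ex show ?case by (simp del: comp_apply fun_upd_apply)
qed (auto simp: comp_def)

lemma fv_rename: "inj f \<Longrightarrow> fv (rename f \<phi>) = f ` fv \<phi>"
  by (induction \<phi>) (auto simp: inj_eq)

abbreviation "Disj \<phi> \<psi> \<equiv> Neg (Conj (Neg \<phi>) (Neg \<psi>))"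
abbreviation "Forall i \<phi> \<equiv> Neg (fm.Ex i (Neg \<phi>))"

lemma fresh_variable:
  obtains N :: nat where "\<And>i. i \<in> fv \<phi> \<Longrightarrow> i < N" "k < N"
proof -
  obtain N where N: "\<And>i. i \<in> insert k (fv \<phi>) \<Longrightarrow> i < N"
    using finite_nat_set_iff_bounded[of "insert k (fv \<phi>)"] finite_fv[of \<phi>] by auto
  show thesis by (rule that[of N]) (use N in auto)
qed

text \<open>At most \<open>Suc d\<close> solutions means that there is none, or that some solution w
  can be removed so that at most d remain. Adding this clause to a formula isolating an algebraic
  element keeps the solution sets finite when the parameters are changed.\<close>

lemma card_le_formula:
  fixes I :: "('r, 'u) struct"
  shows "\<exists>\<chi>. fv \<chi> \<subseteq> fv \<phi> - {i} \<and>
    (\<forall>v. sat I v \<chi> \<longleftrightarrow> finite {y. sat I (v(i := y)) \<phi>} \<and> card {y. sat I (v(i := y)) \<phi>} \<le> d)"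
proof (induction d arbitrary: \<phi>)
  case 0
  have "sat I v (Neg (fm.Ex i \<phi>)) \<longleftrightarrow>
      finite {y. sat I (v(i := y)) \<phi>} \<and> card {y. sat I (v(i := y)) \<phi>} \<le> 0" for v
  proof -
    have "sat I v (Neg (fm.Ex i \<phi>)) \<longleftrightarrow> {y. sat I (v(i := y)) \<phi>} = {}" by simp
    then show ?thesis by (metis card.empty card_eq_0_iff finite.emptyI le_zero_eq)
  qed
  then have "\<forall>v. sat I v (Neg (fm.Ex i \<phi>)) \<longleftrightarrow>
      finite {y. sat I (v(i := y)) \<phi>} \<and> card {y. sat I (v(i := y)) \<phi>} \<le> 0" by (rule allI)
  moreover have "fv (Neg (fm.Ex i \<phi>)) \<subseteq> fv \<phi> - {i}" by simp
  ultimately show ?case by (intro exI conjI)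
next
  case (Suc d)
  obtain z where z: "\<And>j. j \<in> fv \<phi> \<Longrightarrow> j < z" "i < z" using fresh_variable[of \<phi> i] by blast
  obtain \<chi> where \<chi>: "fv \<chi> \<subseteq> fv (Conj \<phi> (Neg (Eq i z))) - {i}"
    "\<And>v. sat I v \<chi> \<longleftrightarrow> finite {y. sat I (v(i := y)) (Conj \<phi> (Neg (Eq i z)))} \<and>
      card {y. sat I (v(i := y)) (Conj \<phi> (Neg (Eq i z)))} \<le> d"
    using Suc[of "Conj \<phi> (Neg (Eq i z))"] by blast
  define \<theta> where "\<theta> = Disj (Neg (fm.Ex i \<phi>)) (fm.Ex z (Conj (fm.Ex i (Conj (Eq i z) \<phi>)) \<chi>))"
  have "fv \<theta> \<subseteq> fv \<phi> - {i}" using \<chi>(1) unfolding \<theta>_def by auto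
  moreover have "sat I v \<theta> \<longleftrightarrow>
      finite {y. sat I (v(i := y)) \<phi>} \<and> card {y. sat I (v(i := y)) \<phi>} \<le> Suc d" for v
  proof -
    define Y where "Y = {y. sat I (v(i := y)) \<phi>}"
    have z_irrel: "sat I (v(z := w, i := y)) \<phi> \<longleftrightarrow> y \<in> Y" for w y
    proof -
      have "sat I (v(z := w, i := y)) \<phi> \<longleftrightarrow> sat I (v(i := y)) \<phi>"
        using z by (intro sat_cong) force
      then show ?thesis unfolding Y_def by simp
    qed
    have 1: "sat I (v(z := w)) \<chi> \<longleftrightarrow> finite (Y - {w}) \<and> card (Y - {w}) \<le> d" for w
    proof -
      have "{y. sat I (v(z := w, i := y)) (Conj \<phi> (Neg (Eq i z)))} = Y - {w}"
        using z_irrel z(2) by auto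
      then show ?thesis using \<chi>(2)[of "v(z := w)"] by simp
    qed
    have 2: "sat I (v(z := w)) (fm.Ex i (Conj (Eq i z) \<phi>)) \<longleftrightarrow> w \<in> Y" for w
      using z_irrel z(2) by auto
    have "sat I v \<theta> \<longleftrightarrow> Y = {} \<or> (\<exists>w. w \<in> Y \<and> finite (Y - {w}) \<and> card (Y - {w}) \<le> d)"
      unfolding \<theta>_def using 1 2 by (auto simp: Y_def)
    also have "\<dots> \<longleftrightarrow> finite Y \<and> card Y \<le> Suc d"
      by (auto simp: card_Diff_singleton_if)
    finally show ?thesis unfolding Y_def .
  qed
  ultimately show ?case by blast
qed

section \<open>Definable sets, algebraic closure and definable closure\<close>

definition asg :: "'u list \<Rightarrow> (nat \<Rightarrow> 'u) \<Rightarrow> nat \<Rightarrow> 'u" where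
  "asg xs v i = (if i < length xs then xs ! i else v i)"

lemma asg_single: "asg [x] v = v(0 := x)"
  by (auto simp: asg_def fun_eq_iff)

text \<open>
  The valuation need only take values in \<open>A\<close> on the free variables, since \<open>A\<close> may be empty.
\<close>

lemma definableI:
  assumes "\<And>i. i \<in> fv \<phi> \<Longrightarrow> n \<le> i \<Longrightarrow> v i \<in> A"
  shows "{xs. length xs = n \<and> sat I (asg xs v) \<phi>} \<in> definable I A n"
proof (cases "A = {}")
  case True
  then have "fv \<phi> \<subseteq> {..<n}" using assms by (meson emptyE lessThan_iff not_le subsetI)
  then have "sat I (asg xs v) \<phi> \<longleftrightarrow> sat I (nth (xs @ [])) \<phi>" if "length xs = n" for xs
    using that by (intro sat_cong) (auto simp: asg_def)
  then have *: "{xs. length xs = n \<and> sat I (asg xs v) \<phi>} =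
      {xs. length xs = n \<and> sat I (nth (xs @ [])) \<phi>}" by blast
  show ?thesis unfolding definable_def *
    using \<open>fv \<phi> \<subseteq> {..<n}\<close> by (intro CollectI exI[of _ \<phi>] exI[of _ "[]"]) auto
next
  case False
  then obtain a where a: "a \<in> A" by blast
  obtain N where N: "\<And>i. i \<in> fv \<phi> \<Longrightarrow> i < N" "n < N" using fresh_variable[of \<phi> n] by blast
  \<comment> \<open>A list has an entry at every position, so positions without a free variable are
    filled with a; this is why empty A is treated separately.\<close>
  define ps where "ps = map (\<lambda>i. if v (n + i) \<in> A then v (n + i) else a) [0..<N - n]"
  have "sat I (asg xs v) \<phi> \<longleftrightarrow> sat I (nth (xs @ ps)) \<phi>" if xs: "length xs = n" for xs
  proof (rule sat_cong)
    fix i assume i: "i \<in> fv \<phi>"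
    show "asg xs v i = (xs @ ps) ! i"
      using N(1)[OF i] assms[OF i] xs unfolding asg_def ps_def by (auto simp: nth_append)
  qed
  then have *: "{xs. length xs = n \<and> sat I (asg xs v) \<phi>} =
      {xs. length xs = n \<and> sat I (nth (xs @ ps)) \<phi>}" by blast
  have "set ps \<subseteq> A" "length ps = N - n" unfolding ps_def using a by auto
  then show ?thesis unfolding definable_def * using N
    by (intro CollectI exI[of _ \<phi>] exI[of _ ps]) auto
qed

lemma definableE:
  assumes "X \<in> definable I A n"
  obtains \<phi> v where "\<And>i. i \<in> fv \<phi> \<Longrightarrow> n \<le> i \<Longrightarrow> v i \<in> A"
    "X = {xs. length xs = n \<and> sat I (asg xs v) \<phi>}"
proof -
  obtain \<phi> ps where X: "X = {xs. length xs = n \<and> sat I (nth (xs @ ps)) \<phi>}"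
      and ps: "set ps \<subseteq> A" "fv \<phi> \<subseteq> {..<n + length ps}"
    using assms unfolding definable_def by blast
  define v where "v i = ps ! (i - n)" for i
  have "v i \<in> A" if "i \<in> fv \<phi>" "n \<le> i" for i
    using that ps unfolding v_def by (metis (no_types, lifting) add_diff_inverse_nat lessThan_iff
      nat_add_left_cancel_less not_le nth_mem subsetD)
  moreover have "(xs @ ps) ! i = asg xs v i" if "length xs = n" for xs i
    using that unfolding asg_def v_def by (simp add: nth_append)
  then have "sat I (nth (xs @ ps)) \<phi> \<longleftrightarrow> sat I (asg xs v) \<phi>" if "length xs = n" for xs
    using that by (intro sat_cong) auto
  then have "X = {xs. length xs = n \<and> sat I (asg xs v) \<phi>}" unfolding X by blast
  ultimately show thesis by (rule that)
qed

lemma definable_mono: "X \<in> definable I A n \<Longrightarrow> A \<subseteq> B \<Longrightarrow> X \<in> definable I B n"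
  by (elim definableE) (auto intro!: definableI)

lemma aclI:
  assumes "\<And>i. i \<in> fv \<phi> \<Longrightarrow> i \<noteq> 0 \<Longrightarrow> v i \<in> A" "sat I (v(0 := x)) \<phi>"
    "finite {y. sat I (v(0 := y)) \<phi>}"
  shows "x \<in> acl I A"
proof -
  have "{xs. length xs = 1 \<and> sat I (asg xs v) \<phi>} = (\<lambda>y. [y]) ` {y. sat I (v(0 := y)) \<phi>}"
    by (auto simp: length_Suc_conv asg_single)
  moreover have "{xs. length xs = 1 \<and> sat I (asg xs v) \<phi>} \<in> definable I A 1"
    using assms(1) by (intro definableI) auto
  ultimately show ?thesis unfolding acl_def using assms(2,3) by (auto simp: asg_single)
qed

lemma aclE:
  assumes "x \<in> acl I A"
  obtains \<phi> v where "\<And>i. i \<in> fv \<phi> \<Longrightarrow> i \<noteq> 0 \<Longrightarrow> v i \<in> A" "sat I (v(0 := x)) \<phi>"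
    "finite {y. sat I (v(0 := y)) \<phi>}"
proof -
  obtain D where D: "D \<in> definable I A 1" "finite D" "[x] \<in> D"
    using assms unfolding acl_def by blast
  obtain \<phi> v where v: "\<And>i. i \<in> fv \<phi> \<Longrightarrow> 1 \<le> i \<Longrightarrow> v i \<in> A"
      and "D = {xs. length xs = 1 \<and> sat I (asg xs v) \<phi>}"
    using definableE[OF D(1)] by metis
  then have "y \<in> {y. sat I (v(0 := y)) \<phi>} \<longleftrightarrow> [y] \<in> D" for y by (simp add: asg_single)
  then have "(\<lambda>y. [y]) ` {y. sat I (v(0 := y)) \<phi>} \<subseteq> D" "sat I (v(0 := x)) \<phi>"
    using D(3) by auto
  moreover from this(1) D(2) have "finite {y. sat I (v(0 := y)) \<phi>}"
    by (meson finite_imageD finite_subset inj_onI list.inject)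
  ultimately show thesis using v that[of \<phi> v] by simp
qed

lemma acl_superset: "A \<subseteq> acl I A"
proof
  fix a assume "a \<in> A"
  then show "a \<in> acl I A" by (intro aclI[of "Eq 0 1" "\<lambda>_. a"]) auto
qed

lemma acl_mono: "A \<subseteq> B \<Longrightarrow> acl I A \<subseteq> acl I B"
  by (auto simp: acl_def intro: definable_mono)

lemma acl_finite:
  assumes "x \<in> acl I A"
  obtains F where "finite F" "F \<subseteq> A" "x \<in> acl I F"
proof -
  obtain \<phi> v where v: "\<And>i. i \<in> fv \<phi> \<Longrightarrow> i \<noteq> 0 \<Longrightarrow> v i \<in> A" "sat I (v(0 := x)) \<phi>"
    "finite {y. sat I (v(0 := y)) \<phi>}" using aclE[OF assms] by blast
  show thesis
  proof (rule that[of "v ` (fv \<phi> - {0})"])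
    show "x \<in> acl I (v ` (fv \<phi> - {0}))" using v by (intro aclI[of \<phi> v]) auto
  qed (use v finite_fv in auto)
qed

text \<open>Replacing the variable \<open>j\<close> by a witness of \<open>\<psi>\<close>, whose parameters are moved out of the way.\<close>

lemma eliminate_parameter:
  fixes \<phi> \<psi> :: "'r fm" and v w :: "nat \<Rightarrow> 'u"
  obtains N \<theta> v' where
    "\<And>i. i \<in> fv \<theta> \<Longrightarrow> (i \<in> fv \<phi> \<and> i \<noteq> j \<and> v' i = v i) \<or>
       (\<exists>l. l \<in> fv \<psi> \<and> l \<noteq> 0 \<and> i = N + l \<and> v' i = w l)"
    "k < N" "j < N"
    "\<And>u. (\<forall>i\<ge>k. u i = v' i) \<Longrightarrow> k \<le> j \<Longrightarrow> sat I u \<theta> \<longleftrightarrow>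
       (\<exists>y. sat I (w(0 := y)) \<psi> \<and> sat I (\<lambda>i. if i = j then y else if i < k then u i else v i) \<phi>)"
proof -
  obtain N where N: "\<And>i. i \<in> fv \<phi> \<Longrightarrow> i < N" "k + j < N"
    using fresh_variable[of \<phi> "k + j"] by blast
  define f where "f i = (if i = 0 then j else N + i)" for i
  have f: "inj f" unfolding f_def inj_def using N(2) by auto
  define \<theta> where "\<theta> = fm.Ex j (Conj (rename f \<psi>) \<phi>)"
  define v' where "v' i = (if i < N then v i else w (i - N))" for i
  show thesis
  proof (rule that[of \<theta> v' N])
    fix i assume "i \<in> fv \<theta>"
    then have "i \<noteq> j" "i \<in> fv \<phi> \<or> i \<in> f ` fv \<psi>" unfolding \<theta>_def using fv_rename[OF f] by auto
    then show "(i \<in> fv \<phi> \<and> i \<noteq> j \<and> v' i = v i) \<or>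
       (\<exists>l. l \<in> fv \<psi> \<and> l \<noteq> 0 \<and> i = N + l \<and> v' i = w l)"
      using N(1) unfolding f_def v'_def by (auto split: if_splits)
  next
    fix u assume u: "\<forall>i\<ge>k. u i = v' i" "k \<le> j"
    have "sat I (u(j := y)) (rename f \<psi>) \<longleftrightarrow> sat I (w(0 := y)) \<psi>" for y
      unfolding sat_rename[OF f] using u N(2) by (intro sat_cong) (auto simp: f_def v'_def)
    moreover have "sat I (u(j := y)) \<phi> \<longleftrightarrow>
        sat I (\<lambda>i. if i = j then y else if i < k then u i else v i) \<phi>" for y
      using u N(1) by (intro sat_cong) (auto simp: v'_def)
    ultimately show "sat I u \<theta> \<longleftrightarrow>
       (\<exists>y. sat I (w(0 := y)) \<psi> \<and> sat I (\<lambda>i. if i = j then y else if i < k then u i else v i) \<phi>)"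
      unfolding \<theta>_def by simp
  qed (use N in auto)
qed

text \<open>Parameters from \<open>acl I A\<close> are removed one at a time: the parameter at j
  becomes a quantified solution of its own formula \<psi>. Another solution of \<psi> could give
  \<phi> infinitely many solutions; the clause \<chi> excludes this, so that the result is a finite
  union of finite sets.\<close>

lemma acl_acl: "acl I (acl I A) = acl I A"
proof
  have "x \<in> acl I A" if "sat I (v(0 := x)) \<phi>" "finite {y. sat I (v(0 := y)) \<phi>}"
    "\<And>i. i \<in> fv \<phi> \<Longrightarrow> i \<noteq> 0 \<Longrightarrow> v i \<in> acl I A" for x \<phi> v
    using that
  proof (induction "card {i \<in> fv \<phi>. i \<noteq> 0 \<and> v i \<notin> A}" arbitrary: \<phi> v rule: less_induct)
    case less
    show ?case
    proof (cases "{i \<in> fv \<phi>. i \<noteq> 0 \<and> v i \<notin> A} = {}")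
      case True
      then show ?thesis using less.prems by (intro aclI[of \<phi> v]) auto
    next
      case False
      then obtain j where j: "j \<in> fv \<phi>" "j \<noteq> 0" "v j \<notin> A" by blast
      obtain \<psi> w where w: "\<And>i. i \<in> fv \<psi> \<Longrightarrow> i \<noteq> 0 \<Longrightarrow> w i \<in> A" "sat I (w(0 := v j)) \<psi>"
        "finite {y. sat I (w(0 := y)) \<psi>}"
        using aclE[OF less.prems(3)[OF j(1,2)]] by metis
      define d where "d = card {y. sat I (v(0 := y)) \<phi>}"
      obtain \<chi> where \<chi>: "fv \<chi> \<subseteq> fv \<phi> - {0}"
        "\<And>v. sat I v \<chi> \<longleftrightarrow> finite {y. sat I (v(0 := y)) \<phi>} \<and> card {y. sat I (v(0 := y)) \<phi>} \<le> d"
        using card_le_formula[of \<phi> 0 I d] by blast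
      obtain N \<theta> v' where \<theta>:
        "\<And>i. i \<in> fv \<theta> \<Longrightarrow> (i \<in> fv (Conj \<phi> \<chi>) \<and> i \<noteq> j \<and> v' i = v i) \<or>
           (\<exists>l. l \<in> fv \<psi> \<and> l \<noteq> 0 \<and> i = N + l \<and> v' i = w l)"
        "1 < N" "j < N"
        "\<And>u. (\<forall>i\<ge>1. u i = v' i) \<Longrightarrow> 1 \<le> j \<Longrightarrow> sat I u \<theta> \<longleftrightarrow>
           (\<exists>y. sat I (w(0 := y)) \<psi> \<and>
             sat I (\<lambda>i. if i = j then y else if i < 1 then u i else v i) (Conj \<phi> \<chi>))"
        by (rule eliminate_parameter[of "Conj \<phi> \<chi>" j v \<psi> w 1 I]) (rule that)
      have vv: "(\<lambda>i. if i = j then y else if i < 1 then (v'(0 := z)) i else v i) = v(j := y, 0 := z)" for y z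
        using j(2) by (auto simp: fun_eq_iff)
      have eq: "sat I (v'(0 := z)) \<theta> \<longleftrightarrow> (\<exists>y. sat I (w(0 := y)) \<psi> \<and>
          z \<in> {z. sat I (v(j := y, 0 := z)) \<phi>} \<and> finite {z. sat I (v(j := y, 0 := z)) \<phi>} \<and>
          card {z. sat I (v(j := y, 0 := z)) \<phi>} \<le> d)" for z
      proof -
        have "sat I (v'(0 := z)) \<theta> \<longleftrightarrow> (\<exists>y. sat I (w(0 := y)) \<psi> \<and>
            sat I (v(j := y, 0 := z)) (Conj \<phi> \<chi>))"
          using \<theta>(4)[of "v'(0 := z)"] j(2) unfolding vv by auto
        then show ?thesis using \<chi>(2) by simp
      qed
      show ?thesis
      proof (rule less.hyps[of \<theta> v'])
        have "{i \<in> fv \<theta>. i \<noteq> 0 \<and> v' i \<notin> A} \<subseteq> {i \<in> fv \<phi>. i \<noteq> 0 \<and> v i \<notin> A} - {j}"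
          using \<theta>(1) w(1) \<chi>(1) by fastforce
        then show "card {i \<in> fv \<theta>. i \<noteq> 0 \<and> v' i \<notin> A} < card {i \<in> fv \<phi>. i \<noteq> 0 \<and> v i \<notin> A}"
          using j finite_fv[of \<phi>] by (intro psubset_card_mono) auto
      next
        show "sat I (v'(0 := x)) \<theta>" unfolding eq
          using w(2) less.prems d_def by (intro exI[of _ "v j"]) auto
      next
        have "{z. sat I (v'(0 := z)) \<theta>} \<subseteq> (\<Union>y\<in>{y. sat I (w(0 := y)) \<psi>}.
            if finite {z. sat I (v(j := y, 0 := z)) \<phi>} then {z. sat I (v(j := y, 0 := z)) \<phi>} else {})"
          unfolding eq by auto
        then show "finite {z. sat I (v'(0 := z)) \<theta>}"
          by (rule finite_subset) (use w(3) in auto)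
      next
        fix i assume "i \<in> fv \<theta>" "i \<noteq> 0"
        then show "v' i \<in> acl I A"
          using \<theta>(1)[of i] w(1) less.prems(3)[of i] \<chi>(1) acl_superset[of A I] by auto
      qed
    qed
  qed
  then show "acl I (acl I A) \<subseteq> acl I A" by (auto elim!: aclE)
  show "acl I A \<subseteq> acl I (acl I A)" by (rule acl_superset)
qed

lemma acl_subset: "A \<subseteq> acl I B \<Longrightarrow> acl I A \<subseteq> acl I B"
  using acl_mono acl_acl by metis

definition dcl :: "('r, 'u) struct \<Rightarrow> 'u set \<Rightarrow> 'u set" where
  "dcl I A = {x. \<exists>\<phi> v. (\<forall>i \<in> fv \<phi>. i \<noteq> 0 \<longrightarrow> v i \<in> A) \<and> (\<forall>y. sat I (v(0 := y)) \<phi> \<longleftrightarrow> y = x)}"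

lemma dcl_superset: "A \<subseteq> dcl I A"
proof
  fix a assume "a \<in> A"
  then show "a \<in> dcl I A" unfolding dcl_def
    by (intro CollectI exI[of _ "Eq 0 1"] exI[of _ "\<lambda>_. a"]) auto
qed

text \<open>Parameters are replaced one at a time by their definitions. This turns a set defined
  over field coordinates of a tuple into a set defined over the tuple itself.\<close>

lemma definable_dcl:
  assumes X: "X \<in> definable I B n" and B: "B \<subseteq> dcl I A"
  shows "X \<in> definable I A n"
proof -
  have "{xs. length xs = n \<and> sat I (asg xs v) \<phi>} \<in> definable I A n"
    if "\<And>i. i \<in> fv \<phi> \<Longrightarrow> n \<le> i \<Longrightarrow> v i \<in> dcl I A" for \<phi> v
    using that
  proof (induction "card {i \<in> fv \<phi>. n \<le> i \<and> v i \<notin> A}" arbitrary: \<phi> v rule: less_induct)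
    case less
    show ?case
    proof (cases "{i \<in> fv \<phi>. n \<le> i \<and> v i \<notin> A} = {}")
      case True
      then show ?thesis by (intro definableI) auto
    next
      case False
      then obtain j where j: "j \<in> fv \<phi>" "n \<le> j" "v j \<notin> A" by blast
      then have "v j \<in> dcl I A" using less.prems by blast
      then obtain \<psi> w where w: "\<And>i. i \<in> fv \<psi> \<Longrightarrow> i \<noteq> 0 \<Longrightarrow> w i \<in> A"
          "\<And>y. sat I (w(0 := y)) \<psi> \<longleftrightarrow> y = v j" unfolding dcl_def by blast
      obtain N \<theta> v' where \<theta>:
        "\<And>i. i \<in> fv \<theta> \<Longrightarrow> (i \<in> fv \<phi> \<and> i \<noteq> j \<and> v' i = v i) \<or>
           (\<exists>l. l \<in> fv \<psi> \<and> l \<noteq> 0 \<and> i = N + l \<and> v' i = w l)"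
        "n < N" "j < N"
        "\<And>u. (\<forall>i\<ge>n. u i = v' i) \<Longrightarrow> n \<le> j \<Longrightarrow> sat I u \<theta> \<longleftrightarrow>
           (\<exists>y. sat I (w(0 := y)) \<psi> \<and> sat I (\<lambda>i. if i = j then y else if i < n then u i else v i) \<phi>)"
        by (rule eliminate_parameter[of \<phi> j v \<psi> w n I]) (rule that)
      have "sat I (asg xs v) \<phi> \<longleftrightarrow> sat I (asg xs v') \<theta>" if "length xs = n" for xs
      proof -
        have "sat I (asg xs v') \<theta> \<longleftrightarrow>
            sat I (\<lambda>i. if i = j then v j else if i < n then (asg xs v') i else v i) \<phi>"
          using \<theta>(4)[of "asg xs v'"] j(2) that unfolding w(2) by (simp add: asg_def)
        also have "\<dots> \<longleftrightarrow> sat I (asg xs v) \<phi>"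
          using that j(2) by (intro sat_cong) (auto simp: asg_def)
        finally show ?thesis by simp
      qed
      then have eq: "{xs. length xs = n \<and> sat I (asg xs v) \<phi>} =
          {xs. length xs = n \<and> sat I (asg xs v') \<theta>}" by blast
      show ?thesis unfolding eq
      proof (rule less.hyps)
        have "{i \<in> fv \<theta>. n \<le> i \<and> v' i \<notin> A} \<subseteq> {i \<in> fv \<phi>. n \<le> i \<and> v i \<notin> A} - {j}"
          using \<theta>(1) w(1) by fastforce
        then show "card {i \<in> fv \<theta>. n \<le> i \<and> v' i \<notin> A} < card {i \<in> fv \<phi>. n \<le> i \<and> v i \<notin> A}"
          using j finite_fv[of \<phi>] by (intro psubset_card_mono) auto
      next
        fix i assume "i \<in> fv \<theta>" "n \<le> i"
        then show "v' i \<in> dcl I A"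
          using \<theta>(1)[of i] w(1) less.prems[of i] dcl_superset[of A I] by auto
      qed
    qed
  qed
  then show ?thesis using X B by (elim definableE) (simp add: subset_iff)
qed

section \<open>Automorphisms, dividing and saturation\<close>

definition automorphism :: "('r, 'u) struct \<Rightarrow> ('u \<Rightarrow> 'u) \<Rightarrow> bool" where
  "automorphism I h \<longleftrightarrow> bij h \<and> (\<forall>R xs. I R (map h xs) \<longleftrightarrow> I R xs)"

lemma automorphism_compose:
  "automorphism I g \<Longrightarrow> automorphism I h \<Longrightarrow> automorphism I (g \<circ> h)"
  unfolding automorphism_def by (metis bij_comp map_map)

lemma sat_automorphism:
  assumes "automorphism I h"
  shows "sat I (h \<circ> v) \<phi> \<longleftrightarrow> sat I v \<phi>"
proof (induction \<phi> arbitrary: v)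
  case (Eq i j)
  then show ?case using assms by (simp add: automorphism_def bij_def inj_eq)
next
  case (Rel R js)
  then show ?case using assms unfolding automorphism_def by (metis map_map sat.simps(2))
next
  case (Ex i \<phi>)
  have upd: "(h \<circ> v)(i := h y) = h \<circ> v(i := y)" for y by (auto simp: fun_eq_iff)
  have "surj h" using assms by (simp add: automorphism_def bij_def)
  have "sat I (h \<circ> v) (fm.Ex i \<phi>) \<longleftrightarrow> (\<exists>y. sat I ((h \<circ> v)(i := h y)) \<phi>)"
    using \<open>surj h\<close> unfolding sat.simps by (metis surjD)
  also have "\<dots> \<longleftrightarrow> sat I v (fm.Ex i \<phi>)" unfolding upd Ex.IH by simp
  finally show ?case .
qed simp_all

lemma acl_automorphism:
  assumes h: "automorphism I h" and "x \<in> acl I A"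
  shows "h x \<in> acl I (h ` A)"
proof -
  obtain \<phi> v where v: "\<And>i. i \<in> fv \<phi> \<Longrightarrow> i \<noteq> 0 \<Longrightarrow> v i \<in> A" "sat I (v(0 := x)) \<phi>"
    "finite {y. sat I (v(0 := y)) \<phi>}" using aclE[OF assms(2)] by metis
  have *: "sat I ((h \<circ> v)(0 := h y)) \<phi> \<longleftrightarrow> sat I (v(0 := y)) \<phi>" for y
  proof -
    have "(h \<circ> v)(0 := h y) = h \<circ> v(0 := y)" by (auto simp: fun_eq_iff)
    then show ?thesis using sat_automorphism[OF h] by metis
  qed
  have "surj h" using h by (simp add: automorphism_def bij_def)
  have "{y. sat I ((h \<circ> v)(0 := y)) \<phi>} \<subseteq> h ` {y. sat I (v(0 := y)) \<phi>}"
  proof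
    fix y assume y: "y \<in> {y. sat I ((h \<circ> v)(0 := y)) \<phi>}"
    obtain z where z: "y = h z" using \<open>surj h\<close> by (rule surjE)
    then have "sat I (v(0 := z)) \<phi>" using y *[of z] by simp
    then show "y \<in> h ` {y. sat I (v(0 := y)) \<phi>}" using z by blast
  qed
  then have "finite {y. sat I ((h \<circ> v)(0 := y)) \<phi>}" using v(3) finite_surj by blast
  moreover have "sat I ((h \<circ> v)(0 := h x)) \<phi>" using v(2) * by blast
  moreover have "(h \<circ> v) i \<in> h ` A" if "i \<in> fv \<phi>" "i \<noteq> 0" for i using v(1) that by simp
  ultimately show ?thesis using aclI[of \<phi> "h \<circ> v" "h ` A"] by blast
qed

lemma definable_automorphism:
  assumes X: "X \<in> definable I A n" and h: "automorphism I h" "\<And>a. a \<in> A \<Longrightarrow> h a = a"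
  shows "map h xs \<in> X \<longleftrightarrow> xs \<in> X"
proof -
  obtain \<phi> v where v: "\<And>i. i \<in> fv \<phi> \<Longrightarrow> n \<le> i \<Longrightarrow> v i \<in> A"
      "X = {xs. length xs = n \<and> sat I (asg xs v) \<phi>}" using definableE[OF X] by metis
  have "sat I (asg (map h xs) v) \<phi> \<longleftrightarrow> sat I (asg xs v) \<phi>" if "length xs = n"
  proof -
    have "sat I (asg (map h xs) v) \<phi> \<longleftrightarrow> sat I (h \<circ> asg xs v) \<phi>"
      using that v(1) h(2) by (intro sat_cong) (auto simp: asg_def)
    then show ?thesis using sat_automorphism[OF h(1)] by simp
  qed
  then show ?thesis unfolding v(2) by auto
qed

text \<open>D is chosen before the automorphisms, so infinitely many images of x under automorphisms
  over A refute algebraicity.\<close>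

lemma acl_finite_orbit:
  assumes "x \<in> acl I A"
  obtains D where "finite D" "\<And>h. automorphism I h \<Longrightarrow> (\<And>a. a \<in> A \<Longrightarrow> h a = a) \<Longrightarrow> h x \<in> D"
proof -
  obtain D where D: "D \<in> definable I A 1" "finite D" "[x] \<in> D"
    using assms unfolding acl_def by blast
  show thesis
  proof (rule that[of "hd ` D"])
    show "finite (hd ` D)" using D by simp
  next
    fix h assume "automorphism I h" "\<And>a. a \<in> A \<Longrightarrow> h a = a"
    then have "map h [x] \<in> D" using definable_automorphism[OF D(1)] D(3) by blast
    then show "h x \<in> hd ` D" by force
  qed
qed

lemma same_type_automorphism:
  assumes "automorphism I h"
  shows "same_type I {} b (map h b)"
  unfolding same_type_def using definable_automorphism[OF _ assms] by auto

text \<open>Conjugates of the parameters under automorphisms have the same type over the empty set,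
  and their instances are the images of X. So it suffices that the images are
  k-inconsistent.\<close>

lemma divides_automorphisms:
  assumes X: "X \<in> definable I A n" and h: "\<And>j :: nat. automorphism I (h j)"
    and k: "\<And>J. finite J \<Longrightarrow> card J = k \<Longrightarrow> (\<Inter>j\<in>J. map (h j) ` X) = {}"
  shows "divides I {} n X"
proof -
  obtain \<phi> ps where X': "X = {xs. length xs = n \<and> sat I (nth (xs @ ps)) \<phi>}"
      and ps: "set ps \<subseteq> A" "fv \<phi> \<subseteq> {..<n + length ps}"
    using X unfolding definable_def by blast
  define D where "D = {xs. length xs = n + length ps \<and> sat I (nth (xs @ [])) \<phi>}"
  have "D \<in> definable I {} (n + length ps)"
    unfolding definable_def D_def using ps(2) by (intro CollectI exI[of _ \<phi>] exI[of _ "[]"]) auto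
  moreover have "X = fibre D n ps" unfolding fibre_def X' D_def by auto
  moreover have "fibre D n (map (h j) ps) = map (h j) ` X" for j
  proof -
    have inv: "map (h j) xs \<in> D \<longleftrightarrow> xs \<in> D" for xs
      using definable_automorphism[OF \<open>D \<in> definable I {} (n + length ps)\<close> h] by simp
    have "surj (h j)" using h unfolding automorphism_def bij_def by blast
    have "x \<in> map (h j) ` X" if "x \<in> fibre D n (map (h j) ps)" for x
    proof -
      have x: "x = map (h j) (map (inv_into UNIV (h j)) x)"
        using \<open>surj (h j)\<close> by (simp add: surj_iff)
      moreover have "map (inv_into UNIV (h j)) x \<in> X"
        using that inv[of "map (inv_into UNIV (h j)) x @ ps"] x
        unfolding \<open>X = fibre D n ps\<close> fibre_def by simp
      ultimately show ?thesis by blast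
    qed
    moreover have "map (h j) x \<in> fibre D n (map (h j) ps)" if "x \<in> X" for x
      using that inv[of "x @ ps"] unfolding \<open>X = fibre D n ps\<close> fibre_def by simp
    ultimately show ?thesis by blast
  qed
  ultimately show ?thesis
    unfolding divides_def using same_type_automorphism[OF h, of ps] k
    by (intro exI[of _ "length ps"] exI[of _ ps] bexI[of _ D] conjI exI[of _ k]
        exI[of _ "\<lambda>j. map (h j) ps"]) auto
qed

lemma not_indep_divides:
  assumes "X \<in> definable I (A \<union> B) (length x)" "x \<in> X" "divides I A (length x) X"
  shows "\<not> indep I A x B"
  unfolding indep_def forks_def using assms by (metis Sup_insert Sup_empty finite.emptyI finite.insertI singletonD sup_bot_right order_refl)

text \<open>In an infinite structure the complements of the finite A-definable sets have the finite
  intersection property, and a realization lies in no finite A-definable set.\<close>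

lemma exists_not_acl:
  fixes I :: "('r, 'u) struct"
  assumes "saturated I" "infinite (UNIV :: 'u set)" "finite A"
  obtains x where "x \<notin> acl I A"
proof -
  define p where "p = {{xs. length xs = 1} - D | D. D \<in> definable I A 1 \<and> finite D}"
  have "small A" unfolding small_def using assms(2,3) finite_lesspoll_infinite by blast
  moreover have "p \<subseteq> definable I A 1"
  proof
    fix X assume "X \<in> p"
    then obtain D where D: "X = {xs. length xs = 1} - D" "D \<in> definable I A 1"
      unfolding p_def by blast
    obtain \<phi> v where v: "\<And>i. i \<in> fv \<phi> \<Longrightarrow> 1 \<le> i \<Longrightarrow> v i \<in> A"
        "D = {xs. length xs = 1 \<and> sat I (asg xs v) \<phi>}" using definableE[OF D(2)] by metis
    then have "X = {xs. length xs = 1 \<and> sat I (asg xs v) (Neg \<phi>)}" unfolding D(1) by auto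
    then show "X \<in> definable I A 1" using definableI[of "Neg \<phi>" 1 v A I] v(1) by simp
  qed
  moreover have "\<Inter>F \<noteq> {}" if F: "F \<subseteq> p" "finite F" for F
  proof -
    have "\<forall>X\<in>F. \<exists>D. X = {xs. length xs = 1} - D \<and> finite D" using F(1) unfolding p_def by blast
    then obtain D where D: "\<And>X. X \<in> F \<Longrightarrow> X = {xs. length xs = 1} - D X \<and> finite (D X)" by metis
    have "infinite {xs :: 'u list. length xs = 1}"
    proof
      assume "finite {xs :: 'u list. length xs = 1}"
      then have "finite (hd ` {xs :: 'u list. length xs = 1})" by simp
      moreover have "hd ` {xs :: 'u list. length xs = 1} = UNIV"
        by (auto intro!: image_eqI[of _ _ "[_]"])
      ultimately show False using assms(2) by simp
    qed
    moreover have "finite (\<Union>X\<in>F. D X)" using F(2) D by auto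
    ultimately obtain xs where "length xs = 1" "xs \<notin> (\<Union>X\<in>F. D X)"
      by (metis (mono_tags, lifting) finite_subset mem_Collect_eq subsetI)
    then have "xs \<in> \<Inter>F" using D by blast
    then show ?thesis by blast
  qed
  ultimately obtain xs where xs: "xs \<in> \<Inter>p"
    using assms(1) unfolding saturated_def by (metis equals0I)
  \<comment> \<open>Puts the set of all one-element lists into p, so that a point of the
    intersection is known to have length 1.\<close>
  have "{} \<in> definable I A 1"
    using definableI[of "Neg (fm.Ex 0 (Eq 0 0))" 1 "\<lambda>_. undefined" A I] by simp
  then have "{xs. length xs = 1} - {} \<in> p" unfolding p_def by blast
  then have "length xs = 1" using xs by blast
  then obtain x where x: "xs = [x]" by (auto simp: length_Suc_conv)
  have "x \<notin> acl I A"
  proof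
    assume "x \<in> acl I A"
    then obtain D where "D \<in> definable I A 1" "finite D" "[x] \<in> D" unfolding acl_def by blast
    then show False using xs x unfolding p_def by blast
  qed
  then show thesis by (rule that)
qed

section \<open>The pregeometry of an algebraically closed field\<close>

abbreviation cl :: "'k::field set \<Rightarrow> 'k set" where
  "cl \<equiv> acl field_struct"

text \<open>Horner's scheme. Variable 0 carries the argument and variable 1 the value, so parameters
  start at 2.\<close>

lemma polynomial_formula:
  fixes p :: "'k::field poly"
  assumes "\<And>i. coeff p i \<in> C"
  shows "\<exists>\<phi> v. (\<forall>i\<in>fv \<phi>. 2 \<le> i \<longrightarrow> v i \<in> C) \<and>
    (\<forall>x y. sat field_struct (v(0 := x, 1 := y)) \<phi> \<longleftrightarrow> y = poly p x)"
  using assms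
proof (induction p)
  case 0
  have "sat field_struct (v(0 := x, 1 := y)) (Rel Zero [1]) \<longleftrightarrow> y = poly 0 x" for v x y
    by simp
  then show ?case by (intro exI[of _ "Rel Zero [1]"]) auto
next
  case (pCons a p)
  have a: "a \<in> C" using pCons.prems[of 0] by simp
  have "coeff p i \<in> C" for i using pCons.prems[of "Suc i"] by simp
  from pCons.IH[OF this] obtain \<phi> v where v: "\<And>i. i \<in> fv \<phi> \<Longrightarrow> 2 \<le> i \<Longrightarrow> v i \<in> C"
      "\<And>x y. sat field_struct (v(0 := x, 1 := y)) \<phi> \<longleftrightarrow> y = poly p x" by metis
  obtain N where N: "\<And>i. i \<in> fv \<phi> \<Longrightarrow> i < N" "1 < N" using fresh_variable[of \<phi> 1] by blast
  \<comment> \<open>A transposition, so that it is injective: the value of p moves to the fresh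
    variable N, and variable 1 is free for the new value. \<open>Suc N\<close> carries the product
    and \<open>Suc (Suc N)\<close> the coefficient a.\<close>
  define f where "f i = (if i = 1 then N else if i = N then 1 else i)" for i
  have f: "inj f" unfolding f_def inj_def by auto
  define \<theta> where "\<theta> = fm.Ex N (Conj (rename f \<phi>)
    (fm.Ex (Suc N) (Conj (Rel Mult [0, N, Suc N]) (Rel Add [Suc (Suc N), Suc N, 1]))))"
  define v' where "v' = v(Suc (Suc N) := a)"
  have "v' i \<in> C" if "i \<in> fv \<theta>" "2 \<le> i" for i
  proof -
    have "i \<noteq> N \<and> (i \<in> f ` fv \<phi> \<or> i = Suc (Suc N))"
      using that unfolding \<theta>_def fv.simps fv_rename[OF f] by auto
    then have "i \<in> fv \<phi> \<or> i = Suc (Suc N)" using that(2) unfolding f_def by (auto split: if_splits)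
    then show ?thesis using v(1)[OF _ that(2)] a unfolding v'_def by auto
  qed
  moreover have "sat field_struct (v'(0 := x, 1 := y)) \<theta> \<longleftrightarrow> y = poly (pCons a p) x" for x y
  proof -
    have 1: "sat field_struct (v'(0 := x, 1 := y, N := z)) (rename f \<phi>) \<longleftrightarrow> z = poly p x" for z
    proof -
      have "sat field_struct ((v'(0 := x, 1 := y, N := z)) \<circ> f) \<phi> \<longleftrightarrow>
          sat field_struct (v(0 := x, 1 := z)) \<phi>"
        using N by (intro sat_cong) (force simp: f_def v'_def)
      then show ?thesis using v(2) sat_rename[OF f] by blast
    qed
    have "sat field_struct (v'(0 := x, 1 := y)) \<theta> \<longleftrightarrow>
        (\<exists>z. sat field_struct (v'(0 := x, 1 := y, N := z)) (rename f \<phi>) \<and> y = a + x * z)"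
      using N(2) unfolding \<theta>_def by (simp add: v'_def)
    then show ?thesis unfolding 1 by simp
  qed
  ultimately show ?case by blast
qed

text \<open>Hence an element outside \<open>cl A\<close> is transcendental over the ring
  \<open>cl A\<close>, which is the hypothesis under which automorphisms and derivations are
  constructed.\<close>

lemma algebraic_over_cl:
  assumes "algebraic_over (cl A) x"
  shows "x \<in> cl A"
proof -
  obtain p where p: "p \<noteq> 0" "\<And>i. coeff p i \<in> cl A" "poly p x = 0"
    using assms unfolding algebraic_over_def by blast
  obtain \<phi> v where v: "\<And>i. i \<in> fv \<phi> \<Longrightarrow> 2 \<le> i \<Longrightarrow> v i \<in> cl A"
      "\<And>x y. sat field_struct (v(0 := x, 1 := y)) \<phi> \<longleftrightarrow> y = poly p x"
    using polynomial_formula[OF p(2)] by metis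
  have eq: "sat field_struct (v(0 := x)) (fm.Ex 1 (Conj \<phi> (Rel Zero [1]))) \<longleftrightarrow> poly p x = 0" for x
    using v(2)[of x] by auto
  have "x \<in> acl field_struct (cl A)"
  proof (rule aclI)
    show "sat field_struct (v(0 := x)) (fm.Ex 1 (Conj \<phi> (Rel Zero [1])))"
      unfolding eq by (rule p(3))
    show "finite {y. sat field_struct (v(0 := y)) (fm.Ex 1 (Conj \<phi> (Rel Zero [1])))}"
      unfolding eq using p(1) by (rule poly_roots_finite)
    show "v i \<in> cl A" if "i \<in> fv (fm.Ex 1 (Conj \<phi> (Rel Zero [1])))" "i \<noteq> 0" for i
      using v(1)[of i] that by auto
  qed
  then show ?thesis by (simp add: acl_acl)
qed

lemma subring_cl: "subring (cl A)"
  unfolding subring_def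
proof (intro conjI ballI)
  show "1 \<in> cl A" by (rule aclI[of "Rel One [0]"]) auto
next
  fix x y assume xy: "x \<in> cl A" "y \<in> cl A"
  have fin: "{z. x = z + y} = {x - y}" by auto
  have "x - y \<in> acl field_struct (cl A)"
    by (rule aclI[of "Rel Add [0, 1, 2]" "\<lambda>i. if i = 1 then y else x"])
      (use xy fin in auto)
  then show "x - y \<in> cl A" by (simp add: acl_acl)
  have "x * y \<in> acl field_struct (cl A)"
    by (rule aclI[of "Rel Mult [1, 2, 0]" "\<lambda>i. if i = 1 then x else y"]) (use xy in auto)
  then show "x * y \<in> cl A" by (simp add: acl_acl)
qed

lemmas cl_0 = subring_0[OF subring_cl]
  and cl_add = subring_add[OF subring_cl]
  and cl_minus = subring_minus[OF subring_cl]

lemma cl_1: "1 \<in> cl A" and cl_diff: "x \<in> cl A \<Longrightarrow> y \<in> cl A \<Longrightarrow> x - y \<in> cl A"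
  and cl_mult: "x \<in> cl A \<Longrightarrow> y \<in> cl A \<Longrightarrow> x * y \<in> cl A"
  using subring_cl[of A] unfolding subring_def by auto

lemma cl_of_nat: "of_nat n \<in> cl A"
  by (induction n) (simp_all add: cl_0 cl_1 cl_add)

lemma cl_inverse: "x \<in> cl A \<Longrightarrow> inverse x \<in> cl A"
proof (cases "x = 0")
  case False
  assume x: "x \<in> cl A"
  have "algebraic_over (cl A) (inverse x)"
    unfolding algebraic_over_def
    by (rule exI[of _ "[:- 1, x:]"])
      (use False x in \<open>auto simp: coeff_pCons cl_1 cl_0 cl_minus split: nat.split\<close>)
  then show ?thesis by (rule algebraic_over_cl)
qed simp

lemma cl_divide: "x \<in> cl A \<Longrightarrow> y \<in> cl A \<Longrightarrow> x / y \<in> cl A"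
  by (simp add: divide_inverse cl_mult cl_inverse)

lemma cl_algebraic:
  assumes "algebraic x"
  shows "x \<in> cl A"
proof -
  obtain p where p: "\<And>i. coeff p i \<in> \<int>" "p \<noteq> 0" "poly p x = 0" 
    using assms unfolding algebraic_def by blast
  have "z \<in> cl A" if "z \<in> \<int>" for z
    using that by (metis Ints_cases cl_minus cl_of_nat int_cases of_int_minus of_int_of_nat_eq)
  then have "algebraic_over (cl A) x" unfolding algebraic_over_def using p by blast
  then show ?thesis by (rule algebraic_over_cl)
qed

lemma cl_poly: "x \<in> cl A \<Longrightarrow> (\<And>i. coeff p i \<in> cl A) \<Longrightarrow> poly p x \<in> cl A"
proof (induction p)
  case (pCons a p)
  have "coeff p i \<in> cl A" for i using pCons.prems(2)[of "Suc i"] by simp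
  then show ?case using pCons.IH pCons.prems(1) pCons.prems(2)[of 0] by (simp add: cl_add cl_mult)
qed (simp add: cl_0)

lemma cl_insert: "x \<in> cl A \<Longrightarrow> cl (insert x A) = cl A"
  by (intro antisym acl_subset acl_mono) (use acl_superset[of A] in auto)

section \<open>Field automorphisms, exchange and homogeneity\<close>

lemma field_aut_simps:
  assumes "field_aut \<sigma>"
  shows "\<sigma> (x + y) = \<sigma> x + \<sigma> y" "\<sigma> (x * y) = \<sigma> x * \<sigma> y" "\<sigma> 0 = 0" "\<sigma> 1 = 1" "\<sigma> (- x) = - \<sigma> x"
    "\<sigma> (x - y) = \<sigma> x - \<sigma> y" "\<sigma> x = \<sigma> y \<longleftrightarrow> x = y" "\<sigma> x = 0 \<longleftrightarrow> x = 0" "\<sigma> x = 1 \<longleftrightarrow> x = 1"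
proof -
  have add: "\<sigma> (x + y) = \<sigma> x + \<sigma> y" for x y using assms unfolding field_aut_def by simp
  have mult: "\<sigma> (x * y) = \<sigma> x * \<sigma> y" for x y using assms unfolding field_aut_def by simp
  have inj: "\<sigma> x = \<sigma> y \<longleftrightarrow> x = y" for x y
    using assms unfolding field_aut_def by (simp add: bij_def inj_eq)
  have zero: "\<sigma> 0 = 0" using add[of 0 0] by (metis add_0 add_cancel_left_right)
  have "\<sigma> 1 \<noteq> 0" using inj[of 1 0] zero by simp
  moreover have "\<sigma> 1 * \<sigma> 1 = \<sigma> 1 * 1" using mult[of 1 1] by simp
  ultimately have one: "\<sigma> 1 = 1" using mult_left_cancel by blast
  have minus: "\<sigma> (- x) = - \<sigma> x" for x
    using add[of x "- x"] zero by (simp add: eq_neg_iff_add_eq_0 add.commute)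
  show "\<sigma> (x + y) = \<sigma> x + \<sigma> y" "\<sigma> (x * y) = \<sigma> x * \<sigma> y" "\<sigma> 0 = 0" "\<sigma> 1 = 1" "\<sigma> (- x) = - \<sigma> x"
    "\<sigma> x = \<sigma> y \<longleftrightarrow> x = y" "\<sigma> x = 0 \<longleftrightarrow> x = 0" "\<sigma> x = 1 \<longleftrightarrow> x = 1"
    using add mult zero one minus inj[of x 0] inj[of x 1] inj by simp_all
  show "\<sigma> (x - y) = \<sigma> x - \<sigma> y" using add[of x "- y"] minus by simp
qed

lemma field_aut_compose: "field_aut \<sigma> \<Longrightarrow> field_aut \<tau> \<Longrightarrow> field_aut (\<sigma> \<circ> \<tau>)"
  unfolding field_aut_def by (auto intro: bij_comp)

lemma field_aut_inverse:
  assumes "field_aut \<sigma>"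
  shows "field_aut (inv_into UNIV \<sigma>)"
proof -
  have b: "bij \<sigma>" using assms unfolding field_aut_def by blast
  then have i: "inv_into UNIV \<sigma> x = y \<longleftrightarrow> x = \<sigma> y" for x y
    by (metis bij_inv_eq_iff)
  have s: "\<sigma> (inv_into UNIV \<sigma> x) = x" for x using b by (simp add: bij_is_surj surj_f_inv_f)
  show ?thesis
    unfolding field_aut_def i field_aut_simps[OF assms] s using b by (simp add: bij_imp_bij_inv)
qed

lemma automorphism_field_aut:
  assumes "field_aut \<sigma>"
  shows "automorphism field_struct \<sigma>"
  unfolding automorphism_def
proof (intro conjI allI)
  note s = field_aut_simps[OF assms]
  show "bij \<sigma>" using assms unfolding field_aut_def by blast
  fix R xs
  show "field_struct R (map \<sigma> xs) \<longleftrightarrow> field_struct R xs"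
  proof (cases R)
    case Add
    have "(\<exists>a b. map \<sigma> xs = [a, b, a + b]) \<longleftrightarrow> (\<exists>a b. xs = [a, b, a + b])"
      by (auto simp: map_eq_Cons_conv s(1)[symmetric] s(7))
    then show ?thesis using Add by simp
  next
    case Mult
    have "(\<exists>a b. map \<sigma> xs = [a, b, a * b]) \<longleftrightarrow> (\<exists>a b. xs = [a, b, a * b])"
      by (auto simp: map_eq_Cons_conv s(2)[symmetric] s(7))
    then show ?thesis using Mult by simp
  qed (auto simp: map_eq_Cons_conv s)
qed

lemma cl_swap:
  fixes A :: "'k::alg_closed_field set"
  assumes "t \<notin> cl A" "u \<notin> cl (insert t A)"
  obtains \<sigma> where "field_aut \<sigma>" "\<And>e. e \<in> cl A \<Longrightarrow> \<sigma> e = e" "\<sigma> t = u" "\<sigma> u = t"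
proof (rule swap_automorphism[OF subring_cl])
  show "\<not> algebraic_over (cl A) t" using assms(1) algebraic_over_cl by blast
  have "{poly p t | p. \<forall>i. coeff p i \<in> cl A} \<subseteq> cl (insert t A)"
    using cl_poly acl_superset[of "insert t A"] acl_mono[of A "insert t A"] by blast
  then show "\<not> algebraic_over {poly p t | p. \<forall>i. coeff p i \<in> cl A} u"
    using assms(2) algebraic_over_cl algebraic_over_mono by blast
next
  fix \<sigma> assume "field_aut \<sigma>" "\<And>e. e \<in> cl A \<Longrightarrow> \<sigma> e = e" "\<sigma> t = u" "\<sigma> u = t"
  then show thesis by (rule that)
qed

text \<open>Were t not in \<open>cl (insert x A)\<close>, an automorphism over A could exchange x
  and t. It would carry the dependence of x on t to a dependence of t on x.\<close>

lemma cl_exchange: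
  fixes A :: "'k::alg_closed_field set"
  assumes "x \<notin> cl A" "x \<in> cl (insert t A)"
  shows "t \<in> cl (insert x A)"
proof (rule ccontr)
  assume "t \<notin> cl (insert x A)"
  then obtain \<sigma> where \<sigma>: "field_aut \<sigma>" "\<And>e. e \<in> cl A \<Longrightarrow> \<sigma> e = e" "\<sigma> x = t" "\<sigma> t = x"
    using cl_swap[OF assms(1)] by metis
  have "\<sigma> x \<in> cl (\<sigma> ` insert t A)"
    using acl_automorphism[OF automorphism_field_aut[OF \<sigma>(1)] assms(2)] .
  moreover have "\<sigma> ` insert t A = insert x A"
    using \<sigma>(2,4) acl_superset[of A field_struct] by force
  ultimately show False using \<sigma>(3) \<open>t \<notin> cl (insert x A)\<close> by simp
qed

lemma exists_not_cl:
  fixes A :: "'k::field_char_0 set"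
  assumes "saturated (field_struct :: (field_sym, 'k) struct)" "finite A"
  obtains x where "x \<notin> cl A"
  using exists_not_acl[OF assms(1) infinite_UNIV_char_0 assms(2)] by blast

text \<open>t and t' may depend on each other over A, and then they cannot be exchanged directly.
  Both can be exchanged with an element u transcendental over A, t and t'.\<close>

lemma cl_homogeneous:
  fixes A :: "'k::{alg_closed_field, field_char_0} set"
  assumes "saturated (field_struct :: (field_sym, 'k) struct)" "finite A"
    and "t \<notin> cl A" "t' \<notin> cl A"
  obtains \<sigma> where "field_aut \<sigma>" "\<And>e. e \<in> cl A \<Longrightarrow> \<sigma> e = e" "\<sigma> t = t'"
proof -
  obtain u where u: "u \<notin> cl ({t, t'} \<union> A)"
    using exists_not_cl[OF assms(1), of "{t, t'} \<union> A"] assms(2) by auto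
  have "cl (insert t A) \<subseteq> cl ({t, t'} \<union> A)" "cl (insert t' A) \<subseteq> cl ({t, t'} \<union> A)"
    by (intro acl_mono; auto)+
  then have u: "u \<notin> cl (insert t A)" "u \<notin> cl (insert t' A)" using u by blast+
  obtain \<sigma> where \<sigma>: "field_aut \<sigma>" "\<And>e. e \<in> cl A \<Longrightarrow> \<sigma> e = e" "\<sigma> t = u" "\<sigma> u = t"
    using cl_swap[OF assms(3) u(1)] by metis
  obtain \<tau> where \<tau>: "field_aut \<tau>" "\<And>e. e \<in> cl A \<Longrightarrow> \<tau> e = e" "\<tau> t' = u" "\<tau> u = t'"
    using cl_swap[OF assms(4) u(2)] by metis
  show thesis
    by (rule that[of "\<tau> \<circ> \<sigma>"]) (use \<sigma> \<tau> field_aut_compose in auto)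
qed

text \<open>The elements of a finite part of T are added one by one; t is the one at which y becomes
  algebraic.\<close>

lemma cl_minimal:
  assumes "y \<in> cl (T \<union> Z)" "y \<notin> cl Z"
  obtains F t where "finite F" "F \<subseteq> T" "t \<in> T" "y \<notin> cl (F \<union> Z)" "y \<in> cl (insert t (F \<union> Z))"
proof -
  obtain G where G: "finite G" "G \<subseteq> T \<union> Z" "y \<in> cl G" using acl_finite[OF assms(1)] by metis
  have *: "finite S \<Longrightarrow> S \<subseteq> T \<Longrightarrow> y \<in> cl (S \<union> Z) \<Longrightarrow>
      \<exists>F t. finite F \<and> F \<subseteq> T \<and> t \<in> T \<and> y \<notin> cl (F \<union> Z) \<and> y \<in> cl (insert t (F \<union> Z))" for S
  proof (induction S rule: finite_induct)
    case empty
    then show ?case using assms(2) by simp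
  next
    case (insert t S)
    then show ?case by (cases "y \<in> cl (S \<union> Z)") auto
  qed
  have "y \<in> cl (G \<inter> T \<union> Z)" using G acl_mono[of G "G \<inter> T \<union> Z"] by blast
  then show thesis using *[of "G \<inter> T"] G(1) that by auto
qed

lemma cl_derivation:
  fixes A :: "'k::field_char_0 set"
  assumes "t \<notin> cl A"
  obtains D where "derivation D" "\<And>e. e \<in> cl A \<Longrightarrow> D e = 0" "D t = 1"
  using derivation_exists[OF subring_cl] assms algebraic_over_cl by metis

section \<open>Polynomials and the quadric\<close>

definition monomial_at :: "(nat \<Rightarrow>\<^sub>0 nat) \<Rightarrow> 'k::comm_ring_1 list \<Rightarrow> 'k" where
  "monomial_at m x = (\<Prod>i\<in>Poly_Mapping.keys m. (x ! i) ^ Poly_Mapping.lookup m i)"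

lemma monomial_at_superset:
  assumes "finite S" "Poly_Mapping.keys m \<subseteq> S"
  shows "monomial_at m x = (\<Prod>i\<in>S. (x ! i) ^ Poly_Mapping.lookup m i)"
  unfolding monomial_at_def using assms
  by (intro prod.mono_neutral_left) (auto simp: in_keys_iff)

lemma monomial_at_add: "monomial_at (m + m') x = monomial_at m x * monomial_at m' x"
proof -
  let ?S = "Poly_Mapping.keys m \<union> Poly_Mapping.keys m'"
  have "Poly_Mapping.keys (m + m') \<subseteq> ?S" by (rule Poly_Mapping.keys_add)
  then show ?thesis
    by (simp add: monomial_at_superset[of ?S] lookup_add power_add prod.distrib)
qed

lemma monomial_at_single: "monomial_at (Poly_Mapping.single i k) x = (x ! i) ^ k"
  by (simp add: monomial_at_superset[of "{i}"])

lemma monomial_at_0: "monomial_at 0 x = 1"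
  by (simp add: monomial_at_def)

lemma eval_mpoly_superset:
  assumes "finite S" "Poly_Mapping.keys Q \<subseteq> S"
  shows "eval_mpoly Q x = (\<Sum>m\<in>S. Poly_Mapping.lookup Q m * monomial_at m x)"
  unfolding eval_mpoly_def monomial_at_def[symmetric] using assms
  by (intro sum.mono_neutral_left) (auto simp: in_keys_iff)

lemma eval_mpoly_0: "eval_mpoly 0 x = 0"
  by (simp add: eval_mpoly_def)

lemma eval_mpoly_add: "eval_mpoly (P + Q) x = eval_mpoly P x + eval_mpoly Q x"
proof -
  let ?S = "Poly_Mapping.keys P \<union> Poly_Mapping.keys Q"
  have "Poly_Mapping.keys (P + Q) \<subseteq> ?S" by (rule Poly_Mapping.keys_add)
  then show ?thesis
    by (simp add: eval_mpoly_superset[of ?S] lookup_add algebra_simps sum.distrib)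
qed

lemma eval_mpoly_diff: "eval_mpoly (P - Q) x = eval_mpoly P x - eval_mpoly Q x"
  using eval_mpoly_add[of "P - Q" Q x] by simp

lemma eval_mpoly_sum: "eval_mpoly (sum f A) x = (\<Sum>a\<in>A. eval_mpoly (f a) x)"
  by (induction A rule: infinite_finite_induct) (simp_all add: eval_mpoly_0 eval_mpoly_add)

lemma eval_mpoly_single: "eval_mpoly (Poly_Mapping.single m c) x = c * monomial_at m x"
  by (simp add: eval_mpoly_superset[of "{m}"])

lemma lookup_map_zero:
  "f 0 = 0 \<Longrightarrow> Poly_Mapping.lookup (Poly_Mapping.map f Q) m = f (Poly_Mapping.lookup Q m)"
  by (simp add: Poly_Mapping.map.rep_eq when_def)

lemma keys_map_subset: "f 0 = 0 \<Longrightarrow> Poly_Mapping.keys (Poly_Mapping.map f Q) \<subseteq> Poly_Mapping.keys Q"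
  by (auto simp: in_keys_iff lookup_map_zero)

lemma in_vars_subset: "in_vars n Q \<Longrightarrow> Poly_Mapping.keys P \<subseteq> Poly_Mapping.keys Q \<Longrightarrow> in_vars n P"
  unfolding in_vars_def by blast

lemma in_vars_map: "f 0 = 0 \<Longrightarrow> in_vars n Q \<Longrightarrow> in_vars n (Poly_Mapping.map f Q)"
  by (meson in_vars_subset keys_map_subset)

lemma in_vars_diff: "in_vars n P \<Longrightarrow> in_vars n Q \<Longrightarrow> in_vars n (P - Q)"
  unfolding in_vars_def using keys_diff[of P Q] by blast

definition partial_at :: "nat \<Rightarrow> 'k::comm_ring_1 mpoly \<Rightarrow> 'k list \<Rightarrow> 'k" where
  "partial_at i Q x = eval_mpoly (partial_deriv i Q) x"

lemma partial_at_superset: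
  assumes "finite S" "Poly_Mapping.keys Q \<subseteq> S"
  shows "partial_at i Q x = (\<Sum>m\<in>S. of_nat (Poly_Mapping.lookup m i) * Poly_Mapping.lookup Q m *
    monomial_at (m - Poly_Mapping.single i 1) x)"
  unfolding partial_at_def partial_deriv_def eval_mpoly_sum eval_mpoly_single
  using assms by (intro sum.mono_neutral_left) (auto simp: in_keys_iff)

definition ring_hom_fun :: "('a::comm_ring_1 \<Rightarrow> 'b::comm_ring_1) \<Rightarrow> bool" where
  "ring_hom_fun h \<longleftrightarrow> h 1 = 1 \<and> (\<forall>x y. h (x + y) = h x + h y) \<and> (\<forall>x y. h (x * y) = h x * h y)"

lemma ring_hom_fun_simps:
  assumes "ring_hom_fun h"
  shows "h 0 = 0" "h 1 = 1" "h (x + y) = h x + h y" "h (x * y) = h x * h y"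
    "h (sum f A) = (\<Sum>a\<in>A. h (f a))" "h (prod f A) = (\<Prod>a\<in>A. h (f a))" "h (z ^ k) = h z ^ k"
    "h (of_nat k) = of_nat k"
proof -
  have add: "h (x + y) = h x + h y" for x y using assms unfolding ring_hom_fun_def by simp
  have mult: "h (x * y) = h x * h y" for x y using assms unfolding ring_hom_fun_def by simp
  have one: "h 1 = 1" using assms unfolding ring_hom_fun_def by simp
  have zero: "h 0 = 0" using add[of 0 0] by (metis add_0 add_cancel_left_right)
  show "h 0 = 0" "h 1 = 1" "h (x + y) = h x + h y" "h (x * y) = h x * h y"
    by (rule zero one add mult)+
  show "h (sum f A) = (\<Sum>a\<in>A. h (f a))"
    by (induction A rule: infinite_finite_induct) (simp_all add: zero add)
  show "h (prod f A) = (\<Prod>a\<in>A. h (f a))"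
    by (induction A rule: infinite_finite_induct) (simp_all add: one mult)
  show "h (z ^ k) = h z ^ k" by (induction k) (simp_all add: one mult)
  show "h (of_nat k) = of_nat k" by (induction k) (simp_all add: zero one add)
qed

lemma monomial_at_hom:
  assumes "ring_hom_fun h" "Poly_Mapping.keys m \<subseteq> {..<length x}"
  shows "h (monomial_at m x) = monomial_at m (map h x)"
  unfolding monomial_at_def ring_hom_fun_simps[OF assms(1)]
  using assms(2) by (intro prod.cong) auto

lemma eval_mpoly_hom:
  assumes h: "ring_hom_fun h" and Q: "in_vars (length x) Q"
  shows "h (eval_mpoly Q x) = eval_mpoly (Poly_Mapping.map h Q) (map h x)"
proof -
  have "eval_mpoly (Poly_Mapping.map h Q) (map h x) =
      (\<Sum>m\<in>Poly_Mapping.keys Q. h (Poly_Mapping.lookup Q m) * monomial_at m (map h x))"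
    by (subst eval_mpoly_superset[of "Poly_Mapping.keys Q"])
      (simp_all add: keys_map_subset lookup_map_zero ring_hom_fun_simps(1)[OF h])
  also have "\<dots> = h (eval_mpoly Q x)"
    unfolding eval_mpoly_superset[OF finite_keys order_refl] ring_hom_fun_simps[OF h]
    using Q unfolding in_vars_def by (intro sum.cong) (simp_all add: monomial_at_hom[OF h])
  finally show ?thesis by simp
qed

lemma keys_diff_nat: "Poly_Mapping.keys (m - m') \<subseteq> Poly_Mapping.keys (m :: nat \<Rightarrow>\<^sub>0 nat)"
  by (auto simp: in_keys_iff lookup_minus)

lemma partial_at_hom:
  assumes h: "ring_hom_fun h" and Q: "in_vars (length x) Q"
  shows "h (partial_at i Q x) = partial_at i (Poly_Mapping.map h Q) (map h x)"
proof -
  have "partial_at i (Poly_Mapping.map h Q) (map h x) =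
      (\<Sum>m\<in>Poly_Mapping.keys Q. of_nat (Poly_Mapping.lookup m i) * h (Poly_Mapping.lookup Q m) *
        monomial_at (m - Poly_Mapping.single i 1) (map h x))"
    by (subst partial_at_superset[of "Poly_Mapping.keys Q"])
      (simp_all add: keys_map_subset lookup_map_zero ring_hom_fun_simps(1)[OF h])
  also have "\<dots> = h (partial_at i Q x)"
    unfolding partial_at_superset[OF finite_keys order_refl] ring_hom_fun_simps[OF h]
  proof (intro sum.cong refl)
    fix m assume "m \<in> Poly_Mapping.keys Q"
    then have "Poly_Mapping.keys (m - Poly_Mapping.single i 1) \<subseteq> {..<length x}"
      using Q keys_diff_nat unfolding in_vars_def by blast
    then show "of_nat (Poly_Mapping.lookup m i) * h (Poly_Mapping.lookup Q m) *
        monomial_at (m - Poly_Mapping.single i 1) (map h x) =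
      of_nat (Poly_Mapping.lookup m i) * h (Poly_Mapping.lookup Q m) *
        h (monomial_at (m - Poly_Mapping.single i 1) x)"
      by (simp only: monomial_at_hom[OF h])
  qed
  finally show ?thesis by simp
qed

lemma derivation_0: "derivation D \<Longrightarrow> D 0 = 0"
  unfolding derivation_def by (metis add_0 add_cancel_left_right)

lemma derivation_sum: "derivation D \<Longrightarrow> D (sum f A) = (\<Sum>a\<in>A. D (f a))"
  by (induction A rule: infinite_finite_induct)
    (auto simp: derivation_0, simp_all add: derivation_def)

lemma derivation_1: "derivation D \<Longrightarrow> D 1 = 0"
  unfolding derivation_def by (metis add_cancel_left_right mult_1 mult.right_neutral)

lemma derivation_power:
  assumes "derivation D"
  shows "D (x ^ k) = of_nat k * x ^ (k - 1) * D x"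
proof (induction k)
  case 0
  then show ?case using derivation_1[OF assms] by simp
next
  case (Suc k)
  have "D (x ^ Suc k) = x * D (x ^ k) + D x * x ^ k" using assms unfolding derivation_def by simp
  also have "\<dots> = of_nat (Suc k) * x ^ k * D x"
    unfolding Suc by (cases k) (simp_all add: algebra_simps)
  finally show ?case by simp
qed

lemma derivation_prod:
  assumes "derivation D" "finite A"
  shows "D (prod f A) = (\<Sum>a\<in>A. prod f (A - {a}) * D (f a))"
  using assms(2)
proof (induction A)
  case empty
  then show ?case using derivation_1[OF assms(1)] by simp
next
  case (insert b A)
  have "D (prod f (insert b A)) = f b * D (prod f A) + D (f b) * prod f A"
    using insert assms(1) unfolding derivation_def by simp
  also have "f b * D (prod f A) = (\<Sum>a\<in>A. prod f (insert b A - {a}) * D (f a))"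
    unfolding insert.IH sum_distrib_left
  proof (intro sum.cong refl)
    fix a assume "a \<in> A"
    then have "insert b A - {a} = insert b (A - {a})" using insert by auto
    then show "f b * (prod f (A - {a}) * D (f a)) = prod f (insert b A - {a}) * D (f a)"
      using insert by (simp add: mult.assoc)
  qed
  finally show ?case using insert by (simp add: algebra_simps)
qed

lemma derivation_monomial_at:
  assumes D: "derivation D" and m: "Poly_Mapping.keys m \<subseteq> {..<n}"
  shows "D (monomial_at m x) = (\<Sum>i<n. of_nat (Poly_Mapping.lookup m i) *
    monomial_at (m - Poly_Mapping.single i 1) x * D (x ! i))"
proof -
  have "D (monomial_at m x) = D (\<Prod>i<n. (x ! i) ^ Poly_Mapping.lookup m i)"
    using monomial_at_superset[OF finite_lessThan m, of x] by simp
  also have "\<dots> = (\<Sum>i<n. (\<Prod>j\<in>{..<n} - {i}. (x ! j) ^ Poly_Mapping.lookup m j) *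
      (of_nat (Poly_Mapping.lookup m i) * (x ! i) ^ (Poly_Mapping.lookup m i - 1) * D (x ! i)))"
    unfolding derivation_prod[OF D finite_lessThan] derivation_power[OF D] ..
  also have "\<dots> = (\<Sum>i<n. of_nat (Poly_Mapping.lookup m i) *
      monomial_at (m - Poly_Mapping.single i 1) x * D (x ! i))"
  proof (intro sum.cong refl)
    fix i assume i: "i \<in> {..<n}"
    have "Poly_Mapping.keys (m - Poly_Mapping.single i 1) \<subseteq> {..<n}" using m keys_diff_nat by blast
    then have "monomial_at (m - Poly_Mapping.single i 1) x =
        (\<Prod>j<n. (x ! j) ^ Poly_Mapping.lookup (m - Poly_Mapping.single i 1) j)"
      using monomial_at_superset by blast
    also have "\<dots> = (x ! i) ^ (Poly_Mapping.lookup m i - 1) *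
        (\<Prod>j\<in>{..<n} - {i}. (x ! j) ^ Poly_Mapping.lookup m j)"
      using i by (subst prod.remove[of _ i])
        (auto intro!: prod.cong arg_cong2[where f = "(*)"] simp: lookup_minus lookup_single)
    finally show "(\<Prod>j\<in>{..<n} - {i}. (x ! j) ^ Poly_Mapping.lookup m j) *
        (of_nat (Poly_Mapping.lookup m i) * (x ! i) ^ (Poly_Mapping.lookup m i - 1) * D (x ! i)) =
      of_nat (Poly_Mapping.lookup m i) * monomial_at (m - Poly_Mapping.single i 1) x * D (x ! i)"
      by (simp add: ac_simps)
  qed
  finally show ?thesis .
qed

text \<open>Used for a derivation of the field, to see that it preserves tangent bundles, and for
  \<open>pderiv\<close> on univariate polynomials, as the chain rule along a curve.\<close>

lemma derivation_eval_mpoly: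
  assumes D: "derivation D" and Q: "in_vars n Q"
  shows "D (eval_mpoly Q x) = eval_mpoly (Poly_Mapping.map D Q) x + (\<Sum>i<n. partial_at i Q x * D (x ! i))"
proof -
  have 1: "eval_mpoly (Poly_Mapping.map D Q) x =
      (\<Sum>m\<in>Poly_Mapping.keys Q. D (Poly_Mapping.lookup Q m) * monomial_at m x)"
    by (subst eval_mpoly_superset[of "Poly_Mapping.keys Q"])
      (simp_all add: keys_map_subset lookup_map_zero derivation_0[OF D])
  have "D (eval_mpoly Q x) = (\<Sum>m\<in>Poly_Mapping.keys Q.
      Poly_Mapping.lookup Q m * D (monomial_at m x) + D (Poly_Mapping.lookup Q m) * monomial_at m x)"
    unfolding eval_mpoly_superset[OF finite_keys order_refl] derivation_sum[OF D]
    using D by (simp add: derivation_def)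
  also have "\<dots> = (\<Sum>m\<in>Poly_Mapping.keys Q. Poly_Mapping.lookup Q m * D (monomial_at m x)) +
      eval_mpoly (Poly_Mapping.map D Q) x"
    unfolding 1 sum.distrib ..
  also have "(\<Sum>m\<in>Poly_Mapping.keys Q. Poly_Mapping.lookup Q m * D (monomial_at m x)) =
      (\<Sum>m\<in>Poly_Mapping.keys Q. \<Sum>i<n. of_nat (Poly_Mapping.lookup m i) * Poly_Mapping.lookup Q m *
        monomial_at (m - Poly_Mapping.single i 1) x * D (x ! i))"
  proof (intro sum.cong refl)
    fix m assume "m \<in> Poly_Mapping.keys Q"
    then have "Poly_Mapping.keys m \<subseteq> {..<n}" using Q unfolding in_vars_def by blast
    from derivation_monomial_at[OF D this]
    show "Poly_Mapping.lookup Q m * D (monomial_at m x) = (\<Sum>i<n. of_nat (Poly_Mapping.lookup m i) *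
        Poly_Mapping.lookup Q m * monomial_at (m - Poly_Mapping.single i 1) x * D (x ! i))"
      by (simp add: sum_distrib_left ac_simps)
  qed
  also have "\<dots> = (\<Sum>i<n. partial_at i Q x * D (x ! i))"
    unfolding partial_at_superset[OF finite_keys order_refl] sum_distrib_right
    by (rule sum.swap)
  finally show ?thesis by simp
qed

lemma derivation_pderiv: "derivation (pderiv :: 'k::field_char_0 poly \<Rightarrow> 'k poly)"
  unfolding derivation_def by (simp add: pderiv_add pderiv_mult)

lemma ring_hom_poly: "ring_hom_fun (\<lambda>p. poly p (t :: 'k::field))"
  unfolding ring_hom_fun_def by simp

lemma map_const_poly:
  "Poly_Mapping.map (\<lambda>p. poly p t) (Poly_Mapping.map (\<lambda>c. [:c :: 'k::field:]) Q) = Q"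
  by (rule poly_mapping_eqI) (simp add: lookup_map_zero)

text \<open>A list \<gamma> of univariate polynomials is a curve, treated as a point over the
  polynomial ring, so that the general facts on homomorphisms and derivations apply to it.\<close>

lemma eval_mpoly_curve:
  assumes "in_vars (length \<gamma>) (Q :: 'k::field mpoly)"
  shows "poly (eval_mpoly (Poly_Mapping.map (\<lambda>c. [:c:]) Q) \<gamma>) t = eval_mpoly Q (map (\<lambda>p. poly p t) \<gamma>)"
  using eval_mpoly_hom[OF ring_hom_poly[of t] in_vars_map[OF _ assms, of "\<lambda>c. [:c:]"]]
  by (simp add: map_const_poly)

text \<open>Computes tangent conditions from the restriction of Q to a line, without expanding
  \<open>partial_deriv\<close> monomial by monomial.\<close>

lemma directional_derivative:
  fixes Q :: "'k::field_char_0 mpoly"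
  assumes Q: "in_vars n Q" and len: "length p = n" "length \<xi> = n"
    and P: "\<And>t. poly P t = eval_mpoly Q (map2 (\<lambda>a e. a + t * e) p \<xi>)"
  shows "(\<Sum>i<n. partial_at i Q p * \<xi> ! i) = poly (pderiv P) 0"
proof -
  define \<gamma> where "\<gamma> = map2 (\<lambda>a e. [:a, e:]) p \<xi>"
  define Q' where "Q' = Poly_Mapping.map (\<lambda>c. [:c:]) Q"
  have len': "length \<gamma> = n" using len unfolding \<gamma>_def by simp
  have Q': "in_vars n Q'" unfolding Q'_def using Q by (intro in_vars_map) auto
  have "map (\<lambda>p. poly p t) \<gamma> = map2 (\<lambda>a e. a + t * e) p \<xi>" for t
    unfolding \<gamma>_def by (auto simp: map_eq_conv split: prod.split)
  then have "poly P t = poly (eval_mpoly Q' \<gamma>) t" for t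
    using eval_mpoly_curve[of \<gamma> Q t] Q len' P unfolding Q'_def by simp
  then have PQ: "P = eval_mpoly Q' \<gamma>" by (simp add: poly_eq_poly_eq_iff[symmetric] fun_eq_iff)
  have "Poly_Mapping.map pderiv Q' = 0"
    unfolding Q'_def by (rule poly_mapping_eqI) (simp add: lookup_map_zero pderiv_pCons)
  then have "pderiv P = (\<Sum>i<n. partial_at i Q' \<gamma> * pderiv (\<gamma> ! i))"
    unfolding PQ derivation_eval_mpoly[OF derivation_pderiv Q'] by (simp add: eval_mpoly_0)
  then have "poly (pderiv P) 0 = (\<Sum>i<n. poly (partial_at i Q' \<gamma>) 0 * poly (pderiv (\<gamma> ! i)) 0)"
    by (simp add: poly_sum)
  also have "\<dots> = (\<Sum>i<n. partial_at i Q p * \<xi> ! i)"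
  proof (intro sum.cong refl)
    fix i assume i: "i \<in> {..<n}"
    have "map (\<lambda>p. poly p 0) \<gamma> = p" unfolding \<gamma>_def using len by (intro nth_equalityI) auto
    then have "poly (partial_at i Q' \<gamma>) 0 = partial_at i Q p"
      using partial_at_hom[OF ring_hom_poly[of 0], of \<gamma> Q'] Q' len'
      unfolding Q'_def by (simp add: map_const_poly)
    moreover have "poly (pderiv (\<gamma> ! i)) 0 = \<xi> ! i"
      using i len unfolding \<gamma>_def by (simp add: pderiv_pCons)
    ultimately show "poly (partial_at i Q' \<gamma>) 0 * poly (pderiv (\<gamma> ! i)) 0 = partial_at i Q p * \<xi> ! i"
      by simp
  qed
  finally show ?thesis by simp
qed

lemma tangent_bundle_iff:
  "xu \<in> tangent_bundle n W \<longleftrightarrow> length xu = n \<and>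
     (\<forall>Q \<in> ideal_of n W. eval_mpoly Q (map fst xu) = 0 \<and>
        (\<Sum>i<n. partial_at i Q (map fst xu) * snd (xu ! i)) = 0)"
  by (simp add: tangent_bundle_def partial_at_def)

text \<open>
  The quadric \<open>x z + y w = 1\<close> is the group \<open>SL\<^sub>2\<close>; every element is a product of four
  elementary matrices.
\<close>

definition quadric :: "'k::comm_ring_1 list set" where
  "quadric = {[x, y, z, w] | x y z w. x * z + y * w = 1}"

text \<open>The list [x, y, z, w] stands for the matrix with rows (x, y) and (-w, z), of determinant
  x z + y w. The entries are those of a product of an upper, a lower, an upper and a lower
  unitriangular matrix with parameters t1 to t4.\<close>

definition elementary_product :: "'k::comm_ring_1 \<Rightarrow> 'k \<Rightarrow> 'k \<Rightarrow> 'k \<Rightarrow> 'k list" where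
  "elementary_product t1 t2 t3 t4 =
     [1 + t1 * t2 + ((1 + t1 * t2) * t3 + t1) * t4, (1 + t1 * t2) * t3 + t1,
      1 + t2 * t3, - t2 - (1 + t2 * t3) * t4]"

lemma elementary_product_mem: "elementary_product t1 t2 t3 t4 \<in> quadric"
  unfolding quadric_def elementary_product_def
  by (intro CollectI exI conjI) (rule refl, simp add: algebra_simps)

lemma map_poly_elementary_product:
  "map (\<lambda>p. poly p t) (elementary_product a b c d) =
     elementary_product (poly a t) (poly b t) (poly c t) (poly d t)"
  by (simp add: elementary_product_def)

lemma elementary_product_surj:
  fixes p :: "'k::field list"
  assumes "p \<in> quadric"
  obtains t1 t2 t3 t4 where "p = elementary_product t1 t2 t3 t4"
proof -
  obtain x y z w where p: "p = [x, y, z, w]" and eq: "x * z + y * w = 1"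
    using assms unfolding quadric_def by blast
  \<comment> \<open>Makes t2 = - w - z t4 nonzero: if w = 0, the equation of the quadric forces z to
    be nonzero. The entries z and x then determine t3 and t1 by division by t2.\<close>
  define t4 :: 'k where "t4 = (if w = 0 then 1 else 0)"
  define t2 where "t2 = - w - z * t4"
  have t2: "t2 \<noteq> 0" using eq unfolding t2_def t4_def by auto
  define t3 where "t3 = (z - 1) / t2"
  define t1 where "t1 = (x - y * t4 - 1) / t2"
  have z: "1 + t2 * t3 = z" using t2 unfolding t3_def by simp
  have x: "1 + t1 * t2 = x - y * t4" using t2 unfolding t1_def by simp
  have "t2 * y = t2 * ((1 + t1 * t2) * t3 + t1)"
  proof -
    have "t2 * ((1 + t1 * t2) * t3 + t1) = (1 + t1 * t2) * (t2 * t3) + t1 * t2"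
      by (simp add: algebra_simps)
    also have "\<dots> = (x - y * t4) * (z - 1) + (x - y * t4 - 1)"
      unfolding x[symmetric] z[symmetric] by (simp add: algebra_simps)
    also have "\<dots> = t2 * y" using eq unfolding t2_def by (simp add: algebra_simps)
    finally show ?thesis by (rule sym)
  qed
  then have y: "(x - y * t4) * t3 + t1 = y" unfolding x using t2 by (metis mult_left_cancel)
  have "p = elementary_product t1 t2 t3 t4"
    unfolding p elementary_product_def z x y by (simp add: t2_def)
  then show thesis by (rule that)
qed

definition quadric_poly :: "'k::comm_ring_1 mpoly" where
  "quadric_poly = Poly_Mapping.single (Poly_Mapping.single 0 1 + Poly_Mapping.single 2 1) 1 +
     Poly_Mapping.single (Poly_Mapping.single 1 1 + Poly_Mapping.single 3 1) 1 -
     Poly_Mapping.single 0 1"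

lemma eval_quadric_poly: "eval_mpoly quadric_poly [x, y, z, w] = x * z + y * w - 1"
  unfolding quadric_poly_def eval_mpoly_diff eval_mpoly_add eval_mpoly_single
    monomial_at_add monomial_at_single monomial_at_0
  by (simp add: numeral_2_eq_2 numeral_3_eq_3)

lemma in_vars_quadric_poly: "in_vars 4 quadric_poly"
proof -
  have "in_vars 4 (Poly_Mapping.single (Poly_Mapping.single i 1 + Poly_Mapping.single j 1) c)"
    if "i < 4" "j < 4" for i j and c :: 'a
    using that keys_add[of "Poly_Mapping.single i 1 :: nat \<Rightarrow>\<^sub>0 nat" "Poly_Mapping.single j 1"]
    unfolding in_vars_def by (auto split: if_splits)
  moreover have "in_vars 4 (Poly_Mapping.single 0 (1 :: 'a))" by (simp add: in_vars_def)
  moreover have "in_vars 4 (P + Q)" if "in_vars 4 P" "in_vars 4 Q" for P Q :: "'a mpoly"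
    using that keys_add[of P Q] unfolding in_vars_def by blast
  ultimately show ?thesis unfolding quadric_poly_def by (intro in_vars_diff) auto
qed

lemma quadric_zero_set: "quadric = zero_set 4 {quadric_poly}"
proof (rule Set.set_eqI, rule iffI)
  fix p :: "'a list" assume "p \<in> zero_set 4 {quadric_poly}"
  then have "length p = 4" "eval_mpoly quadric_poly p = 0" unfolding zero_set_def by auto
  moreover from this obtain x y z w where "p = [x, y, z, w]"
    by (auto simp: numeral_eq_Suc length_Suc_conv)
  ultimately show "p \<in> quadric" by (auto simp: quadric_def eval_quadric_poly)
qed (auto simp: quadric_def zero_set_def eval_quadric_poly)

lemma algebraic_Ints: "x \<in> \<int> \<Longrightarrow> algebraic x"
  by (rule algebraicI[of "[:- x, 1:]"]) (auto simp: coeff_pCons split: nat.split)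

lemma quadric_defined: "defined_over_Qalg 4 quadric"
  unfolding defined_over_Qalg_def
proof (intro exI conjI ballI allI)
  show "quadric = zero_set 4 {quadric_poly}" by (rule quadric_zero_set)
  fix Q :: "'a mpoly" assume "Q \<in> {quadric_poly}"
  then have Q: "Q = quadric_poly" by simp
  show "in_vars 4 Q" unfolding Q by (rule in_vars_quadric_poly)
  show "algebraic (Poly_Mapping.lookup Q m)" for m
    unfolding Q quadric_poly_def
    by (intro algebraic_Ints) (auto simp: lookup_minus lookup_add lookup_single lookup_one when_def)
qed

text \<open>The quadric is a polynomial image of affine 4-space. A point outside V1 and one outside
  V2 are joined by the image \<gamma> of the line between their parameters. Polynomials separating
  the points from V1 and V2 restrict to nonzero polynomials in t, and a t that is a root of neither
  gives a point outside both sets.\<close>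

lemma quadric_irreducible: "irreducible_variety 4 (quadric :: 'k::field_char_0 list set)"
  unfolding irreducible_variety_def
proof (intro conjI allI impI)
  show "zariski_closed 4 (quadric :: 'k list set)"
    unfolding zariski_closed_def using quadric_zero_set in_vars_quadric_poly by blast
  show "(quadric :: 'k list set) \<noteq> {}" using elementary_product_mem by blast
next
  fix V1 V2 :: "'k list set"
  assume V: "zariski_closed 4 V1 \<and> zariski_closed 4 V2 \<and> quadric = V1 \<union> V2"
  show "quadric = V1 \<or> quadric = V2"
  proof (rule ccontr)
    assume "\<not> (quadric = V1 \<or> quadric = V2)"
    then have "\<not> quadric \<subseteq> V1" "\<not> quadric \<subseteq> V2" using V by auto
    then obtain p1 p2 where p: "p1 \<in> quadric" "p1 \<notin> V1" "p2 \<in> quadric" "p2 \<notin> V2"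
      by (auto simp: subset_iff)
    have len: "length p = 4" if "p \<in> quadric" for p :: "'k list" using that unfolding quadric_def by auto
    have sep: "\<exists>Q. in_vars 4 Q \<and> eval_mpoly Q p \<noteq> 0 \<and> (\<forall>x\<in>V. eval_mpoly Q x = 0)"
      if "zariski_closed 4 V" and pV: "p \<notin> V" "p \<in> quadric" for V :: "'k list set" and p
    proof -
      obtain F where F: "\<forall>Q\<in>F. in_vars 4 Q" "V = zero_set 4 F"
        using \<open>zariski_closed 4 V\<close> unfolding zariski_closed_def by blast
      then obtain Q where "Q \<in> F" "eval_mpoly Q p \<noteq> 0"
        using pV(1) len[OF pV(2)] unfolding zero_set_def by blast
      moreover from this have "\<forall>x\<in>V. eval_mpoly Q x = 0" using F unfolding zero_set_def by blast
      ultimately show ?thesis using F by blast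
    qed
    obtain Q1 where Q1: "in_vars 4 Q1" "eval_mpoly Q1 p1 \<noteq> 0" "\<forall>x\<in>V1. eval_mpoly Q1 x = 0"
      using sep[of V1 p1] p V by auto
    obtain Q2 where Q2: "in_vars 4 Q2" "eval_mpoly Q2 p2 \<noteq> 0" "\<forall>x\<in>V2. eval_mpoly Q2 x = 0"
      using sep[of V2 p2] p V by auto
    obtain s1 s2 s3 s4 where s: "p1 = elementary_product s1 s2 s3 s4"
      using elementary_product_surj[OF p(1)] .
    obtain t1 t2 t3 t4 where t: "p2 = elementary_product t1 t2 t3 t4"
      using elementary_product_surj[OF p(3)] .
    define \<gamma> where "\<gamma> = elementary_product [:s1, t1 - s1:] [:s2, t2 - s2:] [:s3, t3 - s3:] [:s4, t4 - s4:]"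
    have g: "map (\<lambda>p. poly p t) \<gamma> = elementary_product
      (s1 + t * (t1 - s1)) (s2 + t * (t2 - s2)) (s3 + t * (t3 - s3)) (s4 + t * (t4 - s4))" for t
      unfolding \<gamma>_def map_poly_elementary_product by (simp add: mult.commute)
    have "length \<gamma> = 4" unfolding \<gamma>_def elementary_product_def by simp
    then obtain P1 P2 where P1: "\<And>t. poly P1 t = eval_mpoly Q1 (map (\<lambda>p. poly p t) \<gamma>)"
        and P2: "\<And>t. poly P2 t = eval_mpoly Q2 (map (\<lambda>p. poly p t) \<gamma>)"
      using eval_mpoly_curve[of \<gamma>] Q1(1) Q2(1) by metis
    have "poly P1 0 \<noteq> 0" using Q1(2) unfolding P1 g s by simp
    moreover have "poly P2 1 \<noteq> 0" using Q2(2) unfolding P2 g t by simp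
    ultimately have "P1 * P2 \<noteq> 0" by auto
    then obtain t where "poly (P1 * P2) t \<noteq> 0" by (metis poly_all_0_iff_0)
    then have "poly P1 t \<noteq> 0" "poly P2 t \<noteq> 0" by auto
    then have "map (\<lambda>p. poly p t) \<gamma> \<notin> V1 \<union> V2" using Q1(3) Q2(3) unfolding P1 P2 by blast
    moreover have "map (\<lambda>p. poly p t) \<gamma> \<in> quadric" unfolding g by (rule elementary_product_mem)
    ultimately show False using V by blast
  qed
qed

lemma quadric_directional_derivative:
  fixes x :: "'k::field_char_0"
  shows "(\<Sum>i<4. partial_at i quadric_poly [x, y, z, w] * [u, v, r, s] ! i) =
    z * u + w * v + x * r + y * s"
proof -
  have "(\<Sum>i<4. partial_at i quadric_poly [x, y, z, w] * [u, v, r, s] ! i) =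
      poly (pderiv ([:x, u:] * [:z, r:] + [:y, v:] * [:w, s:] - 1)) 0"
    by (rule directional_derivative[OF in_vars_quadric_poly])
      (simp_all add: eval_quadric_poly algebra_simps)
  then show ?thesis by (simp add: pderiv_pCons pderiv_add pderiv_diff pderiv_mult algebra_simps)
qed

lemma tangent_quadric_imp:
  fixes x :: "'k::field_char_0"
  assumes "[(x, u), (y, v), (z, r), (w, s)] \<in> tangent_bundle 4 quadric"
  shows "x * z + y * w = 1" "z * u + w * v + x * r + y * s = 0"
proof -
  have "quadric_poly \<in> ideal_of 4 (quadric :: 'k list set)"
    unfolding ideal_of_def using in_vars_quadric_poly quadric_zero_set by (auto simp: zero_set_def)
  then have 1: "eval_mpoly quadric_poly [x, y, z, w] = 0"
    and 2: "(\<Sum>i<4. partial_at i quadric_poly [x, y, z, w] *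
      snd ([(x, u), (y, v), (z, r), (w, s)] ! i)) = 0"
    using assms unfolding tangent_bundle_iff by auto
  show "x * z + y * w = 1" using 1 by (simp add: eval_quadric_poly)
  have "(\<Sum>i<4. partial_at i quadric_poly [x, y, z, w] * snd ([(x, u), (y, v), (z, r), (w, s)] ! i)) =
      (\<Sum>i<4. partial_at i quadric_poly [x, y, z, w] * [u, v, r, s] ! i)"
    by (simp add: numeral_eq_Suc)
  also have "\<dots> = z * u + w * v + x * r + y * s" by (rule quadric_directional_derivative)
  finally show "z * u + w * v + x * r + y * s = 0" unfolding 2 by (rule sym)
qed

text \<open>The tangent space is spanned by the directions of lines contained in the quadric.\<close>

lemma tangent_quadricI:
  fixes x :: "'k::field_char_0"
  assumes eq: "x * z + y * w = 1" "z * u + w * v + x * r + y * s = 0" and nz: "y \<noteq> 0" "z \<noteq> 0"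
  shows "[(x, u), (y, v), (z, r), (w, s)] \<in> tangent_bundle 4 quadric"
  unfolding tangent_bundle_iff
proof (intro conjI ballI)
  fix Q :: "'k mpoly" assume "Q \<in> ideal_of 4 quadric"
  then have Q: "in_vars 4 Q" "\<And>p. p \<in> quadric \<Longrightarrow> eval_mpoly Q p = 0" unfolding ideal_of_def by auto
  have "[x, y, z, w] \<in> quadric" unfolding quadric_def using eq(1) by blast
  then show "eval_mpoly Q (map fst [(x, u), (y, v), (z, r), (w, s)]) = 0" using Q(2) by simp
  define \<delta> where "\<delta> i = partial_at i Q [x, y, z, w]" for i
  \<comment> \<open>A direction that is tangent and isotropic spans a line inside the quadric, and
    every Q in the ideal vanishes along it. This handles the whole ideal without a choice of
    generators.\<close>
  have line: "\<delta> 0 * ea + \<delta> 1 * eb + \<delta> 2 * ec + \<delta> 3 * ed = 0"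
    if "ea * ec + eb * ed = 0" "z * ea + w * eb + x * ec + y * ed = 0" for ea eb ec ed
  proof -
    have "(x + t * ea) * (z + t * ec) + (y + t * eb) * (w + t * ed) =
        (x * z + y * w) + t * (z * ea + w * eb + x * ec + y * ed) + t * t * (ea * ec + eb * ed)" for t
      by (simp add: algebra_simps)
    then have "[x + t * ea, y + t * eb, z + t * ec, w + t * ed] \<in> quadric" for t
      unfolding quadric_def using that eq(1) by simp
    then have "(\<Sum>i<4. partial_at i Q [x, y, z, w] * [ea, eb, ec, ed] ! i) = poly (pderiv 0) 0"
      by (intro directional_derivative[OF Q(1)]) (simp_all add: Q(2))
    then show ?thesis unfolding \<delta>_def by (simp add: numeral_eq_Suc)
  qed
  \<comment> \<open>Splits (u, v, r, s) into isotropic directions of the forms (u + k, 0, 0, e), (0,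
    0, r, e') and (-k, v, 0, 0); the value of k makes the last one tangent.\<close>
  define k where "k = w * v / z"
  have zk: "z * k = w * v" using nz unfolding k_def by simp
  have 1: "\<delta> 0 * (u + k) + \<delta> 3 * (- z * (u + k) / y) = 0"
    using line[where ea = "u + k" and eb = 0 and ec = 0 and ed = "- z * (u + k) / y"] nz by simp
  have 2: "\<delta> 2 * r + \<delta> 3 * (- x * r / y) = 0"
    using line[where ea = 0 and eb = 0 and ec = r and ed = "- x * r / y"] nz by simp
  have 3: "\<delta> 0 * (- k) + \<delta> 1 * v = 0"
    using line[where ea = "- k" and eb = v and ec = 0 and ed = 0] zk by simp
  have "y * s = - z * (u + k) + - x * r"
    using eq(2) zk by (simp add: algebra_simps eq_neg_iff_add_eq_0)
  then have "s = (- z * (u + k) + - x * r) / y" using nz by (metis nonzero_mult_div_cancel_left)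
  then have s: "s = - z * (u + k) / y + - x * r / y" by (simp only: add_divide_distrib)
  have "\<delta> 0 * u + \<delta> 1 * v + \<delta> 2 * r + \<delta> 3 * s =
      (\<delta> 0 * (u + k) + \<delta> 3 * (- z * (u + k) / y)) + (\<delta> 2 * r + \<delta> 3 * (- x * r / y)) + (\<delta> 0 * (- k) + \<delta> 1 * v)"
    unfolding s by (simp add: algebra_simps)
  also have "\<dots> = 0" unfolding 1 2 3 by simp
  finally have "\<delta> 0 * u + \<delta> 1 * v + \<delta> 2 * r + \<delta> 3 * s = 0" .
  then show "(\<Sum>i<4. partial_at i Q (map fst [(x, u), (y, v), (z, r), (w, s)]) *
      snd ([(x, u), (y, v), (z, r), (w, s)] ! i)) = 0"
    unfolding \<delta>_def by (simp add: numeral_eq_Suc)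
qed simp

lemma M_struct_Tan_quadric:
  "M_struct (Tan quadric) [inS p1, inS p2, inS p3, inS p4] \<longleftrightarrow>
     [p1, p2, p3, p4] \<in> tangent_bundle 4 (quadric :: 'k::field_char_0 list set)"
proof -
  have len: "length [p1, p2, p3, p4] = 4" by simp
  have "[inS p1, inS p2, inS p3, inS p4] = map inS ts \<longleftrightarrow> ts = [p1, p2, p3, p4]" for ts
    using inj_map_eq_map[of inS "[p1, p2, p3, p4]" ts] by (auto simp: inj_def)
  then have "M_struct (Tan quadric) [inS p1, inS p2, inS p3, inS p4] \<longleftrightarrow>
      irreducible_variety (length [p1, p2, p3, p4]) (quadric :: 'k list set) \<and>
      defined_over_Qalg (length [p1, p2, p3, p4]) (quadric :: 'k list set) \<and>
      [p1, p2, p3, p4] \<in> tangent_bundle (length [p1, p2, p3, p4]) quadric"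
    unfolding M_struct.simps by blast
  then show ?thesis unfolding len using quadric_irreducible quadric_defined by blast
qed

lemma origin_zero_set: "{[0]} = zero_set 1 {Poly_Mapping.single (Poly_Mapping.single 0 1) (1 :: 'k::comm_ring_1)}"
  by (auto simp: zero_set_def eval_mpoly_single monomial_at_single length_Suc_conv)

lemma in_vars_single: "i < n \<Longrightarrow> in_vars n (Poly_Mapping.single (Poly_Mapping.single i 1) c)"
  by (auto simp: in_vars_def split: if_splits)

text \<open>The origin (0, 0) of S is definable without parameters, as the tangent bundle of the
  variety {0}.\<close>

lemma M_struct_Tan_origin:
  "M_struct (Tan {[0]}) [inS (x, u)] \<longleftrightarrow> x = 0 \<and> u = (0 :: 'k::field_char_0)"
proof -
  let ?X = "Poly_Mapping.single (Poly_Mapping.single 0 1) 1 :: 'k mpoly"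
  have "zariski_closed 1 {[0 :: 'k]}"
    unfolding zariski_closed_def
    by (rule exI[of _ "{?X}"]) (use in_vars_single[of 0 1] origin_zero_set in auto)
  then have irr: "irreducible_variety 1 {[0 :: 'k]}" unfolding irreducible_variety_def by blast
  have "algebraic (Poly_Mapping.lookup ?X m)" for m
    by (intro algebraic_Ints) (auto simp: lookup_single when_def)
  then have def: "defined_over_Qalg 1 {[0 :: 'k]}"
    unfolding defined_over_Qalg_def
  proof (intro exI[of _ "{?X}"] conjI ballI allI)
    show "{[0]} = zero_set 1 {?X}" by (rule origin_zero_set)
    fix Q m assume "Q \<in> {?X}"
    then have Q: "Q = ?X" by (rule singletonD)
    show "in_vars 1 Q" unfolding Q by (rule in_vars_single) simp
    show "algebraic (Poly_Mapping.lookup Q m)" unfolding Q by fact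
  qed
  have "[(x, u)] \<in> tangent_bundle 1 {[0]} \<longleftrightarrow> x = 0 \<and> u = 0"
  proof
    assume t: "[(x, u)] \<in> tangent_bundle 1 {[0]}"
    have "?X \<in> ideal_of 1 {[0]}"
      unfolding ideal_of_def using in_vars_single[of 0 1] by (simp add: eval_mpoly_single monomial_at_single)
    then have 1: "eval_mpoly ?X [x] = 0" and 2: "(\<Sum>i<1. partial_at i ?X [x] * snd ([(x, u)] ! i)) = 0"
      using t unfolding tangent_bundle_iff by auto
    have "(\<Sum>i<1. partial_at i ?X [x] * [u] ! i) = poly (pderiv [:x, u:]) 0"
      by (rule directional_derivative) (use in_vars_single[of 0 1] in \<open>auto simp: eval_mpoly_single monomial_at_single\<close>)
    then show "x = 0 \<and> u = 0"
      using 1 2 by (auto simp: eval_mpoly_single monomial_at_single pderiv_pCons)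
  next
    assume "x = 0 \<and> u = 0"
    then show "[(x, u)] \<in> tangent_bundle 1 {[0]}" unfolding tangent_bundle_iff ideal_of_def by simp
  qed
  moreover have "(\<exists>ts. [inS (x, u)] = map inS ts \<and> \<phi> ts) \<longleftrightarrow> \<phi> [(x, u)]"
    for \<phi> :: "('k \<times> 'k) list \<Rightarrow> bool"
    by (auto simp: Cons_eq_map_conv)
  ultimately show ?thesis using irr def by simp
qed

section \<open>Automorphisms of \<open>M\<close> and independence\<close>

lemma automorphism_inverse:
  assumes "automorphism I h"
  shows "automorphism I (inv_into UNIV h)"
  unfolding automorphism_def
proof (intro conjI allI)
  have b: "bij h" using assms unfolding automorphism_def by blast
  then show "bij (inv_into UNIV h)" by (rule bij_imp_bij_inv)
  fix R xs
  have "h (inv_into UNIV h x) = x" for x using b by (simp add: bij_is_surj surj_f_inv_f)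
  then have "map h (map (inv_into UNIV h) xs) = xs" by (simp add: map_idI)
  then show "I R (map (inv_into UNIV h) xs) \<longleftrightarrow> I R xs"
    using assms unfolding automorphism_def by metis
qed

lemma acl_automorphism_iff:
  assumes h: "automorphism I h"
  shows "h x \<in> acl I (h ` A) \<longleftrightarrow> x \<in> acl I A"
proof
  have b: "bij h" using assms unfolding automorphism_def by blast
  assume "h x \<in> acl I (h ` A)"
  from acl_automorphism[OF automorphism_inverse[OF h] this]
  have "inv_into UNIV h (h x) \<in> acl I (inv_into UNIV h ` h ` A)" .
  moreover have inv: "inv_into UNIV h (h y) = y" for y using b by (simp add: bij_is_inj)
  have "inv_into UNIV h ` h ` A = A" by (simp add: image_image inv)
  ultimately show "x \<in> acl I A" unfolding inv by (simp only:)
qed (rule acl_automorphism[OF h])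

lemma field_aut_inverse_apply:
  assumes "field_aut \<sigma>"
  shows "\<sigma> (inv_into UNIV \<sigma> x) = x" "inv_into UNIV \<sigma> (\<sigma> x) = x"
  using assms unfolding field_aut_def by (simp_all add: bij_is_inj bij_is_surj surj_f_inv_f)

lemma ring_hom_field_aut: "field_aut \<sigma> \<Longrightarrow> ring_hom_fun \<sigma>"
  unfolding ring_hom_fun_def by (simp add: field_aut_simps)

section \<open>The action of automorphisms and derivations on ideals and tangent bundles\<close>

lemma map_map_poly_mapping:
  "f 0 = 0 \<Longrightarrow> g 0 = 0 \<Longrightarrow>
     Poly_Mapping.map f (Poly_Mapping.map g Q) = Poly_Mapping.map (f \<circ> g) Q"
  by (rule poly_mapping_eqI) (simp add: lookup_map_zero)

lemma defined_over_Qalg_invariant: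
  assumes W: "defined_over_Qalg n W" and \<sigma>: "field_aut \<sigma>" "\<And>x. algebraic x \<Longrightarrow> \<sigma> x = x"
    and x: "x \<in> W"
  shows "map \<sigma> x \<in> W"
proof -
  obtain F where F: "\<And>Q. Q \<in> F \<Longrightarrow> in_vars n Q"
      "\<And>Q m. Q \<in> F \<Longrightarrow> algebraic (Poly_Mapping.lookup Q m)" "W = zero_set n F"
    using W unfolding defined_over_Qalg_def by blast
  have len: "length x = n" using x F(3) unfolding zero_set_def by blast
  have "eval_mpoly Q (map \<sigma> x) = 0" if "Q \<in> F" for Q
  proof -
    have "Poly_Mapping.map \<sigma> Q = Q"
      using \<sigma>(2) F(2)[OF that] by (intro poly_mapping_eqI) (simp add: lookup_map_zero field_aut_simps[OF \<sigma>(1)])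
    then have "eval_mpoly Q (map \<sigma> x) = \<sigma> (eval_mpoly Q x)"
      using eval_mpoly_hom[OF ring_hom_field_aut[OF \<sigma>(1)], of x Q] F(1)[OF that] len by simp
    also have "\<dots> = 0" using x F(3) that field_aut_simps(3)[OF \<sigma>(1)] unfolding zero_set_def by simp
    finally show ?thesis .
  qed
  then show ?thesis using F(3) len unfolding zero_set_def by simp
qed

lemma ideal_of_field_aut:
  assumes W: "defined_over_Qalg n W" and \<sigma>: "field_aut \<sigma>" "\<And>x. algebraic x \<Longrightarrow> \<sigma> x = x"
    and Q: "Q \<in> ideal_of n W"
  shows "Poly_Mapping.map \<sigma> Q \<in> ideal_of n W"
proof -
  let ?\<tau> = "inv_into UNIV \<sigma>"
  have b: "bij \<sigma>" using \<sigma>(1) unfolding field_aut_def by blast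
  have \<tau>: "field_aut ?\<tau>" by (rule field_aut_inverse[OF \<sigma>(1)])
  have \<tau>_alg: "?\<tau> x = x" if "algebraic x" for x
    using \<sigma>(2)[OF that] b by (metis bij_inv_eq_iff)
  have Q': "in_vars n Q" "\<And>x. x \<in> W \<Longrightarrow> eval_mpoly Q x = 0" using Q unfolding ideal_of_def by auto
  have "eval_mpoly (Poly_Mapping.map \<sigma> Q) x = 0" if x: "x \<in> W" for x
  proof -
    have y: "map ?\<tau> x \<in> W" by (rule defined_over_Qalg_invariant[OF W \<tau> \<tau>_alg x])
    have len: "length x = n" using x W unfolding defined_over_Qalg_def zero_set_def by auto
    have "map \<sigma> (map ?\<tau> x) = x" by (simp add: map_idI field_aut_inverse_apply[OF \<sigma>(1)])
    then have "eval_mpoly (Poly_Mapping.map \<sigma> Q) x = \<sigma> (eval_mpoly Q (map ?\<tau> x))"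
      using eval_mpoly_hom[OF ring_hom_field_aut[OF \<sigma>(1)], of "map ?\<tau> x" Q] Q'(1) len by simp
    then show ?thesis using Q'(2)[OF y] field_aut_simps(3)[OF \<sigma>(1)] by simp
  qed
  then show ?thesis using in_vars_map[OF _ Q'(1)] field_aut_simps(3)[OF \<sigma>(1)] unfolding ideal_of_def by simp
qed

lemma tangent_bundle_field_aut:
  assumes W: "defined_over_Qalg n W" and \<sigma>: "field_aut \<sigma>" "\<And>x. algebraic x \<Longrightarrow> \<sigma> x = x"
    and ts: "ts \<in> tangent_bundle n W"
  shows "map (\<lambda>p. (\<sigma> (fst p), \<sigma> (snd p))) ts \<in> tangent_bundle n W"
  unfolding tangent_bundle_iff
proof (intro conjI ballI)
  let ?\<tau> = "inv_into UNIV \<sigma>"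
  let ?x = "map fst ts"
  have b: "bij \<sigma>" using \<sigma>(1) unfolding field_aut_def by blast
  have \<tau>: "field_aut ?\<tau>" by (rule field_aut_inverse[OF \<sigma>(1)])
  have \<tau>_alg: "?\<tau> x = x" if "algebraic x" for x
    using \<sigma>(2)[OF that] b by (metis bij_inv_eq_iff)
  have len: "length ts = n" using ts unfolding tangent_bundle_iff by blast
  then show "length (map (\<lambda>p. (\<sigma> (fst p), \<sigma> (snd p))) ts) = n" by simp
  fix Q assume Q: "Q \<in> ideal_of n W"
  \<comment> \<open>The value of Q at the image point is \<sigma> applied to the value of the
    pullback Q' at the original point, and Q' again lies in the ideal.\<close>
  define Q' where "Q' = Poly_Mapping.map ?\<tau> Q"
  have Q': "Q' \<in> ideal_of n W" unfolding Q'_def by (rule ideal_of_field_aut[OF W \<tau> \<tau>_alg Q])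
  have vars: "in_vars (length ?x) Q'" using Q' len unfolding ideal_of_def by simp
  have "\<sigma> \<circ> ?\<tau> = id" by (auto simp: fun_eq_iff field_aut_inverse_apply[OF \<sigma>(1)])
  then have "Poly_Mapping.map \<sigma> Q' = Q"
    unfolding Q'_def map_map_poly_mapping[of \<sigma> ?\<tau>, OF field_aut_simps(3)[OF \<sigma>(1)] field_aut_simps(3)[OF \<tau>]]
    by (intro poly_mapping_eqI) (simp add: lookup_map_zero)
  note hom = eval_mpoly_hom[OF ring_hom_field_aut[OF \<sigma>(1)] vars, unfolded this]
    partial_at_hom[OF ring_hom_field_aut[OF \<sigma>(1)] vars, unfolded this]
  have x: "map fst (map (\<lambda>p. (\<sigma> (fst p), \<sigma> (snd p))) ts) = map \<sigma> ?x" by simp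
  have ev: "eval_mpoly Q' ?x = 0" "(\<Sum>i<n. partial_at i Q' ?x * snd (ts ! i)) = 0"
    using ts Q' unfolding tangent_bundle_iff by auto
  show "eval_mpoly Q (map fst (map (\<lambda>p. (\<sigma> (fst p), \<sigma> (snd p))) ts)) = 0"
    unfolding x hom(1)[symmetric] ev(1) by (rule field_aut_simps(3)[OF \<sigma>(1)])
  have "(\<Sum>i<n. partial_at i Q (map \<sigma> ?x) * snd (map (\<lambda>p. (\<sigma> (fst p), \<sigma> (snd p))) ts ! i)) =
      \<sigma> (\<Sum>i<n. partial_at i Q' ?x * snd (ts ! i))"
    unfolding ring_hom_fun_simps[OF ring_hom_field_aut[OF \<sigma>(1)]] hom(2)
    using len by (intro sum.cong) auto
  then show "(\<Sum>i<n. partial_at i Q (map fst (map (\<lambda>p. (\<sigma> (fst p), \<sigma> (snd p))) ts)) *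
      snd (map (\<lambda>p. (\<sigma> (fst p), \<sigma> (snd p))) ts ! i)) = 0"
    unfolding x ev(2) by (simp only: field_aut_simps(3)[OF \<sigma>(1)])
qed

lemma eval_mpoly_smult: "eval_mpoly (Poly_Mapping.map ((*) c) Q) x = c * eval_mpoly Q x"
proof -
  have "eval_mpoly (Poly_Mapping.map ((*) c) Q) x =
      (\<Sum>m\<in>Poly_Mapping.keys Q. c * Poly_Mapping.lookup Q m * monomial_at m x)"
    by (subst eval_mpoly_superset[of "Poly_Mapping.keys Q"])
      (simp_all add: keys_map_subset lookup_map_zero)
  then show ?thesis
    unfolding eval_mpoly_superset[OF finite_keys order_refl] by (simp add: sum_distrib_left mult.assoc)
qed

lemma ideal_of_smult: "Q \<in> ideal_of n W \<Longrightarrow> Poly_Mapping.map ((*) c) Q \<in> ideal_of n W"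
  unfolding ideal_of_def by (simp add: eval_mpoly_smult in_vars_map)

lemma ideal_of_diff: "P \<in> ideal_of n W \<Longrightarrow> Q \<in> ideal_of n W \<Longrightarrow> P - Q \<in> ideal_of n W"
  unfolding ideal_of_def by (simp add: eval_mpoly_diff in_vars_diff)

lemma ideal_of_add: "P \<in> ideal_of n W \<Longrightarrow> Q \<in> ideal_of n W \<Longrightarrow> P + Q \<in> ideal_of n W"
  using ideal_of_diff[of P n W "0 - Q"] ideal_of_diff[of 0 n W Q]
  by (simp add: ideal_of_def in_vars_def eval_mpoly_0)

text \<open>An element outside \<open>cl {}\<close> is conjugate to its translate by 1, hence not
  fixed.\<close>

lemma cl_empty_fixed:
  fixes c :: "'k::{alg_closed_field, field_char_0}"
  assumes "saturated (field_struct :: (field_sym, 'k) struct)"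
    and "\<And>\<sigma>. field_aut \<sigma> \<Longrightarrow> (\<And>e. e \<in> cl {} \<Longrightarrow> \<sigma> e = e) \<Longrightarrow> \<sigma> c = c"
  shows "c \<in> cl {}"
proof (rule ccontr)
  assume c: "c \<notin> cl {}"
  then have "c + 1 \<notin> cl {}" using cl_diff[of "c + 1" "{}" 1] cl_1 by auto
  then obtain \<sigma> where "field_aut \<sigma>" "\<And>e. e \<in> cl {} \<Longrightarrow> \<sigma> e = e" "\<sigma> c = c + 1"
    using cl_homogeneous[OF assms(1) finite.emptyI c] by blast
  then show False using assms(2) by force
qed

text \<open>
  An ideal stable under \<open>Aut(K/C)\<close>, where \<open>C\<close> is the fixed field, is spanned by polynomials
  over \<open>C\<close>: an element of minimal support with one coefficient \<open>1\<close> is fixed.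
\<close>

lemma ideal_of_derivation:
  fixes Q :: "'k::{alg_closed_field, field_char_0} mpoly"
  assumes sat: "saturated (field_struct :: (field_sym, 'k) struct)"
    and W: "defined_over_Qalg n W" and D: "derivation D" "\<And>e. e \<in> cl {} \<Longrightarrow> D e = 0"
    and "Q \<in> ideal_of n W"
  shows "Poly_Mapping.map D Q \<in> ideal_of n W"
  using assms(5)
proof (induction "card (Poly_Mapping.keys Q)" arbitrary: Q rule: less_induct)
  case less
  have D0: "D 0 = 0" by (rule derivation_0[OF D(1)])
  show ?case
  proof (cases "Q = 0")
    case True
    then have "Poly_Mapping.map D Q = Q" by (intro poly_mapping_eqI) (simp add: lookup_map_zero D0)
    then show ?thesis using less.prems by simp
  next
    case False
    define A where "A = {P \<in> ideal_of n W. P \<noteq> 0 \<and> Poly_Mapping.keys P \<subseteq> Poly_Mapping.keys Q}"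
    have QA: "Q \<in> A" using less.prems False unfolding A_def by simp
    define P where "P = arg_min (\<lambda>P. card (Poly_Mapping.keys P)) (\<lambda>P. P \<in> A)"
    have "P \<in> A" and min: "\<And>P'. P' \<in> A \<Longrightarrow> card (Poly_Mapping.keys P) \<le> card (Poly_Mapping.keys P')"
      unfolding P_def using arg_min_nat_lemma[of "\<lambda>P. P \<in> A" Q "\<lambda>P. card (Poly_Mapping.keys P)"] QA by auto
    then have P: "P \<in> ideal_of n W" "P \<noteq> 0" "Poly_Mapping.keys P \<subseteq> Poly_Mapping.keys Q"
      unfolding A_def by auto
    obtain \<mu> where \<mu>: "\<mu> \<in> Poly_Mapping.keys P" using P(2) by (metis all_not_in_conv keys_eq_empty)
    define p where "p = Poly_Mapping.lookup P \<mu>"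
    have p: "p \<noteq> 0" using \<mu> unfolding p_def by (simp add: in_keys_iff)
    define P1 where "P1 = Poly_Mapping.map ((*) (1 / p)) P"
    have lookup_P1: "Poly_Mapping.lookup P1 m = Poly_Mapping.lookup P m / p" for m
      unfolding P1_def by (simp add: lookup_map_zero)
    have P1: "P1 \<in> ideal_of n W" unfolding P1_def by (rule ideal_of_smult[OF P(1)])
    have keys_P1: "Poly_Mapping.keys P1 = Poly_Mapping.keys P"
      using p by (auto simp: in_keys_iff lookup_P1)
    have P1_const: "Poly_Mapping.lookup P1 m \<in> cl {}" for m
    proof (rule cl_empty_fixed[OF sat])
      fix \<sigma> :: "'k \<Rightarrow> 'k" assume \<sigma>: "field_aut \<sigma>" "\<And>e. e \<in> cl {} \<Longrightarrow> \<sigma> e = e"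
      note s = field_aut_simps[OF \<sigma>(1)]
      define R where "R = Poly_Mapping.map \<sigma> P1 - P1"
      have "R \<in> ideal_of n W" unfolding R_def
        by (intro ideal_of_diff P1 ideal_of_field_aut[OF W \<sigma>(1)]) (simp add: \<sigma>(2) cl_algebraic)
      moreover have lookup_R: "Poly_Mapping.lookup R m = \<sigma> (Poly_Mapping.lookup P1 m) - Poly_Mapping.lookup P1 m" for m
        unfolding R_def by (simp add: lookup_minus lookup_map_zero s)
      have "Poly_Mapping.lookup P1 \<mu> = 1" using p by (simp add: lookup_P1 p_def)
      then have "\<mu> \<notin> Poly_Mapping.keys R" by (simp add: in_keys_iff lookup_R s)
      moreover have "Poly_Mapping.keys R \<subseteq> Poly_Mapping.keys P1"
        by (auto simp: in_keys_iff lookup_R s)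
      ultimately have "Poly_Mapping.keys R \<subset> Poly_Mapping.keys P" using \<mu> keys_P1 by blast
      then have "card (Poly_Mapping.keys R) < card (Poly_Mapping.keys P)"
        by (intro psubset_card_mono) auto
      then have "R \<notin> A" using min by force
      then have "R = 0" using \<open>R \<in> ideal_of n W\<close> \<open>Poly_Mapping.keys R \<subset> Poly_Mapping.keys P\<close> P(3)
        unfolding A_def by blast
      then show "\<sigma> (Poly_Mapping.lookup P1 m) = Poly_Mapping.lookup P1 m"
        using lookup_R[of m] by simp
    qed
    \<comment> \<open>Subtracting q P1 removes \<mu> from the support. Since D kills the
      coefficients of P1, applying D to the coefficients of Q and of Q' gives polynomials that
      differ by D(q) P1, which lies in the ideal.\<close>
    define q where "q = Poly_Mapping.lookup Q \<mu>"
    define Q' where "Q' = Q - Poly_Mapping.map ((*) q) P1"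
    have lookup_Q': "Poly_Mapping.lookup Q' m = Poly_Mapping.lookup Q m - q * Poly_Mapping.lookup P1 m" for m
      unfolding Q'_def by (simp add: lookup_minus lookup_map_zero)
    have "Q' \<in> ideal_of n W" unfolding Q'_def by (intro ideal_of_diff less.prems ideal_of_smult P1)
    moreover have "card (Poly_Mapping.keys Q') < card (Poly_Mapping.keys Q)"
    proof (rule psubset_card_mono)
      have "\<mu> \<notin> Poly_Mapping.keys Q'" using p by (simp add: in_keys_iff lookup_Q' lookup_P1 q_def p_def)
      moreover have "Poly_Mapping.keys Q' \<subseteq> Poly_Mapping.keys Q"
        using P(3) by (auto simp: in_keys_iff lookup_Q' lookup_P1 subset_iff)
      ultimately show "Poly_Mapping.keys Q' \<subset> Poly_Mapping.keys Q" using \<mu> P(3) by blast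
    qed simp
    ultimately have "Poly_Mapping.map D Q' \<in> ideal_of n W" using less.hyps by blast
    then have "Poly_Mapping.map D Q' + Poly_Mapping.map ((*) (D q)) P1 \<in> ideal_of n W"
      by (intro ideal_of_add ideal_of_smult P1)
    moreover have "Poly_Mapping.map D Q = Poly_Mapping.map D Q' + Poly_Mapping.map ((*) (D q)) P1"
    proof (rule poly_mapping_eqI)
      fix m
      have "Poly_Mapping.lookup Q m = Poly_Mapping.lookup Q' m + q * Poly_Mapping.lookup P1 m"
        unfolding lookup_Q' by simp
      then have "D (Poly_Mapping.lookup Q m) =
          D (Poly_Mapping.lookup Q' m) + D q * Poly_Mapping.lookup P1 m"
        using D(1) D(2)[OF P1_const[of m]] unfolding derivation_def by simp
      then show "Poly_Mapping.lookup (Poly_Mapping.map D Q) m =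
          Poly_Mapping.lookup (Poly_Mapping.map D Q' + Poly_Mapping.map ((*) (D q)) P1) m"
        by (simp add: lookup_add lookup_map_zero D0)
    qed
    ultimately show ?thesis by simp
  qed
qed

text \<open>Applying D to Q(x) = 0 expresses the sum of dQ/dx_i D(x_i) as the negative of the value
  at x of Q with D applied to its coefficients. That polynomial is in the ideal, so (x, D x) is
  tangent and may be added to the given tangent vector.\<close>

lemma tangent_bundle_derivation:
  fixes W :: "'k::{alg_closed_field, field_char_0} list set"
  assumes sat: "saturated (field_struct :: (field_sym, 'k) struct)"
    and W: "defined_over_Qalg n W" and D: "derivation D" "\<And>e. e \<in> cl {} \<Longrightarrow> D e = 0"
    and ts: "ts \<in> tangent_bundle n W"
  shows "map (\<lambda>p. (fst p, snd p + D (fst p))) ts \<in> tangent_bundle n W"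
  unfolding tangent_bundle_iff
proof (intro conjI ballI)
  let ?x = "map fst ts"
  have len: "length ts = n" using ts unfolding tangent_bundle_iff by blast
  then show "length (map (\<lambda>p. (fst p, snd p + D (fst p))) ts) = n" by simp
  have x: "map fst (map (\<lambda>p. (fst p, snd p + D (fst p))) ts) = ?x" by simp
  fix Q assume Q: "Q \<in> ideal_of n W"
  have ev: "eval_mpoly Q ?x = 0" "(\<Sum>i<n. partial_at i Q ?x * snd (ts ! i)) = 0"
    using ts Q unfolding tangent_bundle_iff by auto
  show "eval_mpoly Q (map fst (map (\<lambda>p. (fst p, snd p + D (fst p))) ts)) = 0"
    unfolding x by (rule ev)
  have "eval_mpoly (Poly_Mapping.map D Q) ?x = 0"
    using ts ideal_of_derivation[OF sat W D Q] unfolding tangent_bundle_iff by blast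
  then have "(\<Sum>i<n. partial_at i Q ?x * D (?x ! i)) = 0"
    using derivation_eval_mpoly[OF D(1), of n Q ?x] Q ev(1) derivation_0[OF D(1)]
    unfolding ideal_of_def by simp
  moreover have "(\<Sum>i<n. partial_at i Q ?x * snd (map (\<lambda>p. (fst p, snd p + D (fst p))) ts ! i)) =
      (\<Sum>i<n. partial_at i Q ?x * snd (ts ! i)) + (\<Sum>i<n. partial_at i Q ?x * D (?x ! i))"
    unfolding sum.distrib[symmetric] using len by (intro sum.cong) (auto simp: algebra_simps)
  ultimately show "(\<Sum>i<n. partial_at i Q (map fst (map (\<lambda>p. (fst p, snd p + D (fst p))) ts)) *
      snd (map (\<lambda>p. (fst p, snd p + D (fst p))) ts ! i)) = 0"
    unfolding x using ev(2) by simp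
qed

section \<open>Automorphisms of M induced by field automorphisms and derivations\<close>

primrec aut_S :: "('k \<Rightarrow> 'k) \<Rightarrow> 'k elem \<Rightarrow> 'k elem" where
  "aut_S \<sigma> (inP a) = inP (\<sigma> a)"
| "aut_S \<sigma> (inS p) = inS (\<sigma> (fst p), \<sigma> (snd p))"

primrec aut_D :: "('k \<Rightarrow> 'k::plus) \<Rightarrow> 'k elem \<Rightarrow> 'k elem" where
  "aut_D D (inP a) = inP a"
| "aut_D D (inS p) = inS (fst p, snd p + D (fst p))"

lemma automorphismI:
  assumes "\<And>x. g (h x) = x" "\<And>x. h (g x) = x"
    and "\<And>R xs. I R xs \<Longrightarrow> I R (map h xs)" "\<And>R xs. I R xs \<Longrightarrow> I R (map g xs)"
  shows "automorphism I h"
  unfolding automorphism_def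
proof (intro conjI allI)
  show "bij h" using assms(1,2) by (intro bijI' | metis)+
  fix R xs
  have "map g (map h xs) = xs" using assms(1) by (simp add: map_idI)
  then show "I R (map h xs) \<longleftrightarrow> I R xs" using assms(3,4) by metis
qed

lemma M_struct_aut_S:
  fixes xs :: "'k::field_char_0 elem list"
  assumes \<sigma>: "field_aut \<sigma>" "\<And>x. algebraic x \<Longrightarrow> \<sigma> x = x" and "M_struct R xs"
  shows "M_struct R (map (aut_S \<sigma>) xs)"
proof (cases R)
  case (Field T)
  then obtain as where as: "xs = map inP as" "field_struct T as" using assms(3) by auto
  have "field_struct T (map \<sigma> as)"
    using automorphism_field_aut[OF \<sigma>(1)] as(2) unfolding automorphism_def by blast
  moreover have "map (aut_S \<sigma>) xs = map inP (map \<sigma> as)" unfolding as(1) by simp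
  ultimately show ?thesis unfolding Field M_struct.simps by blast
next
  case (Tan W)
  then obtain ts where ts: "xs = map inS ts" "irreducible_variety (length ts) W"
      "defined_over_Qalg (length ts) W" "ts \<in> tangent_bundle (length ts) W" using assms(3) by auto
  let ?ts = "map (\<lambda>p. (\<sigma> (fst p), \<sigma> (snd p))) ts"
  have "?ts \<in> tangent_bundle (length ?ts) W"
    using tangent_bundle_field_aut[OF ts(3) \<sigma> ts(4)] by simp
  moreover have "map (aut_S \<sigma>) xs = map inS ?ts" unfolding ts(1) by simp
  moreover have "irreducible_variety (length ?ts) W" "defined_over_Qalg (length ?ts) W"
    using ts by simp_all
  ultimately show ?thesis unfolding Tan M_struct.simps by blast
qed (use assms(3) in \<open>auto simp: field_aut_simps[OF \<sigma>(1)]\<close>)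

lemma automorphism_aut_S:
  fixes \<sigma> :: "'k::field_char_0 \<Rightarrow> 'k"
  assumes \<sigma>: "field_aut \<sigma>" "\<And>x. x \<in> cl {} \<Longrightarrow> \<sigma> x = x"
  shows "automorphism M_struct (aut_S \<sigma>)"
proof (rule automorphismI[of "aut_S (inv_into UNIV \<sigma>)"])
  let ?\<tau> = "inv_into UNIV \<sigma>"
  have b: "bij \<sigma>" using \<sigma>(1) unfolding field_aut_def by blast
  then have inv: "?\<tau> (\<sigma> x) = x" "\<sigma> (?\<tau> x) = x" for x
    by (simp_all add: bij_is_inj bij_is_surj surj_f_inv_f)
  show "aut_S ?\<tau> (aut_S \<sigma> x) = x" "aut_S \<sigma> (aut_S ?\<tau> x) = x" for x
    using inv by (cases x; simp)+
  have alg: "\<sigma> x = x" if "algebraic x" for x using \<sigma>(2) cl_algebraic that by blast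
  then show "M_struct R xs \<Longrightarrow> M_struct R (map (aut_S \<sigma>) xs)" for R xs
    using M_struct_aut_S[OF \<sigma>(1)] by blast
  have "?\<tau> x = x" if "algebraic x" for x using inv(1)[of x] alg[OF that] by simp
  then show "M_struct R xs \<Longrightarrow> M_struct R (map (aut_S ?\<tau>) xs)" for R xs
    using M_struct_aut_S[OF field_aut_inverse[OF \<sigma>(1)]] by blast
qed

lemma M_struct_aut_D:
  fixes xs :: "'k::{alg_closed_field, field_char_0} elem list"
  assumes sat: "saturated (field_struct :: (field_sym, 'k) struct)"
    and D: "derivation D" "\<And>e. e \<in> cl {} \<Longrightarrow> D e = 0" and "M_struct R xs"
  shows "M_struct R (map (aut_D D) xs)"
proof (cases R)
  case (Field T)
  then obtain as where as: "xs = map inP as" "field_struct T as" using assms(4) by auto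
  moreover have "map (aut_D D) xs = map inP as" unfolding as(1) by simp
  ultimately show ?thesis unfolding Field M_struct.simps by blast
next
  case (Tan W)
  then obtain ts where ts: "xs = map inS ts" "irreducible_variety (length ts) W"
      "defined_over_Qalg (length ts) W" "ts \<in> tangent_bundle (length ts) W" using assms(4) by auto
  let ?ts = "map (\<lambda>p. (fst p, snd p + D (fst p))) ts"
  have "?ts \<in> tangent_bundle (length ?ts) W"
    using tangent_bundle_derivation[OF sat ts(3) D ts(4)] by simp
  moreover have "map (aut_D D) xs = map inS ?ts" unfolding ts(1) by simp
  moreover have "irreducible_variety (length ?ts) W" "defined_over_Qalg (length ?ts) W"
    using ts by simp_all
  ultimately show ?thesis unfolding Tan M_struct.simps by blast
qed (use assms(4) in \<open>auto simp: algebra_simps\<close>)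

lemma automorphism_aut_D:
  fixes D :: "'k::{alg_closed_field, field_char_0} \<Rightarrow> 'k"
  assumes sat: "saturated (field_struct :: (field_sym, 'k) struct)"
    and D: "derivation D" "\<And>e. e \<in> cl {} \<Longrightarrow> D e = 0"
  shows "automorphism M_struct (aut_D D)"
proof (rule automorphismI[of "aut_D (\<lambda>x. - D x)"])
  have D': "derivation (\<lambda>x. - D x)" using D(1) unfolding derivation_def by simp
  show "aut_D (\<lambda>x. - D x) (aut_D D x) = x" "aut_D D (aut_D (\<lambda>x. - D x) x) = x" for x
    by (cases x; simp)+
  show "M_struct R xs \<Longrightarrow> M_struct R (map (aut_D D) xs)" for R xs
    by (rule M_struct_aut_D[OF sat D])
  show "M_struct R xs \<Longrightarrow> M_struct R (map (aut_D (\<lambda>x. - D x)) xs)" for R xs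
    by (rule M_struct_aut_D[OF sat D']) (simp_all add: D(2))
qed

section \<open>The field inside M and first coordinates\<close>

primrec relativize :: "field_sym fm \<Rightarrow> 'k M_sym fm" where
  "relativize (Eq i j) = Eq i j"
| "relativize (Rel R is) = Rel (Field R) is"
| "relativize (Neg \<phi>) = Neg (relativize \<phi>)"
| "relativize (Conj \<phi> \<psi>) = Conj (relativize \<phi>) (relativize \<psi>)"
| "relativize (Ex i \<phi>) = fm.Ex i (Conj (Rel SortP [i]) (relativize \<phi>))"

lemma fv_relativize: "fv (relativize \<phi>) = fv \<phi>"
  by (induction \<phi>) auto

lemma sat_relativize:
  "sat M_struct (inP \<circ> v) (relativize \<phi>) \<longleftrightarrow> sat field_struct (v :: nat \<Rightarrow> 'k::field_char_0) \<phi>"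
proof (induction \<phi> arbitrary: v)
  case (Rel R js)
  have "map (inP \<circ> v) js = map inP as \<longleftrightarrow> as = map v js" for as
    using inj_map_eq_map[of inP "map v js" as] by (auto simp: inj_def)
  then show ?case
    unfolding relativize.simps sat.simps M_struct.simps by (simp only: simp_thms ex_simps)
next
  case (Ex i \<phi>)
  have upd: "(inP \<circ> v)(i := inP a) = inP \<circ> v(i := a)" for a by (auto simp: fun_eq_iff)
  have "sat M_struct ((inP \<circ> v)(i := inP a)) (relativize \<phi>) \<longleftrightarrow> sat field_struct (v(i := a)) \<phi>" for a
    unfolding upd by (rule Ex)
  moreover have "sat M_struct (inP \<circ> v) (relativize (fm.Ex i \<phi>)) \<longleftrightarrow>
      (\<exists>a. sat M_struct ((inP \<circ> v)(i := inP a)) (relativize \<phi>))"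
    by (auto simp del: comp_apply)
  ultimately show ?case by (simp only: sat.simps)
qed (simp_all add: inj_def)

lemma sat_relativize':
  assumes "\<And>i. i \<in> fv \<phi> \<Longrightarrow> w i = inP (v i)"
  shows "sat M_struct w (relativize \<phi>) \<longleftrightarrow> sat field_struct (v :: nat \<Rightarrow> 'k::field_char_0) \<phi>"
proof -
  have "sat M_struct w (relativize \<phi>) \<longleftrightarrow> sat M_struct (inP \<circ> v) (relativize \<phi>)"
    using assms by (intro sat_cong) (simp add: fv_relativize)
  then show ?thesis using sat_relativize by blast
qed

lemma acl_M_cl:
  fixes x :: "'k::field_char_0"
  assumes "x \<in> cl A"
  shows "inP x \<in> acl M_struct (inP ` A)"
proof -
  obtain \<phi> v where v: "\<And>i. i \<in> fv \<phi> \<Longrightarrow> i \<noteq> 0 \<Longrightarrow> v i \<in> A" "sat field_struct (v(0 := x)) \<phi>"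
    "finite {y. sat field_struct (v(0 := y)) \<phi>}" using aclE[OF assms] by metis
  define \<theta> where "\<theta> = Conj (Rel SortP [0]) (relativize \<phi> :: 'k M_sym fm)"
  have *: "sat M_struct ((inP \<circ> v)(0 := y)) \<theta> \<longleftrightarrow> (\<exists>z. y = inP z \<and> sat field_struct (v(0 := z)) \<phi>)" for y
  proof -
    have "sat M_struct ((inP \<circ> v)(0 := inP z)) (relativize \<phi>) \<longleftrightarrow> sat field_struct (v(0 := z)) \<phi>" for z
      by (rule sat_relativize') simp
    then show ?thesis unfolding \<theta>_def by auto
  qed
  show ?thesis
  proof (rule aclI[of \<theta> "inP \<circ> v"])
    show "(inP \<circ> v) i \<in> inP ` A" if "i \<in> fv \<theta>" "i \<noteq> 0" for i
      using v(1) that unfolding \<theta>_def by (simp add: fv_relativize)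
    show "sat M_struct ((inP \<circ> v)(0 := inP x)) \<theta>" unfolding * using v(2) by blast
    have "{y. sat M_struct ((inP \<circ> v)(0 := y)) \<theta>} = inP ` {z. sat field_struct (v(0 := z)) \<phi>}"
      unfolding * by blast
    then show "finite {y. sat M_struct ((inP \<circ> v)(0 := y)) \<theta>}" using v(3) by simp
  qed
qed

lemma generic_P_not_cl: "generic_P a \<Longrightarrow> a \<notin> cl {}"
  unfolding generic_P_def using acl_M_cl[of a "{}"] by auto

text \<open>Treats both sorts alike, since independence is exploited for tuples of P, in the choice
  of a, b, c, and for tuples of S, the realizations of q.\<close>

primrec pcoord :: "'k elem \<Rightarrow> 'k" where
  "pcoord (inP a) = a"
| "pcoord (inS p) = fst p"

definition pcoord_formula :: "nat \<Rightarrow> nat \<Rightarrow> 'k M_sym fm" where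
  "pcoord_formula i j = Disj (Conj (Rel SortP [i]) (Eq i j)) (Rel Proj [i, j])"

lemma sat_pcoord_formula:
  "sat M_struct v (pcoord_formula i j) \<longleftrightarrow> v j = inP (pcoord (v i))"
  unfolding pcoord_formula_def by (cases "v i") auto

lemma substitute_pcoord:
  fixes \<theta> :: "'k::field_char_0 M_sym fm"
  assumes "finite J" "\<And>j. j \<in> J \<Longrightarrow> \<kappa> j \<notin> J"
  shows "\<exists>\<theta>'. fv \<theta>' \<subseteq> (fv \<theta> - J) \<union> \<kappa> ` J \<and>
    (\<forall>u. sat M_struct u \<theta>' \<longleftrightarrow>
      sat M_struct (\<lambda>i. if i \<in> J then inP (pcoord (u (\<kappa> i))) else u i) \<theta>)"
  using assms
proof (induction J rule: finite_induct)
  case empty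
  then show ?case by (intro exI[of _ \<theta>]) simp
next
  case (insert j J)
  then have "\<kappa> i \<notin> J" if "i \<in> J" for i using that by blast
  from insert.IH[OF this] obtain \<theta>' where \<theta>': "fv \<theta>' \<subseteq> (fv \<theta> - J) \<union> \<kappa> ` J"
    "\<And>u. sat M_struct u \<theta>' \<longleftrightarrow>
      sat M_struct (\<lambda>i. if i \<in> J then inP (pcoord (u (\<kappa> i))) else u i) \<theta>"
    by blast
  define \<eta> where "\<eta> = fm.Ex j (Conj (pcoord_formula (\<kappa> j) j) \<theta>')"
  have kj: "\<kappa> j \<noteq> j" "\<And>i. i \<in> J \<Longrightarrow> \<kappa> i \<noteq> j" using insert.prems by auto
  have "fv \<eta> \<subseteq> (fv \<theta> - insert j J) \<union> \<kappa> ` insert j J"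
    using \<theta>'(1) kj unfolding \<eta>_def pcoord_formula_def by auto
  moreover have "sat M_struct u \<eta> \<longleftrightarrow>
      sat M_struct (\<lambda>i. if i \<in> insert j J then inP (pcoord (u (\<kappa> i))) else u i) \<theta>" for u
  proof -
    have "sat M_struct u \<eta> \<longleftrightarrow> sat M_struct (u(j := inP (pcoord (u (\<kappa> j))))) \<theta>'"
      unfolding \<eta>_def using kj by (simp add: sat_pcoord_formula)
    also have "\<dots> \<longleftrightarrow>
        sat M_struct (\<lambda>i. if i \<in> insert j J then inP (pcoord (u (\<kappa> i))) else u i) \<theta>"
      unfolding \<theta>'(2) using kj insert.hyps by (intro sat_cong) auto
    finally show ?thesis .
  qed
  ultimately show ?case by blast
qed

text \<open>Variables in S are read off the tuple z through \<kappa>; the others keep their value, a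
  parameter from C.\<close>

lemma definable_pcoord:
  fixes v :: "nat \<Rightarrow> 'k::field_char_0"
  assumes S: "\<And>i. i \<in> fv \<psi> \<Longrightarrow> i \<in> S \<Longrightarrow> \<kappa> i < n"
    and C: "\<And>i. i \<in> fv \<psi> \<Longrightarrow> i \<notin> S \<Longrightarrow> v i \<in> C"
  shows "{z. length z = n \<and> sat field_struct (\<lambda>i. if i \<in> S then pcoord (z ! \<kappa> i) else v i) \<psi>}
    \<in> definable M_struct (inP ` C) n"
proof -
  \<comment> \<open>Field variables are shifted by n, past the entries of z; J holds the shifted
    ones that \<open>substitute_pcoord\<close> replaces by coordinates of z.\<close>
  define J where "J = {n + i | i. i \<in> fv \<psi> \<and> i \<in> S}"
  define \<kappa>' where "\<kappa>' i = \<kappa> (i - n)" for i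
  have "finite J" unfolding J_def using finite_fv[of \<psi>] by simp
  moreover have \<kappa>': "\<kappa>' j < n" if "j \<in> J" for j using that S unfolding J_def \<kappa>'_def by auto
  then have "\<kappa>' j \<notin> J" if "j \<in> J" for j using that unfolding J_def by fastforce
  ultimately obtain \<theta> :: "'k M_sym fm" where
    \<theta>: "fv \<theta> \<subseteq> (fv (relativize (rename (\<lambda>i. n + i) \<psi>) :: 'k M_sym fm) - J) \<union> \<kappa>' ` J"
    "\<And>u. sat M_struct u \<theta> \<longleftrightarrow> sat M_struct (\<lambda>i. if i \<in> J then inP (pcoord (u (\<kappa>' i))) else u i)
      (relativize (rename (\<lambda>i. n + i) \<psi>))"
    using substitute_pcoord[of J \<kappa>' "relativize (rename (\<lambda>i. n + i) \<psi>)"] by blast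
  have shift: "inj (\<lambda>i :: nat. n + i)" by (simp add: inj_def)
  define w where "w i = inP (v (i - n))" for i
  have "sat M_struct (asg z w) \<theta> \<longleftrightarrow>
      sat field_struct (\<lambda>i. if i \<in> S then pcoord (z ! \<kappa> i) else v i) \<psi>" if "length z = n" for z
  proof -
    have "sat M_struct (asg z w) \<theta> \<longleftrightarrow> sat field_struct
        (\<lambda>i. if i - n \<in> S then pcoord (z ! \<kappa> (i - n)) else v (i - n)) (rename (\<lambda>i. n + i) \<psi>)"
      unfolding \<theta>(2)
    proof (rule sat_relativize')
      fix i assume "i \<in> fv (rename (\<lambda>i. n + i) \<psi>)"
      then obtain l where l: "i = n + l" "l \<in> fv \<psi>" unfolding fv_rename[OF shift] by blast
      then have "i \<in> J \<longleftrightarrow> l \<in> S" unfolding J_def by auto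
      then show "(if i \<in> J then inP (pcoord (asg z w (\<kappa>' i))) else asg z w i) =
          inP (if i - n \<in> S then pcoord (z ! \<kappa> (i - n)) else v (i - n))"
        using S[OF l(2)] that l(1) by (simp add: asg_def w_def \<kappa>'_def)
    qed
    also have "\<dots> \<longleftrightarrow> sat field_struct (\<lambda>i. if i \<in> S then pcoord (z ! \<kappa> i) else v i) \<psi>"
      unfolding sat_rename[OF shift] by (intro sat_cong) simp
    finally show ?thesis .
  qed
  then have "{z. length z = n \<and> sat field_struct (\<lambda>i. if i \<in> S then pcoord (z ! \<kappa> i) else v i) \<psi>} =
      {z. length z = n \<and> sat M_struct (asg z w) \<theta>}" by blast
  also have "\<dots> \<in> definable M_struct (inP ` C) n"
  proof (rule definableI)
    fix i assume i: "i \<in> fv \<theta>" "n \<le> i"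
    then have "i \<notin> \<kappa>' ` J" using \<kappa>' by force
    then have "i \<notin> J" "i \<in> (\<lambda>i. n + i) ` fv \<psi>"
      using \<theta>(1) i(1) unfolding fv_relativize fv_rename[OF shift] by auto
    then show "w i \<in> inP ` C" using C unfolding J_def w_def by auto
  qed
  finally show ?thesis .
qed

text \<open>
  If \<open>t\<close> is transcendental over \<open>F\<close> but algebraic over \<open>F\<close> and the coordinates of \<open>x\<close>, then the
  conjugates \<open>t + j\<close> of \<open>t\<close> witness that \<open>x\<close> depends on \<open>F\<close> and \<open>t\<close>: each tuple satisfies the
  algebraic relation with at most \<open>d\<close> of them.
\<close>

lemma not_indep_if_interalgebraic:
  fixes x :: "'k::{alg_closed_field, field_char_0} elem list"
  assumes sat: "saturated (field_struct :: (field_sym, 'k) struct)"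
    and F: "finite F" "inP ` insert t F \<subseteq> dcl M_struct A"
    and t: "t \<in> cl (F \<union> pcoord ` set x)" "t \<notin> cl F"
  shows "\<not> indep M_struct {} x A"
proof -
  define n where "n = length x"
  obtain \<phi> v where v: "\<And>i. i \<in> fv \<phi> \<Longrightarrow> i \<noteq> 0 \<Longrightarrow> v i \<in> F \<union> pcoord ` set x"
      "sat field_struct (v(0 := t)) \<phi>" "finite {y. sat field_struct (v(0 := y)) \<phi>}"
    using aclE[OF t(1)] by metis
  define d where "d = card {y. sat field_struct (v(0 := y)) \<phi>}"
  obtain \<chi> where \<chi>: "fv \<chi> \<subseteq> fv \<phi> - {0}" "\<And>v :: nat \<Rightarrow> 'k. sat field_struct v \<chi> \<longleftrightarrow>
      finite {y. sat field_struct (v(0 := y)) \<phi>} \<and> card {y. sat field_struct (v(0 := y)) \<phi>} \<le> d"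
    using card_le_formula[of \<phi> 0 "field_struct :: (field_sym, 'k) struct" d] by blast
  \<comment> \<open>The bound d has to be part of the formula, because the formula is applied to
    tuples other than x.\<close>
  define \<psi> where "\<psi> = Conj \<phi> \<chi>"
  have fv_\<psi>: "fv \<psi> = fv \<phi>" using \<chi>(1) unfolding \<psi>_def by auto
  have "\<exists>k<n. v i \<notin> F \<longrightarrow> v i = pcoord (x ! k)" if "i \<in> fv \<phi>" "i \<noteq> 0" "v i \<notin> F" for i
    using v(1)[OF that(1,2)] that(3) unfolding n_def by (auto simp: in_set_conv_nth)
  then obtain k where k: "\<And>i. i \<in> fv \<phi> \<Longrightarrow> i \<noteq> 0 \<Longrightarrow> v i \<notin> F \<Longrightarrow> k i < n \<and> v i = pcoord (x ! k i)"
    by metis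
  \<comment> \<open>Parameters outside F are read off the tuple, while t, at variable 0, and the
    elements of F remain parameters. So Y is defined over F and t and contains x.\<close>
  define S where "S = {i. i \<noteq> 0 \<and> v i \<notin> F}"
  define vy where "vy y i = (if i \<in> S then pcoord (y ! k i) else (v(0 := t)) i)" for y i
  define Y where "Y = {y. length y = n \<and> sat field_struct (vy y) \<psi>}"
  have Y: "Y \<in> definable M_struct (inP ` insert t F) n"
    unfolding Y_def vy_def using k unfolding S_def fv_\<psi>[symmetric]
    by (intro definable_pcoord) auto
  have "sat field_struct (vy x) \<psi> \<longleftrightarrow> sat field_struct (v(0 := t)) \<psi>"
    using k fv_\<psi> by (intro sat_cong) (auto simp: vy_def S_def)
  moreover have "sat field_struct (v(0 := t)) \<psi>" unfolding \<psi>_def using v(2,3) by (simp add: \<chi>(2) d_def)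
  ultimately have "x \<in> Y" unfolding Y_def by (simp add: n_def)
  have "t + of_nat j \<notin> cl F" for j
    using t(2) cl_diff[OF _ cl_of_nat, of "t + of_nat j" F j] by auto
  then have "\<exists>\<sigma>. field_aut \<sigma> \<and> (\<forall>e\<in>cl F. \<sigma> e = e) \<and> \<sigma> t = t + of_nat j" for j
    using cl_homogeneous[OF sat F(1) t(2), of "t + of_nat j"] by metis
  then obtain \<sigma> where \<sigma>: "\<And>j :: nat. field_aut (\<sigma> j)" "\<And>j e. e \<in> cl F \<Longrightarrow> \<sigma> j e = e"
      "\<And>j. \<sigma> j t = t + of_nat j" by metis
  have aut: "automorphism M_struct (aut_S (\<sigma> j))" for j
    using \<sigma>(1,2) acl_mono[of "{}" F field_struct] by (intro automorphism_aut_S) auto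
  have inconsistent: "(\<Inter>j\<in>S. map (aut_S (\<sigma> j)) ` Y) = {}" if S: "finite S" "card S = Suc d" for S
  proof (rule ccontr)
    assume "(\<Inter>j\<in>S. map (aut_S (\<sigma> j)) ` Y) \<noteq> {}"
    then obtain y where y: "\<And>j. j \<in> S \<Longrightarrow> y \<in> map (aut_S (\<sigma> j)) ` Y" by blast
    have root: "sat field_struct ((vy y)(0 := t + of_nat j)) \<psi>" if j: "j \<in> S" for j
    proof -
      obtain z where z: "z \<in> Y" "y = map (aut_S (\<sigma> j)) z" using y[OF j] by blast
      have pc: "pcoord (aut_S (\<sigma> j) e) = \<sigma> j (pcoord e)" for e by (cases e) auto
      have "sat field_struct ((vy y)(0 := t + of_nat j)) \<psi> \<longleftrightarrow> sat field_struct (\<sigma> j \<circ> vy z) \<psi>"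
        using k \<sigma>(2,3) acl_superset[of F field_struct] z unfolding fv_\<psi>[symmetric]
        by (intro sat_cong) (auto simp: vy_def S_def Y_def pc)
      also have "\<dots> \<longleftrightarrow> sat field_struct (vy z) \<psi>"
        by (rule sat_automorphism[OF automorphism_field_aut[OF \<sigma>(1)]])
      finally show ?thesis using z(1) unfolding Y_def by blast
    qed
    define T where "T = {y'. sat field_struct ((vy y)(0 := y')) \<phi>}"
    have sub: "(\<lambda>j. t + of_nat j) ` S \<subseteq> T" using root unfolding T_def \<psi>_def by auto
    obtain j where "j \<in> S" using S by fastforce
    then have "sat field_struct ((vy y)(0 := t + of_nat j)) \<chi>" using root unfolding \<psi>_def by simp
    then have T: "finite T" "card T \<le> d" unfolding \<chi>(2) T_def by simp_all
    have card: "card ((\<lambda>j. t + of_nat j) ` S) = Suc d"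
      using S(2) by (subst card_image) (auto simp: inj_on_def)
    have "Suc d \<le> card T" using card_mono[OF T(1) sub] unfolding card .
    then show False using T(2) by linarith
  qed
  have "divides M_struct {} n Y"
    by (rule divides_automorphisms[OF Y aut inconsistent])
  moreover have "Y \<in> definable M_struct ({} \<union> A) (length x)"
    using definable_dcl[OF Y F(2)] unfolding n_def by simp
  ultimately show ?thesis using not_indep_divides \<open>x \<in> Y\<close> unfolding n_def by blast
qed

text \<open>If adding t to a finite part F of T makes y algebraic, exchange makes t algebraic over F
  and the coordinates of x, while t is transcendental over F. Then x is not independent from
  A.\<close>

lemma indep_cl:
  fixes x :: "'k::{alg_closed_field, field_char_0} elem list"
  assumes sat: "saturated (field_struct :: (field_sym, 'k) struct)"
    and "indep M_struct {} x A" "inP ` T \<subseteq> dcl M_struct A"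
    and "y \<in> pcoord ` set x" "Z \<subseteq> pcoord ` set x" "y \<notin> cl Z"
  shows "y \<notin> cl (T \<union> Z)"
proof
  assume "y \<in> cl (T \<union> Z)"
  then obtain F t where F: "finite F" "F \<subseteq> T" "t \<in> T" "y \<notin> cl (F \<union> Z)" "y \<in> cl (insert t (F \<union> Z))"
    using cl_minimal[OF _ assms(6)] by metis
  have "t \<in> cl (insert y (F \<union> Z))" by (rule cl_exchange[OF F(4,5)])
  then have "t \<in> cl (F \<union> pcoord ` set x)"
    using acl_mono[of "insert y (F \<union> Z)" "F \<union> pcoord ` set x"] assms(4,5) by blast
  moreover have "t \<notin> cl F"
    using F(4,5) cl_insert[of t "F \<union> Z"] acl_mono[of F "F \<union> Z" field_struct] by blast
  ultimately show False
    using not_indep_if_interalgebraic[OF sat F(1)] assms(2,3) F(2,3) by blast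
qed

lemma dcl_projection:
  fixes a :: "'k::field_char_0"
  assumes "inS (a, u) \<in> A"
  shows "inP a \<in> dcl M_struct A"
  unfolding dcl_def
  by (intro CollectI exI[of _ "Rel Proj [1, 0]"] exI[of _ "\<lambda>_. inS (a, u)"]) (use assms in auto)

text \<open>In the fibre over 0 the definable origin serves as base point: u is the scalar whose
  action carries (0, 0) to (0, u).\<close>

lemma dcl_fibre_origin:
  fixes u :: "'k::field_char_0"
  assumes "inS (0, u) \<in> A"
  shows "inP u \<in> dcl M_struct A"
proof -
  define \<phi> :: "'k M_sym fm" where "\<phi> = fm.Ex 2 (Conj (Rel (Tan {[0]}) [2]) (Rel Act [0, 2, 1]))"
  have "sat M_struct ((\<lambda>_. inS (0, u))(0 := y)) \<phi> \<longleftrightarrow> y = inP u" for y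
  proof -
    have tan: "M_struct (Tan {[0]}) [e] \<longleftrightarrow> e = inS (0, 0 :: 'k)" for e
    proof (cases e)
      case (inS p)
      then show ?thesis using M_struct_Tan_origin[of "fst p" "snd p"] by (auto simp: prod_eq_iff)
    qed auto
    show ?thesis unfolding \<phi>_def sat.simps list.map tan by (simp add: eq_commute)
  qed
  then show ?thesis unfolding dcl_def
    by (intro CollectI exI[of _ \<phi>] exI[of _ "\<lambda>_. inS (0, u)"]) (use assms in auto)
qed

section \<open>Generic triples and their conjugacy\<close>

definition generic3 :: "'k::field set \<Rightarrow> 'k \<Rightarrow> 'k \<Rightarrow> 'k \<Rightarrow> bool" where
  "generic3 L a b c \<longleftrightarrow> a \<notin> cl L \<and> b \<notin> cl (insert a L) \<and> c \<notin> cl (insert b (insert a L))"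

text \<open>The three coordinates are put in place one after the other, each automorphism fixing L
  and what has been placed already.\<close>

lemma generic3_homogeneous:
  fixes L :: "'k::{alg_closed_field, field_char_0} set"
  assumes sat: "saturated (field_struct :: (field_sym, 'k) struct)" and L: "finite L"
    and g: "generic3 L a b c" "generic3 L a' b' c'"
  obtains \<sigma> where "field_aut \<sigma>" "\<And>e. e \<in> cl L \<Longrightarrow> \<sigma> e = e" "\<sigma> a = a'" "\<sigma> b = b'" "\<sigma> c = c'"
proof -
  obtain \<sigma> where \<sigma>: "field_aut \<sigma>" "\<And>e. e \<in> cl L \<Longrightarrow> \<sigma> e = e" "\<sigma> a = a'"
    using cl_homogeneous[OF sat L, of a a'] g unfolding generic3_def by metis
  have \<sigma>L: "\<sigma> ` L = L" using \<sigma>(2) acl_superset[of L field_struct] by force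
  have "\<sigma> b \<notin> cl (insert a' L)"
    using acl_automorphism_iff[OF automorphism_field_aut[OF \<sigma>(1)], of b "insert a L"] g(1) \<sigma>(3) \<sigma>L
    unfolding generic3_def by simp
  moreover have "b' \<notin> cl (insert a' L)" "finite (insert a' L)" using g L unfolding generic3_def by auto
  ultimately obtain \<tau> where \<tau>: "field_aut \<tau>" "\<And>e. e \<in> cl (insert a' L) \<Longrightarrow> \<tau> e = e" "\<tau> (\<sigma> b) = b'"
    using cl_homogeneous[OF sat, of "insert a' L" "\<sigma> b" b'] by metis
  have \<tau>a: "\<tau> e = e" if "e \<in> insert a' L" for e
    using \<tau>(2) that acl_superset[of "insert a' L" field_struct] by blast
  have \<tau>L: "\<tau> ` L = L" using \<tau>a by force
  have "\<sigma> c \<notin> cl (insert (\<sigma> b) (insert a' L))"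
    using acl_automorphism_iff[OF automorphism_field_aut[OF \<sigma>(1)], of c "insert b (insert a L)"] g(1) \<sigma>(3) \<sigma>L
    unfolding generic3_def by simp
  then have "\<tau> (\<sigma> c) \<notin> cl (insert b' (insert a' L))"
    using acl_automorphism_iff[OF automorphism_field_aut[OF \<tau>(1)], of "\<sigma> c" "insert (\<sigma> b) (insert a' L)"]
      \<tau>(3) \<tau>L \<tau>a by simp
  moreover have "c' \<notin> cl (insert b' (insert a' L))" "finite (insert b' (insert a' L))"
    using g L unfolding generic3_def by auto
  ultimately obtain \<rho> where \<rho>: "field_aut \<rho>" "\<And>e. e \<in> cl (insert b' (insert a' L)) \<Longrightarrow> \<rho> e = e"
      "\<rho> (\<tau> (\<sigma> c)) = c'"
    using cl_homogeneous[OF sat, of "insert b' (insert a' L)" "\<tau> (\<sigma> c)" c'] by metis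
  have \<rho>a: "\<rho> e = e" if "e \<in> insert b' (insert a' L)" for e
    using \<rho>(2) that acl_superset[of "insert b' (insert a' L)" field_struct] by blast
  show thesis
  proof (rule that[of "\<rho> \<circ> \<tau> \<circ> \<sigma>"])
    show "field_aut (\<rho> \<circ> \<tau> \<circ> \<sigma>)" using \<sigma>(1) \<tau>(1) \<rho>(1) by (intro field_aut_compose)
    have "cl L \<subseteq> cl (insert a' L)" "cl L \<subseteq> cl (insert b' (insert a' L))" by (intro acl_mono; auto)+
    then have "e \<in> cl (insert a' L)" "e \<in> cl (insert b' (insert a' L))" if "e \<in> cl L" for e
      using that by blast+
    then show "(\<rho> \<circ> \<tau> \<circ> \<sigma>) e = e" if "e \<in> cl L" for e using that \<sigma>(2) \<tau>(2) \<rho>(2) by simp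
    show "(\<rho> \<circ> \<tau> \<circ> \<sigma>) a = a'" "(\<rho> \<circ> \<tau> \<circ> \<sigma>) b = b'" "(\<rho> \<circ> \<tau> \<circ> \<sigma>) c = c'"
      using \<sigma>(3) \<tau>(3) \<rho>(3) \<tau>a \<rho>a by auto
  qed
qed

text \<open>D1, D2, D3 have value 1 at a, b, c respectively, and D2, D3 vanish at the earlier
  elements. The system for the coefficients is therefore triangular: f2 and f3 correct for D1 at b
  and c and for D2 at c.\<close>

lemma generic3_derivation:
  fixes L :: "'k::field_char_0 set"
  assumes "generic3 L a b c"
  obtains D where "derivation D" "\<And>e. e \<in> cl L \<Longrightarrow> D e = 0" "D a = e1" "D b = e2" "D c = e3"
proof -
  obtain D1 where D1: "derivation D1" "\<And>e. e \<in> cl L \<Longrightarrow> D1 e = 0" "D1 a = 1"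
    using cl_derivation[of a L] assms unfolding generic3_def by metis
  obtain D2 where D2: "derivation D2" "\<And>e. e \<in> cl (insert a L) \<Longrightarrow> D2 e = 0" "D2 b = 1"
    using cl_derivation[of b "insert a L"] assms unfolding generic3_def by metis
  obtain D3 where D3: "derivation D3" "\<And>e. e \<in> cl (insert b (insert a L)) \<Longrightarrow> D3 e = 0" "D3 c = 1"
    using cl_derivation[of c "insert b (insert a L)"] assms unfolding generic3_def by metis
  have z: "D2 a = 0" "D3 a = 0" "D3 b = 0"
    using D2(2) D3(2) acl_superset[of "insert a L" field_struct]
      acl_superset[of "insert b (insert a L)" field_struct] by auto
  have sub: "cl L \<subseteq> cl (insert a L)" "cl L \<subseteq> cl (insert b (insert a L))" by (intro acl_mono; auto)+
  define f2 where "f2 = e2 - e1 * D1 b"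
  define f3 where "f3 = e3 - e1 * D1 c - f2 * D2 c"
  define D where "D x = e1 * D1 x + f2 * D2 x + f3 * D3 x" for x
  show thesis
  proof (rule that[of D])
    have add: "D1 (x + y) = D1 x + D1 y" "D2 (x + y) = D2 x + D2 y" "D3 (x + y) = D3 x + D3 y"
      and mult: "D1 (x * y) = x * D1 y + D1 x * y" "D2 (x * y) = x * D2 y + D2 x * y"
        "D3 (x * y) = x * D3 y + D3 x * y" for x y
      using D1(1) D2(1) D3(1) unfolding derivation_def by blast+
    show "derivation D"
      unfolding derivation_def D_def add mult by (simp add: algebra_simps)
    show "D e = 0" if "e \<in> cl L" for e
      unfolding D_def using that D1(2) D2(2) D3(2) sub[THEN subsetD, OF that] by simp
    show "D a = e1" "D b = e2" "D c = e3"
      unfolding D_def f3_def f2_def using z D1(3) D2(3) D3(3) by simp_all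
  qed
qed

text \<open>\<sigma> moves the first coordinates; then D, which vanishes on \<open>cl L\<close>,
  adds to the second coordinates what is missing.\<close>

lemma generic3_automorphism:
  fixes L :: "'k::{alg_closed_field, field_char_0} set"
  assumes sat: "saturated (field_struct :: (field_sym, 'k) struct)" and L: "finite L"
    and g: "generic3 L a b c" "generic3 L a' b' c'"
  obtains h where "automorphism M_struct h" "\<And>e. e \<in> cl L \<Longrightarrow> h (inP e) = inP e"
    "\<And>e e'. e \<in> cl L \<Longrightarrow> e' \<in> cl L \<Longrightarrow> h (inS (e, e')) = inS (e, e')"
    "h (inS (a, u)) = inS (a', u')" "h (inS (b, v)) = inS (b', v')" "h (inS (c, w)) = inS (c', w')"
proof -
  obtain \<sigma> where \<sigma>: "field_aut \<sigma>" "\<And>e. e \<in> cl L \<Longrightarrow> \<sigma> e = e" "\<sigma> a = a'" "\<sigma> b = b'" "\<sigma> c = c'"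
    using generic3_homogeneous[OF sat L g] by metis
  obtain D where D: "derivation D" "\<And>e. e \<in> cl L \<Longrightarrow> D e = 0"
      "D a' = u' - \<sigma> u" "D b' = v' - \<sigma> v" "D c' = w' - \<sigma> w"
    using generic3_derivation[OF g(2)] by metis
  have sub: "cl {} \<subseteq> cl L" by (rule acl_mono) simp
  show thesis
  proof (rule that[of "aut_D D \<circ> aut_S \<sigma>"])
    show "automorphism M_struct (aut_D D \<circ> aut_S \<sigma>)"
      using \<sigma>(1,2) D(1,2) sub by (intro automorphism_compose automorphism_aut_D[OF sat] automorphism_aut_S) auto
  qed (use \<sigma> D in auto)
qed

section \<open>The type of a generic tangent vector of the quadric\<close>

lemma strong_type_refl: "x \<in> strong_type I A x"
  unfolding strong_type_def finite_equiv_rels_def by (auto simp: equiv_def refl_on_def)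

text \<open>D and its complement are the classes of a definable equivalence relation, so a strong
  type determines the type.\<close>

lemma strong_type_definable:
  assumes y: "y \<in> strong_type I A x" and D: "D \<in> definable I A (length x)"
  shows "length y = length x \<and> (x \<in> D \<longleftrightarrow> y \<in> D)"
proof -
  define n where "n = length x"
  define E where "E = {(x, y). length x = n \<and> length y = n \<and> (x \<in> D \<longleftrightarrow> y \<in> D)}"
  obtain \<phi> v where v: "\<And>i. i \<in> fv \<phi> \<Longrightarrow> n \<le> i \<Longrightarrow> v i \<in> A"
      "D = {xs. length xs = n \<and> sat I (asg xs v) \<phi>}" using definableE[OF D] unfolding n_def by metis
  have "equiv {xs. length xs = n} E"
    unfolding equiv_def refl_on_def sym_def trans_def E_def by auto
  moreover have "finite ({xs. length xs = n} // E)"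
  proof (rule finite_subset)
    show "{xs. length xs = n} // E \<subseteq> {{xs. length xs = n \<and> xs \<in> D}, {xs. length xs = n \<and> xs \<notin> D}}"
      unfolding quotient_def E_def by auto
  qed simp
  moreover have "{x @ y | x y. (x, y) \<in> E} \<in> definable I A (n + n)"
  proof -
    \<comment> \<open>Two copies of \<phi> are placed on the halves of a list of length n + n: f
      leaves its variables in the first half, g moves them to the second, and both send the
      parameter at i to i + n.\<close>
    define f where "f i = (if i < n then i else i + n)" for i
    define g where "g i = i + n" for i
    have f: "inj f" "inj g" unfolding f_def g_def inj_def by auto
    define w where "w i = v (i - n)" for i
    define \<phi>1 where "\<phi>1 = rename f \<phi>"
    define \<phi>2 where "\<phi>2 = rename g \<phi>"
    define \<theta> where "\<theta> = Disj (Conj \<phi>1 \<phi>2) (Conj (Neg \<phi>1) (Neg \<phi>2))"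
    have "{zs. length zs = n + n \<and> sat I (asg zs w) \<theta>} \<in> definable I A (n + n)"
    proof (rule definableI)
      fix i assume "i \<in> fv \<theta>" "n + n \<le> i"
      then have "i - n \<in> fv \<phi>" "n \<le> i - n"
        unfolding \<theta>_def \<phi>1_def \<phi>2_def fv.simps fv_rename[OF f(1)] fv_rename[OF f(2)]
        by (auto simp: f_def g_def split: if_splits)
      then show "w i \<in> A" unfolding w_def by (rule v(1))
    qed
    moreover have "{zs. length zs = n + n \<and> sat I (asg zs w) \<theta>} = {x @ y | x y. (x, y) \<in> E}"
    proof -
      have *: "sat I (asg (xs @ ys) w) \<theta> \<longleftrightarrow> (xs, ys) \<in> E" if len: "length xs = n" "length ys = n" for xs ys
      proof -
        have "sat I (asg (xs @ ys) w) \<phi>1 \<longleftrightarrow> sat I (asg xs v) \<phi>"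
          unfolding \<phi>1_def sat_rename[OF f(1)]
          by (intro sat_cong) (auto simp: asg_def f_def w_def len nth_append)
        moreover have "sat I (asg (xs @ ys) w) \<phi>2 \<longleftrightarrow> sat I (asg ys v) \<phi>"
          unfolding \<phi>2_def sat_rename[OF f(2)]
          by (intro sat_cong) (auto simp: asg_def g_def w_def len nth_append)
        ultimately show ?thesis unfolding \<theta>_def E_def v(2) using len by auto
      qed
      show ?thesis
      proof (intro equalityI subsetI)
        fix zs assume zs: "zs \<in> {zs. length zs = n + n \<and> sat I (asg zs w) \<theta>}"
        then have "(take n zs, drop n zs) \<in> E" using *[of "take n zs" "drop n zs"] by simp
        then show "zs \<in> {x @ y | x y. (x, y) \<in> E}" by (metis (mono_tags, lifting) append_take_drop_id mem_Collect_eq)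
      next
        fix zs assume "zs \<in> {x @ y | x y. (x, y) \<in> E}"
        then obtain xs ys where zs: "zs = xs @ ys" and E: "(xs, ys) \<in> E" by blast
        then have len: "length xs = n" "length ys = n" unfolding E_def by simp_all
        show "zs \<in> {zs. length zs = n + n \<and> sat I (asg zs w) \<theta>}"
          unfolding zs using *[OF len] E len by simp
      qed
    qed
    ultimately show ?thesis by simp
  qed
  ultimately have "(x, y) \<in> E" using y unfolding strong_type_def finite_equiv_rels_def n_def by blast
  then show ?thesis unfolding E_def n_def by simp
qed

text \<open>An algebraic dependence between first coordinates is witnessed by a formula without
  further parameters, including the bound on the number of solutions. Hence it is part of the
  type.\<close>

lemma pcoord_cl_transfer:
  fixes x y :: "'k::field_char_0 elem list"
  assumes same: "\<And>D. D \<in> definable M_struct {} n \<Longrightarrow> x \<in> D \<longleftrightarrow> y \<in> D"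
    and len: "length x = n" "length y = n" and i0: "i0 < n" "J \<subseteq> {..<n}"
    and y: "pcoord (y ! i0) \<in> cl ((\<lambda>j. pcoord (y ! j)) ` J)"
  shows "pcoord (x ! i0) \<in> cl ((\<lambda>j. pcoord (x ! j)) ` J)"
proof -
  obtain \<phi> v where v: "\<And>i. i \<in> fv \<phi> \<Longrightarrow> i \<noteq> 0 \<Longrightarrow> v i \<in> (\<lambda>j. pcoord (y ! j)) ` J"
      "sat field_struct (v(0 := pcoord (y ! i0))) \<phi>" "finite {z. sat field_struct (v(0 := z)) \<phi>}"
    using aclE[OF y] by metis
  define d where "d = card {z. sat field_struct (v(0 := z)) \<phi>}"
  obtain \<chi> where \<chi>: "fv \<chi> \<subseteq> fv \<phi> - {0}" "\<And>v :: nat \<Rightarrow> 'k. sat field_struct v \<chi> \<longleftrightarrow>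
      finite {z. sat field_struct (v(0 := z)) \<phi>} \<and> card {z. sat field_struct (v(0 := z)) \<phi>} \<le> d"
    using card_le_formula[of \<phi> 0 "field_struct :: (field_sym, 'k) struct" d] by blast
  define \<psi> where "\<psi> = Conj \<phi> \<chi>"
  have fv_\<psi>: "fv \<psi> = fv \<phi>" using \<chi>(1) unfolding \<psi>_def by auto
  have "\<exists>k\<in>J. v i = pcoord (y ! k)" if "i \<in> fv \<phi>" "i \<noteq> 0" for i using v(1)[OF that] by blast
  then obtain k where k: "\<And>i. i \<in> fv \<phi> \<Longrightarrow> i \<noteq> 0 \<Longrightarrow> k i \<in> J \<and> v i = pcoord (y ! k i)" by metis
  define \<kappa> where "\<kappa> i = (if i = 0 then i0 else k i)" for i
  define vz where "vz z i = pcoord (z ! \<kappa> i)" for z :: "'k elem list" and i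
  define D where "D = {z. length z = n \<and> sat field_struct (vz z) \<psi>}"
  have "\<kappa> i < n" if "i \<in> fv \<psi>" for i
    using that k i0 unfolding fv_\<psi> \<kappa>_def by auto
  then have "D \<in> definable M_struct {} n"
    using definable_pcoord[of \<psi> UNIV \<kappa> n "\<lambda>_. 0" "{}"] unfolding D_def vz_def by simp
  have "sat field_struct (vz y) \<psi> \<longleftrightarrow> sat field_struct (v(0 := pcoord (y ! i0))) \<psi>"
    using k unfolding fv_\<psi>[symmetric] by (intro sat_cong) (auto simp: vz_def \<kappa>_def)
  moreover have "sat field_struct (v(0 := pcoord (y ! i0))) \<psi>"
    unfolding \<psi>_def using v(2,3) by (simp add: \<chi>(2) d_def)
  ultimately have "y \<in> D" using len by (simp add: D_def)
  then have "x \<in> D" using same[OF \<open>D \<in> definable M_struct {} n\<close>] by simp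
  then have "sat field_struct (vz x) \<phi>" "sat field_struct (vz x) \<chi>" unfolding D_def \<psi>_def by auto
  then have fin: "finite {z. sat field_struct ((vz x)(0 := z)) \<phi>}" unfolding \<chi>(2) by simp
  show ?thesis
  proof (rule aclI[OF _ _ fin])
    have "(vz x)(0 := pcoord (x ! i0)) = vz x" by (auto simp: vz_def \<kappa>_def fun_eq_iff)
    then show "sat field_struct ((vz x)(0 := pcoord (x ! i0))) \<phi>"
      using \<open>sat field_struct (vz x) \<phi>\<close> by simp
    show "vz x i \<in> (\<lambda>j. pcoord (x ! j)) ` J" if "i \<in> fv \<phi>" "i \<noteq> 0" for i
      using k[OF that] that by (simp add: vz_def \<kappa>_def)
  qed
qed

lemma generic3_mono: "generic3 L a b c \<Longrightarrow> K \<subseteq> L \<Longrightarrow> generic3 K a b c"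
  unfolding generic3_def
  using acl_mono[of K L] acl_mono[of "insert a K" "insert a L"]
    acl_mono[of "insert b (insert a K)" "insert b (insert a L)"] by blast

lemma generic3_nonzero:
  assumes "generic3 L a b c"
  shows "a \<noteq> 0" "b \<noteq> 0" "c \<noteq> 0"
  using assms cl_0 unfolding generic3_def by metis+

text \<open>Membership in the tangent bundle is definable, and an algebraic dependence in y would
  transfer back to the given vector.\<close>

lemma strong_type_generic:
  fixes a :: "'k::field_char_0"
  assumes g: "generic3 {} a b c"
    and tan: "[(a, u), (b, v), (c, r), (d, s)] \<in> tangent_bundle 4 quadric"
    and y: "y \<in> strong_type M_struct {} [inS (a, u), inS (b, v), inS (c, r), inS (d, s)]"
  obtains a' u' b' v' c' r' d' s' where "y = [inS (a', u'), inS (b', v'), inS (c', r'), inS (d', s')]"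
    "[(a', u'), (b', v'), (c', r'), (d', s')] \<in> tangent_bundle 4 quadric" "generic3 {} a' b' c'"
proof -
  define x where "x = [inS (a, u), inS (b, v), inS (c, r), inS (d, s)]"
  have len: "length x = 4" unfolding x_def by simp
  have same: "x \<in> D \<longleftrightarrow> y \<in> D" and len_y: "length y = 4" if "D \<in> definable M_struct {} 4" for D
    using strong_type_definable[OF y[folded x_def], unfolded len] that by auto
  define w :: "nat \<Rightarrow> 'k elem" where "w i = inP 0" for i
  define D where "D = {z. length z = 4 \<and> sat M_struct (asg z w) (Rel (Tan quadric) [0, 1, 2, 3])}"
  have D: "D \<in> definable M_struct {} 4" unfolding D_def by (intro definableI) auto
  have "x \<in> D" unfolding D_def x_def
    using tan M_struct_Tan_quadric[of "(a, u)" "(b, v)" "(c, r)" "(d, s)"] by (simp add: asg_def del: M_struct.simps)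
  then have "y \<in> D" using same[OF D] by simp
  have "length y = 4" by (rule len_y[OF D])
  then obtain y1 y2 y3 y4 where y4: "y = [y1, y2, y3, y4]"
    by (auto simp: numeral_eq_Suc length_Suc_conv)
  have Tan_y: "M_struct (Tan quadric) [y1, y2, y3, y4]"
    using \<open>y \<in> D\<close> unfolding D_def y4 by (simp add: asg_def del: M_struct.simps)
  then obtain ts :: "('k \<times> 'k) list" where "[y1, y2, y3, y4] = map inS ts"
    unfolding M_struct.simps by (elim exE conjE) (rule that)
  then obtain p1 p2 p3 p4 where p: "y1 = inS p1" "y2 = inS p2" "y3 = inS p3" "y4 = inS p4"
    by (auto simp: Cons_eq_map_conv)
  obtain a' u' b' v' c' r' d' s' where p': "p1 = (a', u')" "p2 = (b', v')" "p3 = (c', r')" "p4 = (d', s')"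
    by (cases p1, cases p2, cases p3, cases p4)
  have transfer: "pcoord (x ! i) \<in> cl ((\<lambda>j. pcoord (x ! j)) ` J)"
    if "i < 4" "J \<subseteq> {..<4}" "pcoord (y ! i) \<in> cl ((\<lambda>j. pcoord (y ! j)) ` J)" for i J
    using pcoord_cl_transfer[OF same len \<open>length y = 4\<close> that] .
  show thesis
  proof (rule that)
    show "y = [inS (a', u'), inS (b', v'), inS (c', r'), inS (d', s')]" using y4 p p' by simp
    show "[(a', u'), (b', v'), (c', r'), (d', s')] \<in> tangent_bundle 4 quadric"
      using Tan_y unfolding p p' M_struct_Tan_quadric .
    show "generic3 {} a' b' c'"
      using transfer[of 0 "{}"] transfer[of 1 "{0}"] transfer[of 2 "{1, 0}"] g
      unfolding generic3_def x_def y4 p p' by auto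
  qed
qed

lemma indep_generic3:
  fixes x :: "'k::{alg_closed_field, field_char_0} elem list"
  assumes sat: "saturated (field_struct :: (field_sym, 'k) struct)"
    and x: "indep M_struct {} x A" "inP ` T \<subseteq> dcl M_struct A"
    and g: "generic3 {} a b c" "{a, b, c} \<subseteq> pcoord ` set x"
  shows "generic3 T a b c"
  using indep_cl[OF sat x, of a "{}"] indep_cl[OF sat x, of b "{a}"] indep_cl[OF sat x, of c "{b, a}"] g
  unfolding generic3_def by (simp add: insert_commute Un_insert_right)

text \<open>Multiplying by b and using b d = 1 - a c removes d. What remains is linear in c, after
  that in b and finally in a, and each of these is transcendental over the coefficients.\<close>

lemma no_linear_relation:
  fixes a :: "'k::field"
  assumes g: "generic3 T a b c" and d: "a * c + b * d = 1"
    and w: "w1 \<in> cl T" "w2 \<in> cl T" "w3 \<in> cl T" "w4 \<in> cl T" "w5 \<in> cl T"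
    and eq: "w1 * c + w2 * d + w3 * a + w4 * b + w5 = 0"
  shows "w1 = 0 \<and> w2 = 0 \<and> w3 = 0 \<and> w4 = 0"
proof -
  note nz = generic3_nonzero[OF g]
  let ?T1 = "insert a T" and ?T2 = "insert b (insert a T)"
  have mem: "a \<in> cl ?T1" "a \<in> cl ?T2" "b \<in> cl ?T2"
    using acl_superset[of ?T1 field_struct] acl_superset[of ?T2 field_struct] by auto
  have w1: "x \<in> cl ?T1" if "x \<in> cl T" for x using that acl_mono[of T ?T1] by blast
  have w2: "x \<in> cl ?T2" if "x \<in> cl T" for x using that acl_mono[of T ?T2] by blast
  have solve: "x \<in> cl S" if "x * p + q = 0" "p \<noteq> 0" "p \<in> cl S" "q \<in> cl S" for x p q :: 'k and S
  proof -
    have "x = - q / p" using that(1,2) by (simp add: field_simps eq_neg_iff_add_eq_0)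
    then show ?thesis using that(3,4) by (simp add: cl_divide cl_minus)
  qed
  have "b * (w1 * c + w2 * d + w3 * a + w4 * b + w5) =
      c * (w1 * b - w2 * a) + (w2 * (a * c + b * d) + b * (w3 * a + w4 * b + w5))"
    by (simp add: algebra_simps)
  then have 1: "c * (w1 * b - w2 * a) + (w2 + b * (w3 * a + w4 * b + w5)) = 0" using eq d by simp
  have c0: "w1 * b - w2 * a = 0"
  proof (rule ccontr)
    assume "w1 * b - w2 * a \<noteq> 0"
    from solve[OF 1 this] have "c \<in> cl ?T2"
      using w w2 mem by (simp add: cl_diff cl_mult cl_add)
    then show False using g unfolding generic3_def by blast
  qed
  have "w1 = 0"
  proof (rule ccontr)
    assume "w1 \<noteq> 0"
    have "b * w1 + - (w2 * a) = 0" using c0 by (simp add: algebra_simps)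
    from solve[OF this \<open>w1 \<noteq> 0\<close>] have "b \<in> cl ?T1"
      using w w1 mem by (simp add: cl_minus cl_mult)
    then show False using g unfolding generic3_def by blast
  qed
  moreover from this c0 nz have "w2 = 0" by simp
  ultimately have "b * (w3 * a + w4 * b + w5) = 0" using 1 by simp
  then have "w3 * a + w4 * b + w5 = 0" using nz by simp
  then have 2: "b * w4 + (w3 * a + w5) = 0" by (simp add: algebra_simps)
  have "w4 = 0"
  proof (rule ccontr)
    assume "w4 \<noteq> 0"
    from solve[OF 2 this] have "b \<in> cl ?T1" using w w1 mem by (simp add: cl_add cl_mult)
    then show False using g unfolding generic3_def by blast
  qed
  then have 3: "a * w3 + w5 = 0" using 2 by (simp add: algebra_simps)
  have "w3 = 0"
  proof (rule ccontr)
    assume "w3 \<noteq> 0"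
    from solve[OF 3 this] have "a \<in> cl T" using w by simp
    then show False using g unfolding generic3_def by blast
  qed
  with \<open>w1 = 0\<close> \<open>w2 = 0\<close> \<open>w4 = 0\<close> show ?thesis by simp
qed

section \<open>The stabilizer and almost internality\<close>

lemma stabilizer_trivial:
  fixes a :: "'k::{alg_closed_field, field_char_0}"
  assumes sat: "saturated (field_struct :: (field_sym, 'k) struct)"
    and g: "generic3 {} a b c"
    and tan: "[(a, u), (b, v), (c, r), (d, s)] \<in> tangent_bundle 4 quadric"
    and G: "G \<in> Stab M_struct {} (S_power 4)
      (strong_type M_struct {} [inS (a, u), inS (b, v), inS (c, r), inS (d, s)])"
  shows "G = \<one>\<^bsub>S_power 4\<^esub>"
proof -
  let ?q = "strong_type M_struct {} [inS (a, u), inS (b, v), inS (c, r), inS (d, s)]"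
  obtain x where x: "x \<in> ?q" "indep M_struct {} x (set G)" "G \<otimes>\<^bsub>S_power 4\<^esub> x \<in> ?q"
    and carrier: "G \<in> carrier (S_power 4)" using G unfolding Stab_def by blast
  have "length G = 4" "set G \<subseteq> sort_S" using carrier unfolding S_power_def by auto
  then obtain p1 p2 p3 p4 where "G = [inS p1, inS p2, inS p3, inS p4]"
    by (auto simp: numeral_eq_Suc length_Suc_conv)
  then obtain \<alpha> u1 \<beta> u2 \<gamma> u3 \<delta> u4 where G4: "G = [inS (\<alpha>, u1), inS (\<beta>, u2), inS (\<gamma>, u3), inS (\<delta>, u4)]"
    by (metis surj_pair)
  obtain a' u' b' v' c' r' d' s' where x4: "x = [inS (a', u'), inS (b', v'), inS (c', r'), inS (d', s')]"
    and tan_x: "[(a', u'), (b', v'), (c', r'), (d', s')] \<in> tangent_bundle 4 quadric"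
    and gen_x: "generic3 {} a' b' c'"
    using strong_type_generic[OF g tan x(1)] by metis
  have Gx: "G \<otimes>\<^bsub>S_power 4\<^esub> x =
      [inS (\<alpha> + a', u1 + u'), inS (\<beta> + b', u2 + v'), inS (\<gamma> + c', u3 + r'), inS (\<delta> + d', u4 + s')]"
    unfolding G4 x4 S_power_def by simp
  obtain a2 w1 b2 w2 c2 w3 d2 w4 where y4: "G \<otimes>\<^bsub>S_power 4\<^esub> x = [inS (a2, w1), inS (b2, w2), inS (c2, w3), inS (d2, w4)]"
    and tan_y: "[(a2, w1), (b2, w2), (c2, w3), (d2, w4)] \<in> tangent_bundle 4 quadric"
    using strong_type_generic[OF g tan x(3)] by metis
  have tan_y: "[(\<alpha> + a', u1 + u'), (\<beta> + b', u2 + v'), (\<gamma> + c', u3 + r'), (\<delta> + d', u4 + s')]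
      \<in> tangent_bundle 4 quadric"
    using tan_y y4 unfolding Gx by simp
  note ex = tangent_quadric_imp[OF tan_x] and ey = tangent_quadric_imp[OF tan_y]
  define T where "T = {t. inP t \<in> dcl M_struct (set G)}"
  have gen: "generic3 T a' b' c'"
    by (rule indep_generic3[OF sat x(2) _ gen_x]) (auto simp: T_def x4)
  have T: "t \<in> cl T" if "t \<in> T" for t using that acl_superset[of T field_struct] by blast
  have "\<alpha> \<in> T" "\<beta> \<in> T" "\<gamma> \<in> T" "\<delta> \<in> T"
    unfolding T_def G4 by (auto intro: dcl_projection)
  note in_T = this[THEN T]
  have "\<alpha> * c' + \<beta> * d' + \<gamma> * a' + \<delta> * b' + (\<alpha> * \<gamma> + \<beta> * \<delta>) =
      ((\<alpha> + a') * (\<gamma> + c') + (\<beta> + b') * (\<delta> + d')) - (a' * c' + b' * d')"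
    by (simp add: algebra_simps)
  then have "\<alpha> * c' + \<beta> * d' + \<gamma> * a' + \<delta> * b' + (\<alpha> * \<gamma> + \<beta> * \<delta>) = 0" using ex(1) ey(1) by simp
  moreover have "\<alpha> * \<gamma> + \<beta> * \<delta> \<in> cl T" using in_T by (intro cl_add cl_mult)
  ultimately have zero: "\<alpha> = 0 \<and> \<beta> = 0 \<and> \<gamma> = 0 \<and> \<delta> = 0"
    by (intro no_linear_relation[OF gen ex(1) in_T])
  \<comment> \<open>Only now that the first coordinates are 0 are the second ones definable from
    G.\<close>
  then have "u1 \<in> T" "u2 \<in> T" "u3 \<in> T" "u4 \<in> T"
    unfolding T_def G4 by (auto intro: dcl_fibre_origin)
  note in_T = this[THEN T]
  have "u1 * c' + u2 * d' + u3 * a' + u4 * b' + 0 =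
      (c' * (u1 + u') + d' * (u2 + v') + a' * (u3 + r') + b' * (u4 + s')) -
      (c' * u' + d' * v' + a' * r' + b' * s')"
    by (simp add: algebra_simps)
  then have "u1 * c' + u2 * d' + u3 * a' + u4 * b' + 0 = 0" using ex(2) ey(2) zero by simp
  then have "u1 = 0 \<and> u2 = 0 \<and> u3 = 0 \<and> u4 = 0"
    by (rule no_linear_relation[OF gen ex(1) in_T cl_0])
  then show ?thesis using zero unfolding G4 S_power_def by (simp add: numeral_eq_Suc zero_prod_def)
qed

lemma not_almost_internal_P:
  fixes a :: "'k::{alg_closed_field, field_char_0}"
  assumes sat: "saturated (field_struct :: (field_sym, 'k) struct)"
    and g: "generic3 {} a b c"
    and tan: "[(a, u), (b, v), (c, r), (d, s)] \<in> tangent_bundle 4 quadric"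
  shows "\<not> almost_internal M_struct {} sort_P
    (strong_type M_struct {} [inS (a, u), inS (b, v), inS (c, r), inS (d, s)])"
proof
  assume "almost_internal M_struct {} sort_P
    (strong_type M_struct {} [inS (a, u), inS (b, v), inS (c, r), inS (d, s)])"
  then obtain B x f where x: "x \<in> strong_type M_struct {} [inS (a, u), inS (b, v), inS (c, r), inS (d, s)]"
      "indep M_struct {} x B" "set f \<subseteq> sort_P" "set x \<subseteq> acl M_struct ({} \<union> B \<union> set f)"
    unfolding almost_internal_def by blast
  obtain a' u' b' v' c' r' d' s' where x4: "x = [inS (a', u'), inS (b', v'), inS (c', r'), inS (d', s')]"
    and gen_x: "generic3 {} a' b' c'"
    using strong_type_generic[OF g tan x(1)] by metis
  define T where "T = {t. inP t \<in> dcl M_struct B}"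
  have "generic3 T a' b' c'"
    by (rule indep_generic3[OF sat x(2) _ gen_x]) (auto simp: T_def x4)
  then obtain D where D: "derivation D" "\<And>e. e \<in> cl T \<Longrightarrow> D e = 0" "D a' = 1"
    using generic3_derivation[of T a' b' c' 1 0 0] by metis
  have "inS (a', u') \<in> acl M_struct (B \<union> set f)" using x(4) unfolding x4 by simp
  then obtain Orb where Orb: "finite Orb" "\<And>h. automorphism M_struct h \<Longrightarrow>
      (\<And>e. e \<in> B \<union> set f \<Longrightarrow> h e = e) \<Longrightarrow> h (inS (a', u')) \<in> Orb"
    using acl_finite_orbit by metis
  \<comment> \<open>The multiple n D also vanishes on T, which contains the first coordinates of
    points of B. So its automorphism fixes P and B pointwise and translates the fibre over a' by
    n.\<close>
  have "inS (a', u' + of_nat n) \<in> Orb" for n :: nat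
  proof -
    let ?D = "\<lambda>x. of_nat n * D x"
    have "derivation ?D" using D(1) unfolding derivation_def by (simp add: algebra_simps)
    moreover have "?D e = 0" if "e \<in> cl {}" for e
      using that D(2) acl_mono[of "{}" T field_struct] by auto
    ultimately have "automorphism M_struct (aut_D ?D)" by (rule automorphism_aut_D[OF sat])
    moreover have "aut_D ?D e = e" if "e \<in> B \<union> set f" for e
    proof (cases e)
      case (inS p)
      then have "inS (fst p, snd p) \<in> B" using that x(3) by auto
      then have "fst p \<in> T" unfolding T_def using dcl_projection by blast
      then have "D (fst p) = 0" using D(2) acl_superset[of T field_struct] by blast
      then show ?thesis using inS by simp
    qed simp
    ultimately have "aut_D ?D (inS (a', u')) \<in> Orb" by (rule Orb(2))
    then show ?thesis using D(3) by simp
  qed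
  then have "range (\<lambda>n :: nat. inS (a', u' + of_nat n)) \<subseteq> Orb" by blast
  moreover have "inj (\<lambda>n :: nat. inS (a', u' + of_nat n))" by (simp add: inj_def)
  ultimately show False using Orb(1) by (meson finite_subset range_inj_infinite)
qed

text \<open>
  A translation-covering notion of largeness which, unlike genericity, is first-order in the
  parameters.
\<close>

definition large :: "('k::field \<Rightarrow> bool) \<Rightarrow> bool" where
  "large Z \<longleftrightarrow> (\<exists>h. \<forall>a. Z a \<or> Z (a + h))"

text \<open>
  Averaging over the subset sums of the translations \<open>h j\<close>: for each \<open>j\<close>, at least half of them
  lie in \<open>Z j\<close>.
\<close>

lemma large_common_point:
  assumes "finite J" "\<And>j. j \<in> J \<Longrightarrow> large (Z j)"
  obtains a where "card J \<le> 2 * card {j \<in> J. Z j a}"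
proof -
  obtain h where h: "\<And>j a. j \<in> J \<Longrightarrow> Z j a \<or> Z j (a + h j)"
    using assms(2) unfolding large_def by metis
  define p where "p E = sum h E" for E
  have J: "finite (Pow J)" using assms(1) by simp
  have half: "2 ^ card J \<le> 2 * card {E \<in> Pow J. Z j (p E)}" if j: "j \<in> J" for j
  proof -
    \<comment> \<open>The sums of E and of \<open>insert j E\<close> differ by h j, so one of them
      lies in \<open>Z j\<close>. Choosing one is injective on the subsets avoiding j.\<close>
    define F where "F E = (if Z j (p E) then E else insert j E)" for E
    have inj: "inj_on F (Pow (J - {j}))"
      unfolding inj_on_def F_def by (auto split: if_splits)
    have sub: "F ` Pow (J - {j}) \<subseteq> {E \<in> Pow J. Z j (p E)}"
    proof
      fix S assume "S \<in> F ` Pow (J - {j})"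
      then obtain E where E: "E \<subseteq> J - {j}" "S = F E" by blast
      have "finite E" using E(1) assms(1) by (meson finite_Diff finite_subset)
      then have "p (insert j E) = p E + h j" unfolding p_def using E(1) by (subst sum.insert) auto
      then show "S \<in> {E \<in> Pow J. Z j (p E)}"
        using h[OF j, of "p E"] E j unfolding F_def by (auto split: if_splits)
    qed
    have "card (Pow (J - {j})) \<le> card {E \<in> Pow J. Z j (p E)}"
      using J by (intro card_inj_on_le[OF inj sub]) simp
    moreover have "2 * card (Pow (J - {j})) = 2 ^ card J"
      using card.remove[OF assms(1) j] assms(1) by (simp add: card_Pow)
    ultimately show ?thesis by linarith
  qed
  have "\<exists>E\<in>Pow J. card J \<le> 2 * card {j \<in> J. Z j (p E)}"
  proof (rule ccontr)
    assume no: "\<not> (\<exists>E\<in>Pow J. card J \<le> 2 * card {j \<in> J. Z j (p E)})"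
    have less: "2 * card {j \<in> J. Z j (p E)} < card J" if "E \<in> Pow J" for E
      using no that by (meson not_le)
    \<comment> \<open>Double counting of the pairs of an index j and a subset E whose sum lies in
      \<open>Z j\<close>.\<close>
    have "card J * 2 ^ card J = (\<Sum>j\<in>J. 2 ^ card J)" by simp
    also have "\<dots> \<le> (\<Sum>j\<in>J. 2 * card {E \<in> Pow J. Z j (p E)})"
      using half by (intro sum_mono)
    also have "\<dots> = 2 * (\<Sum>j\<in>J. card {E \<in> Pow J. Z j (p E)})" by (simp add: sum_distrib_left)
    also have "(\<Sum>j\<in>J. card {E \<in> Pow J. Z j (p E)}) = (\<Sum>E\<in>Pow J. card {j \<in> J. Z j (p E)})"
      by (rule sum_multicount_gen[OF assms(1) J, symmetric, THEN sym]) simp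
    also have "2 * \<dots> = (\<Sum>E\<in>Pow J. 2 * card {j \<in> J. Z j (p E)})" by (simp add: sum_distrib_left)
    also have "\<dots> < (\<Sum>E\<in>Pow J. card J)"
      using less J by (intro sum_strict_mono) auto
    also have "\<dots> = card J * 2 ^ card J" by (simp add: card_Pow assms(1))
    finally show False by simp
  qed
  then show thesis using that by blast
qed

text \<open>For h outside \<open>cl L\<close>, the elements a and a + h cannot both lie in
  \<open>cl L\<close>.\<close>

lemma large_generic:
  fixes Z :: "'k::field_char_0 \<Rightarrow> bool"
  assumes "saturated (field_struct :: (field_sym, 'k) struct)" "finite L"
    and "\<And>a. a \<notin> cl L \<Longrightarrow> Z a"
  shows "large Z"
proof -
  obtain h where "h \<notin> cl L" using exists_not_cl[OF assms(1,2)] by metis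
  then have "a \<notin> cl L \<or> a + h \<notin> cl L" for a using cl_diff[of "a + h" L a] by auto
  then show ?thesis unfolding large_def using assms(3) by blast
qed

lemma large_formula:
  fixes \<theta> :: "'k::field_char_0 M_sym fm"
  shows "\<exists>\<eta>. fv \<eta> \<subseteq> fv \<theta> - {A} \<and>
    (\<forall>u. sat M_struct u \<eta> \<longleftrightarrow> large (\<lambda>a. sat M_struct (u(A := inP a)) \<theta>))"
proof -
  obtain H where H: "\<And>i. i \<in> fv \<theta> \<Longrightarrow> i < H" "A < H" using fresh_variable[of \<theta> A] by metis
  define T where "T = Suc H"
  \<comment> \<open>For some h and every t, some value of A among t and t + h satisfies \<theta>.
    Quantifying over A avoids substituting the sum into \<theta>.\<close>
  define \<eta> where "\<eta> = fm.Ex H (Conj (Rel SortP [H]) (Forall T (Disj (Neg (Rel SortP [T]))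
    (fm.Ex A (Conj (Disj (Conj (Rel SortP [A]) (Eq A T)) (Rel (Field Add) [T, H, A])) \<theta>)))))"
  have "fv \<eta> \<subseteq> fv \<theta> - {A}" unfolding \<eta>_def using H by (auto simp: T_def)
  moreover have "sat M_struct u \<eta> \<longleftrightarrow> large (\<lambda>a. sat M_struct (u(A := inP a)) \<theta>)" for u
  proof -
    have irrel: "sat M_struct (u(H := e, T := e', A := e'')) \<theta> \<longleftrightarrow> sat M_struct (u(A := e'')) \<theta>" for e e' e''
      using H by (intro sat_cong) (force simp: T_def)
    have add: "M_struct (Field Add) [inP t, inP h, e] \<longleftrightarrow> e = inP (t + h)" for t h :: 'k and e
      by (auto simp: Cons_eq_map_conv)
    have sortP: "M_struct SortP [y] \<longleftrightarrow> (\<exists>a. y = inP a)" for y :: "'k elem" by simp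
    have "H \<noteq> A" "T \<noteq> A" "H \<noteq> T" using H(2) unfolding T_def by auto
    then have "sat M_struct u \<eta> \<longleftrightarrow> (\<exists>y. M_struct SortP [y] \<and> (\<forall>y'. M_struct SortP [y'] \<longrightarrow>
        (\<exists>e. (M_struct SortP [e] \<and> e = y' \<or> M_struct (Field Add) [y', y, e]) \<and>
          sat M_struct (u(A := e)) \<theta>)))"
      unfolding \<eta>_def sat.simps irrel by (simp del: M_struct.simps)
    also have "\<dots> \<longleftrightarrow> (\<exists>h. \<forall>t. \<exists>e. (e = inP t \<or> M_struct (Field Add) [inP t, inP h, e]) \<and>
        sat M_struct (u(A := e)) \<theta>)"
      unfolding sortP by blast
    finally show ?thesis unfolding add large_def by blast
  qed
  ultimately show ?thesis by blast
qed

section \<open>Nonforking over the origin\<close>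

text \<open>The instance of D at \<beta> contains all tangent vectors of the quadric over first
  coordinates a, b, c. With b and c nonzero such vectors exist, so the condition is not
  vacuous.\<close>

definition covers :: "'k::field_char_0 elem list set \<Rightarrow> 'k elem list \<Rightarrow> 'k \<Rightarrow> 'k \<Rightarrow> 'k \<Rightarrow> bool" where
  "covers D \<beta> a b c \<longleftrightarrow> b \<noteq> 0 \<and> c \<noteq> 0 \<and> (\<forall>u v r p.
     M_struct (Tan quadric) [inS (a, u), inS (b, v), inS (c, r), p] \<longrightarrow>
     [inS (a, u), inS (b, v), inS (c, r), p] @ \<beta> \<in> D)"

text \<open>This makes largeness of an instance a property of the type of its parameters, so that it
  passes to all members of a dividing sequence.\<close>

lemma large_covers_definable:
  assumes "D \<in> definable (M_struct :: ('k::field_char_0 M_sym, 'k elem) struct) {} (4 + m)"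
  shows "{\<beta>. length \<beta> = m \<and> large (\<lambda>a. large (\<lambda>b. large (\<lambda>c. covers D \<beta> a b c)))}
    \<in> definable M_struct {} m"
proof -
  obtain \<phi> v where v: "\<And>i. i \<in> fv \<phi> \<Longrightarrow> 4 + m \<le> i \<Longrightarrow> v i \<in> {}"
      and D: "D = {xs. length xs = 4 + m \<and> sat M_struct (asg xs v) \<phi>}"
    by (rule definableE[OF assms]) (rule that)
  have fv: "i < 4 + m" if "i \<in> fv \<phi>" for i using v[OF that] by force
  \<comment> \<open>Variables below m carry \<beta>, those from m to m + 3 the tangent vector, and m
    + 4 to m + 6 the first coordinates a, b, c; f moves the variables of \<phi> accordingly.\<close>
  define f where "f i = (if i < 4 then m + i else if i < 4 + m then i - 4 else i)" for i
  have f: "inj f" unfolding inj_def f_def by auto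
  define \<chi> where "\<chi> = Conj (Rel (Tan quadric) [m, m + 1, m + 2, m + 3]) (Conj (Rel Proj [m, m + 4])
    (Conj (Rel Proj [m + 1, m + 5]) (Conj (Rel Proj [m + 2, m + 6]) (Neg (rename f \<phi>)))))"
  define \<theta> where "\<theta> = Conj (Neg (Rel (Field Zero) [m + 5])) (Conj (Neg (Rel (Field Zero) [m + 6]))
    (Neg (fm.Ex m (fm.Ex (m + 1) (fm.Ex (m + 2) (fm.Ex (m + 3) \<chi>))))))"
  have "f ` fv \<phi> \<subseteq> {..<m + 4}" using fv unfolding f_def by force
  then have fv_\<theta>: "fv \<theta> \<subseteq> {..<m} \<union> {m + 4, m + 5, m + 6}"
    unfolding \<theta>_def \<chi>_def fv.simps fv_rename[OF f] by auto
  have sat_\<theta>: "sat M_struct (u(m + 4 := inP a, m + 5 := inP b, m + 6 := inP c)) \<theta> \<longleftrightarrow> covers D \<beta> a b c"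
    if u: "length \<beta> = m" "\<And>i. i < m \<Longrightarrow> u i = \<beta> ! i" for u \<beta> and a b c :: 'k
  proof -
    let ?u = "u(m + 4 := inP a, m + 5 := inP b, m + 6 := inP c)"
    have \<phi>: "sat M_struct (?u(m := y1, m + 1 := y2, m + 2 := y3, m + 3 := y4)) (rename f \<phi>) \<longleftrightarrow>
        [y1, y2, y3, y4] @ \<beta> \<in> D" for y1 y2 y3 y4
    proof -
      have "sat M_struct ((?u(m := y1, m + 1 := y2, m + 2 := y3, m + 3 := y4)) \<circ> f) \<phi> \<longleftrightarrow>
          sat M_struct (asg ([y1, y2, y3, y4] @ \<beta>) v) \<phi>"
      proof (rule sat_cong)
        fix i assume "i \<in> fv \<phi>"
        then have "i < 4 + m" by (rule fv)
        then have "i = 0 \<or> i = 1 \<or> i = 2 \<or> i = 3 \<or> i = 4 + (i - 4) \<and> i - 4 < m" by linarith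
        then consider "i = 0" | "i = 1" | "i = 2" | "i = 3" | j where "i = 4 + j" "j < m" by blast
        then show "((?u(m := y1, m + 1 := y2, m + 2 := y3, m + 3 := y4)) \<circ> f) i =
            asg ([y1, y2, y3, y4] @ \<beta>) v i"
          by cases (simp_all add: f_def asg_def u nth_append)
      qed
      then show ?thesis unfolding sat_rename[OF f] D by (simp add: u(1))
    qed
    have proj: "M_struct Proj [y, inP x] \<longleftrightarrow> (\<exists>u. y = inS (x, u))" for y and x :: 'k by auto
    have zero: "M_struct (Field Zero) [inP x] \<longleftrightarrow> x = 0" for x :: 'k
      by (auto simp: Cons_eq_map_conv)
    have "sat M_struct ?u \<theta> \<longleftrightarrow> b \<noteq> 0 \<and> c \<noteq> 0 \<and> \<not> (\<exists>y1 y2 y3 y4.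
        M_struct (Tan quadric) [y1, y2, y3, y4] \<and> M_struct Proj [y1, inP a] \<and>
        M_struct Proj [y2, inP b] \<and> M_struct Proj [y3, inP c] \<and> [y1, y2, y3, y4] @ \<beta> \<notin> D)"
      unfolding \<theta>_def \<chi>_def sat.simps \<phi> by (simp add: zero del: M_struct.simps)
    also have "\<dots> \<longleftrightarrow> covers D \<beta> a b c" unfolding covers_def proj by blast
    finally show ?thesis .
  qed
  obtain \<eta>1 where \<eta>1: "fv \<eta>1 \<subseteq> fv \<theta> - {m + 6}"
    "\<And>u. sat M_struct u \<eta>1 \<longleftrightarrow> large (\<lambda>c. sat M_struct (u(m + 6 := inP c)) \<theta>)"
    using large_formula[of \<theta> "m + 6"] by blast
  obtain \<eta>2 where \<eta>2: "fv \<eta>2 \<subseteq> fv \<eta>1 - {m + 5}"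
    "\<And>u. sat M_struct u \<eta>2 \<longleftrightarrow> large (\<lambda>b. sat M_struct (u(m + 5 := inP b)) \<eta>1)"
    using large_formula[of \<eta>1 "m + 5"] by blast
  obtain \<eta>3 where \<eta>3: "fv \<eta>3 \<subseteq> fv \<eta>2 - {m + 4}"
    "\<And>u. sat M_struct u \<eta>3 \<longleftrightarrow> large (\<lambda>a. sat M_struct (u(m + 4 := inP a)) \<eta>2)"
    using large_formula[of \<eta>2 "m + 4"] by blast
  have "fv \<eta>3 \<subseteq> {..<m}" using \<eta>1(1) \<eta>2(1) \<eta>3(1) fv_\<theta> by auto
  then have "{\<beta>. length \<beta> = m \<and> sat M_struct (asg \<beta> v) \<eta>3} \<in> definable M_struct {} m"
    by (intro definableI) auto
  moreover have "sat M_struct (asg \<beta> v) \<eta>3 \<longleftrightarrow> large (\<lambda>a. large (\<lambda>b. large (\<lambda>c. covers D \<beta> a b c)))"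
    if "length \<beta> = m" for \<beta>
  proof -
    have "sat M_struct ((asg \<beta> v)(m + 4 := inP a, m + 5 := inP b, m + 6 := inP c)) \<theta> \<longleftrightarrow>
        covers D \<beta> a b c" for a b c
      using that by (intro sat_\<theta>) (simp_all add: asg_def)
    then show ?thesis unfolding \<eta>3(2) \<eta>2(2) \<eta>1(2) by simp
  qed
  ultimately show ?thesis by (simp cong: conj_cong)
qed

text \<open>The equation of the quadric is linear in w and the tangent equation is linear in s, both
  with the nonzero coefficient y.\<close>

lemma tangent_quadric_fourth:
  fixes x :: "'k::field_char_0"
  assumes "[p1, p2, p3, p4] \<in> tangent_bundle 4 quadric" "[p1, p2, p3, p4'] \<in> tangent_bundle 4 quadric"
    and "fst p2 \<noteq> (0 :: 'k::field_char_0)"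
  shows "p4 = p4'"
proof -
  obtain x u y v z r w s w' s' where p: "p1 = (x, u)" "p2 = (y, v)" "p3 = (z, r)" "p4 = (w, s)" "p4' = (w', s')"
    by (cases p1, cases p2, cases p3, cases p4, cases p4')
  note e = tangent_quadric_imp[OF assms(1)[unfolded p]] tangent_quadric_imp[OF assms(2)[unfolded p]]
  have "y * w = y * w'" using e(1,3) by (metis add_left_cancel)
  then have "w = w'" using assms(3) p by simp
  then have "y * s = y * s'" using e(2,4) by (metis add_left_cancel)
  then show ?thesis using \<open>w = w'\<close> assms(3) p by simp
qed

lemma covers_large_if_generic:
  fixes L :: "'k::{alg_closed_field, field_char_0} set"
  assumes sat: "saturated (field_struct :: (field_sym, 'k) struct)" and L: "finite L"
    and "\<And>a b c. generic3 L a b c \<Longrightarrow> covers D \<beta> a b c"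
  shows "large (\<lambda>a. large (\<lambda>b. large (\<lambda>c. covers D \<beta> a b c)))"
proof (rule large_generic[OF sat L])
  fix a assume a: "a \<notin> cl L"
  show "large (\<lambda>b. large (\<lambda>c. covers D \<beta> a b c))"
  proof (rule large_generic[OF sat])
    show "finite (insert a L)" using L by simp
    fix b assume b: "b \<notin> cl (insert a L)"
    show "large (\<lambda>c. covers D \<beta> a b c)"
    proof (rule large_generic[OF sat])
      show "finite (insert b (insert a L))" using L by simp
      fix c assume "c \<notin> cl (insert b (insert a L))"
      with a b show "covers D \<beta> a b c" by (intro assms(3)) (simp add: generic3_def)
    qed
  qed
qed

text \<open>\<open>large_common_point\<close> keeps at least half of the indices for each of a, b
  and c, so of 8 * k instances at least k cover a common triple. The vector over it with second
  coordinates 0 lies in all of these.\<close>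

lemma not_inconsistent_if_large:
  fixes \<beta> :: "nat \<Rightarrow> 'k::field_char_0 elem list"
  assumes large: "\<And>j. large (\<lambda>a. large (\<lambda>b. large (\<lambda>c. covers D (\<beta> j) a b c)))"
  shows "\<exists>J. finite J \<and> card J = k \<and> (\<Inter>j\<in>J. fibre D 4 (\<beta> j)) \<noteq> {}"
proof -
  obtain a where "card {..<8 * k} \<le>
      2 * card {j \<in> {..<8 * k}. large (\<lambda>b. large (\<lambda>c. covers D (\<beta> j) a b c))}"
    using large_common_point[of "{..<8 * k}" "\<lambda>j a. large (\<lambda>b. large (\<lambda>c. covers D (\<beta> j) a b c))"] large
    by blast
  then obtain J1 where J1: "finite J1" "4 * k \<le> card J1"
      "\<And>j. j \<in> J1 \<Longrightarrow> large (\<lambda>b. large (\<lambda>c. covers D (\<beta> j) a b c))"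
    by (intro that[of "{j \<in> {..<8 * k}. large (\<lambda>b. large (\<lambda>c. covers D (\<beta> j) a b c))}"]) auto
  obtain b where "card J1 \<le> 2 * card {j \<in> J1. large (\<lambda>c. covers D (\<beta> j) a b c)}"
    using large_common_point[of J1 "\<lambda>j b. large (\<lambda>c. covers D (\<beta> j) a b c)"] J1 by blast
  then obtain J2 where J2: "finite J2" "2 * k \<le> card J2"
      "\<And>j. j \<in> J2 \<Longrightarrow> large (\<lambda>c. covers D (\<beta> j) a b c)"
    using J1(1,2) by (intro that[of "{j \<in> J1. large (\<lambda>c. covers D (\<beta> j) a b c)}"]) auto
  obtain c where "card J2 \<le> 2 * card {j \<in> J2. covers D (\<beta> j) a b c}"
    using large_common_point[of J2 "\<lambda>j c. covers D (\<beta> j) a b c"] J2 by blast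
  then have "k \<le> card {j \<in> J2. covers D (\<beta> j) a b c}" using J2(2) by linarith
  then obtain J where J: "J \<subseteq> {j \<in> J2. covers D (\<beta> j) a b c}" "card J = k" "finite J"
    by (rule obtain_subset_with_card_n)
  define x where "x = [inS (a, 0), inS (b, 0), inS (c, 0), inS ((1 - a * c) / b, 0)]"
  have "x \<in> fibre D 4 (\<beta> j)" if "j \<in> J" for j
  proof -
    have cov: "covers D (\<beta> j) a b c" using J(1) that by blast
    then have "b \<noteq> 0" "c \<noteq> 0" unfolding covers_def by auto
    then have "M_struct (Tan quadric) x"
      unfolding x_def M_struct_Tan_quadric by (intro tangent_quadricI) simp_all
    then show ?thesis using cov unfolding covers_def fibre_def x_def by (simp del: M_struct.simps)
  qed
  then have "x \<in> (\<Inter>j\<in>J. fibre D 4 (\<beta> j))" by blast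
  then show ?thesis using J(2,3) by blast
qed

text \<open>Includes second coordinates, unlike \<open>pcoord\<close>: the conjugating automorphisms
  fix an element of S when both of its coordinates lie in \<open>cl L\<close>.\<close>

definition coords :: "'k elem \<Rightarrow> 'k set" where
  "coords e = (case e of inP a \<Rightarrow> {a} | inS p \<Rightarrow> {fst p, snd p})"

lemma indep_origin:
  fixes a :: "'k::{alg_closed_field, field_char_0}"
  assumes sat: "saturated (field_struct :: (field_sym, 'k) struct)"
    and g: "generic3 {} a b c"
    and tan: "[(a, u), (b, v), (c, r), (d, s)] \<in> tangent_bundle 4 quadric"
  shows "indep M_struct {} [inS (a, u), inS (b, v), inS (c, r), inS (d, s)] {inS (0, 0)}"
  unfolding indep_def
proof (intro ballI impI)
  let ?x = "[inS (a, u), inS (b, v), inS (c, r), inS (d, s)]"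
  fix X assume X: "X \<in> definable M_struct ({} \<union> {inS (0, 0)}) (length ?x)" "?x \<in> X"
  have len: "length ?x = 4" by simp
  \<comment> \<open>Any two tangent vectors with first coordinates generic over L are conjugate over
    L: the first three points can be moved freely, and they determine the fourth.\<close>
  have move: "\<exists>h. automorphism M_struct h \<and> map h [inS (a1, u1), inS (b1, v1), inS (c1, r1), inS q1] =
      [inS (a2, u2), inS (b2, v2), inS (c2, r2), inS q2] \<and> (\<forall>e. coords e \<subseteq> cl L \<longrightarrow> h e = e)"
    if L: "finite L" and g: "generic3 L a1 b1 c1" "generic3 L a2 b2 c2"
      and tan: "[(a1, u1), (b1, v1), (c1, r1), q1] \<in> tangent_bundle 4 quadric"
        "[(a2, u2), (b2, v2), (c2, r2), q2] \<in> tangent_bundle 4 quadric"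
    for L and a1 u1 b1 v1 c1 r1 a2 u2 b2 v2 c2 r2 :: 'k and q1 q2
  proof -
    obtain h where h: "automorphism M_struct h" "\<And>e. e \<in> cl L \<Longrightarrow> h (inP e) = inP e"
      "\<And>e e'. e \<in> cl L \<Longrightarrow> e' \<in> cl L \<Longrightarrow> h (inS (e, e')) = inS (e, e')"
      "h (inS (a1, u1)) = inS (a2, u2)" "h (inS (b1, v1)) = inS (b2, v2)" "h (inS (c1, r1)) = inS (c2, r2)"
      using generic3_automorphism[OF sat L g, of u1 u2 v1 v2 r1 r2] by metis
    have fix_L: "h e = e" if "coords e \<subseteq> cl L" for e
    proof (cases e)
      case (inS p)
      then have "fst p \<in> cl L" "snd p \<in> cl L" using that by (auto simp: coords_def)
      then show ?thesis using h(3)[of "fst p" "snd p"] inS by simp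
    qed (use h(2) that in \<open>auto simp: coords_def\<close>)
    have "M_struct SortS [h (inS q1)] \<longleftrightarrow> M_struct SortS [inS q1]"
      using h(1) unfolding automorphism_def by (metis list.map)
    then obtain q where q: "h (inS q1) = inS q" by auto
    have "M_struct (Tan quadric) (map h [inS (a1, u1), inS (b1, v1), inS (c1, r1), inS q1])"
      using h(1) tan(1) unfolding automorphism_def M_struct_Tan_quadric[symmetric] by blast
    then have "[(a2, u2), (b2, v2), (c2, r2), q] \<in> tangent_bundle 4 quadric"
      unfolding list.map h(4-6) q M_struct_Tan_quadric .
    then have "q = q2" using tangent_quadric_fourth[OF _ tan(2)] generic3_nonzero(2)[OF g(2)] by simp
    then show ?thesis using h(1,4-6) q fix_L by (intro exI[of _ h]) simp
  qed
  show "\<not> forks M_struct {} (length ?x) X"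
    unfolding len
  proof
    assume "forks M_struct {} 4 X"
    then obtain F where F: "finite F" "\<And>Y. Y \<in> F \<Longrightarrow> divides M_struct {} 4 Y" "X \<subseteq> \<Union>F"
      unfolding forks_def by blast
    have "\<forall>Y\<in>F. \<exists>\<beta>0. \<exists>D \<in> definable M_struct {} (4 + length \<beta>0). Y = fibre D 4 \<beta>0 \<and>
        (\<exists>(k::nat) \<beta>. (\<forall>i :: nat. same_type M_struct {} \<beta>0 (\<beta> i)) \<and>
           (\<forall>J. finite J \<and> card J = k \<longrightarrow> (\<Inter>j\<in>J. fibre D 4 (\<beta> j)) = {}))"
    proof
      fix Y assume "Y \<in> F"
      from F(2)[OF this, unfolded divides_def]
      obtain m b D where "D \<in> definable M_struct {} (4 + m)" "length b = m" "Y = fibre D 4 b"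
        "\<exists>(k::nat) \<beta>. (\<forall>i :: nat. same_type M_struct {} b (\<beta> i)) \<and>
           (\<forall>J. finite J \<and> card J = k \<longrightarrow> (\<Inter>j\<in>J. fibre D 4 (\<beta> j)) = {})"
        by (elim exE bexE conjE) (rule that; blast)
      then show "\<exists>\<beta>0. \<exists>D \<in> definable M_struct {} (4 + length \<beta>0). Y = fibre D 4 \<beta>0 \<and>
        (\<exists>(k::nat) \<beta>. (\<forall>i :: nat. same_type M_struct {} \<beta>0 (\<beta> i)) \<and>
           (\<forall>J. finite J \<and> card J = k \<longrightarrow> (\<Inter>j\<in>J. fibre D 4 (\<beta> j)) = {}))"
        by (intro exI[of _ b] bexI[of _ D] conjI) simp_all
    qed
    from bchoice[OF this] obtain \<beta>0 where \<beta>0: "\<forall>Y\<in>F. \<exists>D \<in> definable M_struct {} (4 + length (\<beta>0 Y)).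
        Y = fibre D 4 (\<beta>0 Y) \<and>
        (\<exists>(k::nat) \<beta>. (\<forall>i :: nat. same_type M_struct {} (\<beta>0 Y) (\<beta> i)) \<and>
           (\<forall>J. finite J \<and> card J = k \<longrightarrow> (\<Inter>j\<in>J. fibre D 4 (\<beta> j)) = {}))"
      by (elim exE)
    \<comment> \<open>A tangent vector x' generic over the parameters of all members of F still lies
      in X, hence in some Y of F. Conjugacy over L then puts every tangent vector generic over L
      into this Y.\<close>
    define L where "L = (\<Union>Y\<in>F. \<Union>e\<in>set (\<beta>0 Y). coords e)"
    have L: "finite L" unfolding L_def using F(1) by (auto simp: coords_def split: elem.split)
    obtain a' where a': "a' \<notin> cl L" using exists_not_cl[OF sat L] by metis
    obtain b' where b': "b' \<notin> cl (insert a' L)" using exists_not_cl[OF sat, of "insert a' L"] L by auto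
    obtain c' where "c' \<notin> cl (insert b' (insert a' L))"
      using exists_not_cl[OF sat, of "insert b' (insert a' L)"] L by auto
    with a' b' have g': "generic3 L a' b' c'" unfolding generic3_def by simp
    define x' where "x' = [inS (a', 0), inS (b', 0), inS (c', 0), inS ((1 - a' * c') / b', 0)]"
    have tan': "[(a', 0), (b', 0), (c', 0), ((1 - a' * c') / b', 0)] \<in> tangent_bundle 4 quadric"
      using generic3_nonzero[OF g'] by (intro tangent_quadricI) simp_all
    obtain h where h: "automorphism M_struct h" "map h ?x = x'" "\<forall>e. coords e \<subseteq> cl {} \<longrightarrow> h e = e"
      using move[OF finite.emptyI g generic3_mono[OF g' empty_subsetI] tan tan', folded x'_def]
      by (elim exE conjE) (rule that)
    \<comment> \<open>X is defined over the origin, which h fixes, so X also contains x'.\<close>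
    have "h (inS (0, 0)) = inS (0, 0)" using h(3) by (simp add: coords_def cl_0)
    then have "map h ?x \<in> X" using definable_automorphism[OF X(1) h(1), of ?x] X(2) by auto
    then obtain Y where Y: "Y \<in> F" "x' \<in> Y" using F(3) h(2) by blast
    obtain D k \<beta> where D: "D \<in> definable M_struct {} (4 + length (\<beta>0 Y))" "Y = fibre D 4 (\<beta>0 Y)"
      and \<beta>: "\<And>i :: nat. same_type M_struct {} (\<beta>0 Y) (\<beta> i)"
      and k: "\<And>J. finite J \<and> card J = k \<Longrightarrow> (\<Inter>j\<in>J. fibre D 4 (\<beta> j)) = {}"
      using \<beta>0[rule_format, OF Y(1)] by blast
    have "covers D (\<beta>0 Y) a2 b2 c2" if g2: "generic3 L a2 b2 c2" for a2 b2 c2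
      unfolding covers_def
    proof (intro conjI allI impI)
      show "b2 \<noteq> 0" "c2 \<noteq> 0" using generic3_nonzero[OF g2] by auto
      fix u2 v2 r2 p assume T: "M_struct (Tan quadric) [inS (a2, u2), inS (b2, v2), inS (c2, r2), p]"
      then obtain q where q: "p = inS q" by (auto simp: Cons_eq_map_conv)
      have "[(a2, u2), (b2, v2), (c2, r2), q] \<in> tangent_bundle 4 quadric"
        using T unfolding q M_struct_Tan_quadric .
      from move[OF L g' g2 tan' this, folded x'_def q] obtain h where h: "automorphism M_struct h"
        "map h x' = [inS (a2, u2), inS (b2, v2), inS (c2, r2), p]" "\<forall>e. coords e \<subseteq> cl L \<longrightarrow> h e = e"
        by (elim exE conjE) (rule that)
      have "coords e \<subseteq> cl L" if "e \<in> set (\<beta>0 Y)" for e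
        using that Y(1) acl_superset[of L field_struct] unfolding L_def by blast
      then have "map h (\<beta>0 Y) = \<beta>0 Y" using h(3) by (simp add: map_idI)
      moreover have "x' \<in> fibre D 4 (\<beta>0 Y)" using Y(2) by (subst D(2)[symmetric])
      then have "x' @ \<beta>0 Y \<in> D" unfolding fibre_def by blast
      then have "map h (x' @ \<beta>0 Y) \<in> D" using definable_automorphism[OF D(1) h(1)] by blast
      ultimately show "[inS (a2, u2), inS (b2, v2), inS (c2, r2), p] @ \<beta>0 Y \<in> D"
        using h(2) by simp
    qed
    then have large0: "large (\<lambda>a. large (\<lambda>b. large (\<lambda>c. covers D (\<beta>0 Y) a b c)))"
      by (rule covers_large_if_generic[OF sat L])
    \<comment> \<open>A set definable without parameters that contains \<beta>0 Y also contains
      every \<beta> j, and large instances cannot be k-inconsistent.\<close>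
    define \<Theta> where "\<Theta> = {\<beta>. length \<beta> = length (\<beta>0 Y) \<and>
      large (\<lambda>a. large (\<lambda>b. large (\<lambda>c. covers D \<beta> a b c)))}"
    have "\<Theta> \<in> definable M_struct {} (length (\<beta>0 Y))"
      unfolding \<Theta>_def by (rule large_covers_definable[OF D(1)])
    moreover have "\<beta>0 Y \<in> \<Theta>" using large0 unfolding \<Theta>_def by simp
    ultimately have "\<beta> j \<in> \<Theta>" for j using \<beta>[of j] unfolding same_type_def by blast
    then have "large (\<lambda>a. large (\<lambda>b. large (\<lambda>c. covers D (\<beta> j) a b c)))" for j
      unfolding \<Theta>_def by simp
    from not_inconsistent_if_large[of D \<beta> k, OF this] obtain J where
      "finite J" "card J = k" "(\<Inter>j\<in>J. fibre D 4 (\<beta> j)) \<noteq> {}" by (elim exE conjE) (rule that)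
    then show False using k[of J] by simp
  qed
qed

theorem theorem3p7:
  fixes a b c d u v r s :: "'k :: {alg_closed_field, field_char_0}"
    and q :: "'k elem list set"
  assumes "saturated (field_struct :: (field_sym, 'k) struct)"
    and "generic_P a" and "generic_P b" and "generic_P c"
    and "independent_family M_struct {} [inP a, inP b, inP c]"
    and "d = (1 - a * c) / b"
    and "c * u + d * v + a * r + b * s = 0"
    and "q = strong_type M_struct {} [inS (a, u), inS (b, v), inS (c, r), inS (d, s)]"
  shows "M_struct (Tan {[x, y, z, w] | x y z w. x * z + y * w = 1})
             [inS (a, u), inS (b, v), inS (c, r), inS (d, s)]
         \<and> Stab M_struct {} (S_power 4) q = {\<one>\<^bsub>S_power 4\<^esub>}
         \<and> \<not> almost_internal M_struct {} sort_P q"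
proof -
  note sat = assms(1)
  have gen: "a \<notin> cl {}" "b \<notin> cl {}" "c \<notin> cl {}" using assms(2-4) generic_P_not_cl by blast+
  have ind: "indep M_struct {} [inP b] {inP a, inP c}" "indep M_struct {} [inP c] {inP a, inP b}"
  proof -
    have *: "indep M_struct {} [[inP a, inP b, inP c] ! i]
        {[inP a, inP b, inP c] ! j | j. j < 3 \<and> j \<noteq> i}" if "i < 3" for i
      using assms(5) that unfolding independent_family_def by (simp add: numeral_eq_Suc)
    have "{[inP a, inP b, inP c] ! j | j. j < 3 \<and> j \<noteq> 1} = {inP a, inP c}"
      "{[inP a, inP b, inP c] ! j | j. j < 3 \<and> j \<noteq> 2} = {inP a, inP b}"
      by (auto simp: numeral_eq_Suc less_Suc_eq; force)+
    with *[of 1] *[of 2] show "indep M_struct {} [inP b] {inP a, inP c}"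
      "indep M_struct {} [inP c] {inP a, inP b}" by (simp_all add: numeral_eq_Suc)
  qed
  have "b \<notin> cl ({a} \<union> {})"
    by (rule indep_cl[OF sat ind(1)], rule order.trans[OF _ dcl_superset]) (use gen in auto)
  moreover have "c \<notin> cl ({b, a} \<union> {})"
    by (rule indep_cl[OF sat ind(2)], rule order.trans[OF _ dcl_superset]) (use gen in auto)
  ultimately have g: "generic3 {} a b c" using gen unfolding generic3_def by simp
  have tan: "[(a, u), (b, v), (c, r), (d, s)] \<in> tangent_bundle 4 quadric"
    using assms(6,7) generic3_nonzero[OF g] by (intro tangent_quadricI) simp_all
  let ?x = "[inS (a, u), inS (b, v), inS (c, r), inS (d, s)]"
  have one: "\<one>\<^bsub>S_power 4\<^esub> = [inS (0, 0), inS (0, 0), inS (0, 0), inS (0 :: 'k, 0 :: 'k)]"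
    unfolding S_power_def by (simp add: numeral_eq_Suc zero_prod_def)
  have "\<one>\<^bsub>S_power 4\<^esub> \<in> Stab M_struct {} (S_power 4) q"
    unfolding Stab_def
  proof (intro CollectI conjI bexI[of _ ?x])
    show "\<one>\<^bsub>S_power 4\<^esub> \<in> carrier (S_power 4)" unfolding one S_power_def by simp
    show "?x \<in> carrier (S_power 4)" unfolding S_power_def by simp
    show "?x \<in> q" unfolding assms(8) by (rule strong_type_refl)
    then show "\<one>\<^bsub>S_power 4\<^esub> \<otimes>\<^bsub>S_power 4\<^esub> ?x \<in> q" unfolding one by (simp add: S_power_def)
    show "indep M_struct {} ?x (set \<one>\<^bsub>S_power 4\<^esub>)"
      unfolding one using indep_origin[OF sat g tan] by simp
  qed
  then have "Stab M_struct {} (S_power 4) q = {\<one>\<^bsub>S_power 4\<^esub>}"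
    using stabilizer_trivial[OF sat g tan] unfolding assms(8) by blast
  moreover have "M_struct (Tan quadric) ?x" using tan unfolding M_struct_Tan_quadric .
  moreover have "\<not> almost_internal M_struct {} sort_P q"
    unfolding assms(8) by (rule not_almost_internal_P[OF sat g tan])
  ultimately show ?thesis unfolding quadric_def by blast
qed

end
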